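(* Let $C$ be a generic curve on a surface $S$ such that the chord diagram of $C$ is orientable and each connected component of $S\setminus C$ is a disk. Then $C$ realizes the homology class dual to the first Stiefel--Whitney class $w_1(S)\in H^1(S;\mathbb Z/2\mathbb Z)$ of the surface.
   Context: A generic curve on a surface $S$ (orientable or not) is the image of a generic immersion of a closed 1-manifold to $S$, i.e. an immersion whose multiple points are transversal double points only. Its chord diagram consists of the source 1-manifold (the base) and, for each double point, a chord connecting the two points of the base mapped to it. The curve is considered as a 1-cycle with coefficients in $\mathbb Z/2\mathbb Z$; it realizes the class (Poincaré) dual to $w_1(S)$ if for each loop on $S$ in general position to the curve, the value of $w_1(S)$ on the loop equals the number of intersection points of the loop and the curve modulo 2. Orientation of a chord diagram: the end points of chords divide the base into arcs. An orientation of the chord diagram is a choice of orientations of all these arcs such that (1) at each end point of a chord the orientations of the two adjacent arcs do not extend over the point: either both arcs are directed towards the point (the point is attractive) or both are directed away from it (the point is repulsive); (2) for each chord, one of its end points is attractive and the other one is repulsive. A chord diagram is orientable if it admits an orientation. *)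

theory Defs
  imports "HOL-Analysis.Analysis" "HOL-Library.Z2"
begin

section \<open>Smooth maps between Euclidean spaces\<close>

text \<open>The predicates below are used for open sets \<open>S\<close> only.\<close>

primrec Ck_on :: "nat \<Rightarrow> 'a::euclidean_space set \<Rightarrow> ('a \<Rightarrow> 'b::euclidean_space) \<Rightarrow> bool" where
  "Ck_on 0 S f \<longleftrightarrow> continuous_on S f"
| "Ck_on (Suc k) S f \<longleftrightarrow>
     (\<forall>x\<in>S. f differentiable (at x)) \<and>
     (\<forall>v. Ck_on k S (\<lambda>x. frechet_derivative f (at x) v))"

definition smooth_on :: "'a::euclidean_space set \<Rightarrow> ('a \<Rightarrow> 'b::euclidean_space) \<Rightarrow> bool" where
  "smooth_on S f \<longleftrightarrow> (\<forall>k. Ck_on k S f)"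

section \<open>Smooth manifolds\<close>

text \<open>A chart is a pair of a domain and a coordinate map; the values of the coordinate map outside
  the domain are irrelevant.\<close>

type_synonym ('a, 'e) chart = "'a set \<times> ('a \<Rightarrow> 'e)"

abbreviation chart_dom :: "('a, 'e) chart \<Rightarrow> 'a set" where
  "chart_dom c \<equiv> fst c"

abbreviation coord :: "('a, 'e) chart \<Rightarrow> 'a \<Rightarrow> 'e" where
  "coord c \<equiv> snd c"

definition is_chart :: "'a topology \<Rightarrow> ('a, 'e::euclidean_space) chart \<Rightarrow> bool" where
  "is_chart X c \<longleftrightarrow>
     openin X (chart_dom c) \<and> open (coord c ` chart_dom c) \<and>
     homeomorphic_map (subtopology X (chart_dom c)) (top_of_set (coord c ` chart_dom c)) (coord c)"

definition in_charts ::
    "('a, 'e) chart \<Rightarrow> ('b, 'f) chart \<Rightarrow> ('a \<Rightarrow> 'b) \<Rightarrow> 'e \<Rightarrow> 'f" where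
  "in_charts c d f = coord d \<circ> f \<circ> inv_into (chart_dom c) (coord c)"

definition smooth_atlas :: "'a topology \<Rightarrow> ('a, 'e::euclidean_space) chart set \<Rightarrow> bool" where
  "smooth_atlas X A \<longleftrightarrow>
     (\<forall>c\<in>A. is_chart X c) \<and> (\<Union>c\<in>A. chart_dom c) = topspace X \<and>
     (\<forall>c\<in>A. \<forall>d\<in>A. smooth_on (coord c ` (chart_dom c \<inter> chart_dom d)) (in_charts c d id))"

definition second_countable :: "'a topology \<Rightarrow> bool" where
  "second_countable X \<longleftrightarrow>
     (\<exists>\<B>. countable \<B> \<and> (\<forall>V\<in>\<B>. openin X V) \<and>
        (\<forall>U x. openin X U \<and> x \<in> U \<longrightarrow> (\<exists>V\<in>\<B>. x \<in> V \<and> V \<subseteq> U)))"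

text \<open>Manifolds without boundary, neither compact nor connected in general. The dimension is
  that of the type \<open>'e\<close>. The atlas is not required to be maximal.\<close>

definition smooth_manifold :: "'a topology \<Rightarrow> ('a, 'e::euclidean_space) chart set \<Rightarrow> bool" where
  "smooth_manifold X A \<longleftrightarrow> Hausdorff_space X \<and> second_countable X \<and> smooth_atlas X A"

definition surface :: "'a topology \<Rightarrow> ('a, real ^ 2) chart set \<Rightarrow> bool" where
  "surface S A \<longleftrightarrow> smooth_manifold S A"

definition closed_1_manifold :: "'b topology \<Rightarrow> ('b, real) chart set \<Rightarrow> bool" where
  "closed_1_manifold M B \<longleftrightarrow> smooth_manifold M B \<and> compact_space M"

definition smooth_map ::
    "'a topology \<Rightarrow> ('a, 'e::euclidean_space) chart set \<Rightarrow>
     'b topology \<Rightarrow> ('b, 'f::euclidean_space) chart set \<Rightarrow> ('a \<Rightarrow> 'b) \<Rightarrow> bool" where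
  "smooth_map X A Y B f \<longleftrightarrow>
     continuous_map X Y f \<and>
     (\<forall>c\<in>A. \<forall>d\<in>B. smooth_on (coord c ` {p \<in> chart_dom c. f p \<in> chart_dom d}) (in_charts c d f))"

definition deriv_in_charts ::
    "('a, 'e::euclidean_space) chart \<Rightarrow> ('b, 'f::euclidean_space) chart \<Rightarrow> ('a \<Rightarrow> 'b) \<Rightarrow>
     'a \<Rightarrow> 'e \<Rightarrow> 'f" where
  "deriv_in_charts c d f p = frechet_derivative (in_charts c d f) (at (coord c p))"

definition immersion ::
    "'a topology \<Rightarrow> ('a, 'e::euclidean_space) chart set \<Rightarrow>
     'b topology \<Rightarrow> ('b, 'f::euclidean_space) chart set \<Rightarrow> ('a \<Rightarrow> 'b) \<Rightarrow> bool" where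
  "immersion X A Y B f \<longleftrightarrow>
     smooth_map X A Y B f \<and>
     (\<forall>c\<in>A. \<forall>d\<in>B. \<forall>p\<in>chart_dom c. f p \<in> chart_dom d \<longrightarrow> inj (deriv_in_charts c d f p))"

text \<open>For \<open>f p = g q\<close>: the images of the differentials of \<open>f\<close> at \<open>p\<close> and of \<open>g\<close> at \<open>q\<close> together
  span the tangent space of the target.\<close>

definition transverse_at ::
    "('a, 'e::euclidean_space) chart set \<Rightarrow> ('b, 'f::euclidean_space) chart set \<Rightarrow>
     ('c, 'g::euclidean_space) chart set \<Rightarrow> ('a \<Rightarrow> 'c) \<Rightarrow> ('b \<Rightarrow> 'c) \<Rightarrow> 'a \<Rightarrow> 'b \<Rightarrow> bool" where
  "transverse_at A B C f g p q \<longleftrightarrow>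
     (\<forall>a\<in>A. \<forall>b\<in>B. \<forall>c\<in>C.
        p \<in> chart_dom a \<and> q \<in> chart_dom b \<and> f p \<in> chart_dom c \<and> g q \<in> chart_dom c \<longrightarrow>
        {u + v |u v. u \<in> range (deriv_in_charts a c f p) \<and> v \<in> range (deriv_in_charts b c g q)} = UNIV)"

section \<open>Generic curves and chord diagrams\<close>

definition generic_immersion ::
    "'b topology \<Rightarrow> ('b, real) chart set \<Rightarrow> 'a topology \<Rightarrow> ('a, real ^ 2) chart set \<Rightarrow>
     ('b \<Rightarrow> 'a) \<Rightarrow> bool" where
  "generic_immersion M B S A f \<longleftrightarrow>
     immersion M B S A f \<and>
     (\<forall>y. finite {p \<in> topspace M. f p = y} \<and> card {p \<in> topspace M. f p = y} \<le> 2) \<and>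
     (\<forall>p\<in>topspace M. \<forall>q\<in>topspace M. p \<noteq> q \<and> f p = f q \<longrightarrow> transverse_at B B A f f p q)"

text \<open>A chord diagram consists of a base (a 1-manifold) and a set of chords, each chord being given
  as the set of its two end points.\<close>

definition chords :: "'b topology \<Rightarrow> ('b \<Rightarrow> 'a) \<Rightarrow> 'b set set" where
  "chords M f = {{p, q} |p q. p \<in> topspace M \<and> q \<in> topspace M \<and> p \<noteq> q \<and> f p = f q}"

text \<open>An orientation of an open subset \<open>W\<close> of a 1-manifold gives, for each point \<open>p\<close> of \<open>W\<close> and each
  chart \<open>c\<close> around \<open>p\<close>, the sign \<open>dir p c\<close> that tells whether the direction chosen at \<open>p\<close> is that of
  increasing (\<open>1\<close>) or decreasing (\<open>-1\<close>) coordinate \<open>c\<close>. If \<open>W\<close> is the complement of the end points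
  of the chords, its connected components are the arcs, so an orientation of \<open>W\<close> is a choice of
  orientations of all the arcs.\<close>

definition orientation_1 ::
    "'b topology \<Rightarrow> ('b, real) chart set \<Rightarrow> 'b set \<Rightarrow> ('b \<Rightarrow> ('b, real) chart \<Rightarrow> real) \<Rightarrow> bool" where
  "orientation_1 M B W dir \<longleftrightarrow>
     (\<forall>c\<in>B. \<forall>p \<in> W \<inter> chart_dom c.
        dir p c \<in> {1, -1} \<and>
        (\<forall>\<^sub>F q in atin (subtopology M W) p. dir q c = dir p c) \<and>
        (\<forall>d\<in>B. p \<in> chart_dom d \<longrightarrow>
           dir p d = sgn (deriv (in_charts c d id) (coord c p)) * dir p c))"

text \<open>On both sides of \<open>e\<close> the chosen direction points towards (respectively, away from) \<open>e\<close>.\<close>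

definition attractive ::
    "'b topology \<Rightarrow> ('b, real) chart set \<Rightarrow> ('b \<Rightarrow> ('b, real) chart \<Rightarrow> real) \<Rightarrow> 'b \<Rightarrow> bool" where
  "attractive M B dir e \<longleftrightarrow>
     (\<forall>c\<in>B. e \<in> chart_dom c \<longrightarrow> (\<forall>\<^sub>F q in atin M e. dir q c = sgn (coord c e - coord c q)))"

definition repulsive ::
    "'b topology \<Rightarrow> ('b, real) chart set \<Rightarrow> ('b \<Rightarrow> ('b, real) chart \<Rightarrow> real) \<Rightarrow> 'b \<Rightarrow> bool" where
  "repulsive M B dir e \<longleftrightarrow>
     (\<forall>c\<in>B. e \<in> chart_dom c \<longrightarrow> (\<forall>\<^sub>F q in atin M e. dir q c = sgn (coord c q - coord c e)))"

definition chord_diagram_orientation ::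
    "'b topology \<Rightarrow> ('b, real) chart set \<Rightarrow> 'b set set \<Rightarrow>
     ('b \<Rightarrow> ('b, real) chart \<Rightarrow> real) \<Rightarrow> bool" where
  "chord_diagram_orientation M B K dir \<longleftrightarrow>
     orientation_1 M B (topspace M - \<Union>K) dir \<and>
     (\<forall>e\<in>\<Union>K. attractive M B dir e \<or> repulsive M B dir e) \<and>
     (\<forall>k\<in>K. \<exists>p q. k = {p, q} \<and> attractive M B dir p \<and> repulsive M B dir q)"

definition orientable_chord_diagram ::
    "'b topology \<Rightarrow> ('b, real) chart set \<Rightarrow> 'b set set \<Rightarrow> bool" where
  "orientable_chord_diagram M B K \<longleftrightarrow> (\<exists>dir. chord_diagram_orientation M B K dir)"

section \<open>The first Stiefel--Whitney class\<close>

text \<open>\<open>w\<^sub>1\<close> of a surface (that is, of its tangent bundle) is represented by the Cech cocycle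
  formed by the signs, written additively, of the Jacobians of the transition functions.\<close>

definition w1_cocycle :: "('a, real ^ 2) chart \<Rightarrow> ('a, real ^ 2) chart \<Rightarrow> 'a \<Rightarrow> bit" where
  "w1_cocycle c d p = (if det (matrix (deriv_in_charts c d id p)) < 0 then 1 else 0)"

text \<open>Loops are 1-periodic maps defined on the real line. A chain of charts along a loop is
  a subdivision \<open>0 = t 0 < \<dots> < t n = 1\<close> together with charts \<open>c i\<close>, \<open>i < n\<close>, such that \<open>c i\<close> covers the
  \<open>i\<close>-th piece of the loop. It is closed up cyclically by passing at time 1, i.e. at time 0, from
  \<open>c (n - 1)\<close> back to \<open>c 0\<close>.\<close>

definition chart_chain ::
    "('a, real ^ 2) chart set \<Rightarrow> (real \<Rightarrow> 'a) \<Rightarrow> nat \<Rightarrow> (nat \<Rightarrow> real) \<Rightarrow>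
     (nat \<Rightarrow> ('a, real ^ 2) chart) \<Rightarrow> bool" where
  "chart_chain A \<gamma> n t c \<longleftrightarrow>
     t 0 = 0 \<and> t n = 1 \<and>
     (\<forall>i<n. t i < t (Suc i) \<and> c i \<in> A \<and> \<gamma> ` {t i..t (Suc i)} \<subseteq> chart_dom (c i))"

text \<open>The value of \<open>w\<^sub>1\<close> on a loop; it does not depend on the chain of charts.\<close>

definition w1_on_loop :: "('a, real ^ 2) chart set \<Rightarrow> (real \<Rightarrow> 'a) \<Rightarrow> bit" where
  "w1_on_loop A \<gamma> =
     (THE w. \<exists>n t c. chart_chain A \<gamma> n t c \<and>
        w = (\<Sum>i<n. w1_cocycle (c i) (c (Suc i mod n)) (\<gamma> (t (Suc i)))))"

section \<open>Realizing the class dual to the first Stiefel--Whitney class\<close>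

abbreviation line_atlas :: "(real, real) chart set" where
  "line_atlas \<equiv> {(UNIV, id)}"

definition smooth_loop ::
    "'a topology \<Rightarrow> ('a, real ^ 2) chart set \<Rightarrow> (real \<Rightarrow> 'a) \<Rightarrow> bool" where
  "smooth_loop S A \<gamma> \<longleftrightarrow>
     smooth_map euclideanreal line_atlas S A \<gamma> \<and> (\<forall>t. \<gamma> (t + 1) = \<gamma> t)"

text \<open>A loop in general position to a curve avoids its double points and crosses it
  transversally.\<close>

definition general_position ::
    "'b topology \<Rightarrow> ('b, real) chart set \<Rightarrow> ('a, real ^ 2) chart set \<Rightarrow> ('b \<Rightarrow> 'a) \<Rightarrow>
     (real \<Rightarrow> 'a) \<Rightarrow> bool" where
  "general_position M B A f \<gamma> \<longleftrightarrow>
     (\<forall>t. \<forall>p\<in>topspace M. \<gamma> t = f p \<longrightarrow>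
        (\<forall>q\<in>topspace M. f q = f p \<longrightarrow> q = p) \<and> transverse_at line_atlas B A \<gamma> f t p)"

text \<open>Intersection points are counted on the loop, i.e. with multiplicity if the loop passes
  several times through the same point of the curve.\<close>

definition realizes_dual_w1 ::
    "'b topology \<Rightarrow> ('b, real) chart set \<Rightarrow> 'a topology \<Rightarrow> ('a, real ^ 2) chart set \<Rightarrow>
     ('b \<Rightarrow> 'a) \<Rightarrow> bool" where
  "realizes_dual_w1 M B S A f \<longleftrightarrow>
     (\<forall>\<gamma>. smooth_loop S A \<gamma> \<and> general_position M B A f \<gamma> \<longrightarrow>
        w1_on_loop A \<gamma> = of_nat (card {t \<in> {0..<1}. \<gamma> t \<in> f ` topspace M}))"

end

theory Submission
  imports Defs
begin

text \<open>Write \<open>C\<close> for the image of the curve. At a double point, an orientation of the chord diagram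
  lets one branch run into the point from both sides and the other branch run out of it on both
  sides. So the four edges that end there are alternately incoming and outgoing, and every corner of
  \<open>S - C\<close> lies between an incoming and an outgoing edge: seen from the corner, the two edges bound
  it coherently, both from the left or both from the right. Therefore the rule ``positive to the left
  of \<open>C\<close>, negative to the right of \<open>C\<close>'' (with respect to a local orientation of \<open>S\<close>) defines one
  orientation of \<open>N - C\<close> for some neighbourhood \<open>N\<close> of \<open>C\<close>, including the double points, although
  it is reversed whenever \<open>C\<close> is crossed.

  A face, i.e. a component of \<open>S - C\<close>, is an open disk. Being simply connected, it has an orientation.
  Having a single end, it has a connected part close to \<open>C\<close>, so this orientation agrees there
  everywhere or nowhere with the one given by the rule, and after a change of sign it agrees
  everywhere. The faces together thus carry an orientation of \<open>S - C\<close> that is reversed by each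
  crossing of \<open>C\<close>. Transport it along a loop: in terms of charts the total change of sign is the
  product of the signs of the Jacobians, which is the value of \<open>w\<^sub>1\<close>, and it is also the
  parity of the number of crossings.

  An orientation of a part of \<open>S\<close> is recorded as a sign \<open>\<epsilon> x\<close> for each point, relative to a
  chart chosen once for that point; the predicate \<open>orients\<close> expresses local constancy in charts.
  The rule above is expressed at regular points only, by the predicate \<open>adapted\<close>: it prescribes the
  signs along every path that crosses \<open>C\<close> transversally. This is what a loop needs in the end, and it
  determines the orientation on both sides of \<open>C\<close> (\<open>adapted_agree\<close>), so that local solutions
  can be glued. The proof rests on \<open>double_patch\<close> (the rule is consistent around a double point),
  \<open>orientation_near_curve\<close>, \<open>face_orientation\<close>, \<open>complement_orientation\<close> and
  \<open>w1_sum_eq_crossings\<close>.\<close>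

section \<open>Coordinate charts\<close>

abbreviation param :: "('a, 'e) chart \<Rightarrow> 'e \<Rightarrow> 'a" where
  "param c \<equiv> inv_into (chart_dom c) (coord c)"

abbreviation chart_image :: "('a, 'e) chart \<Rightarrow> 'e set" where
  "chart_image c \<equiv> coord c ` chart_dom c"

lemma chart_openin: "is_chart X c \<Longrightarrow> openin X (chart_dom c)"
  and chart_open_image: "is_chart X c \<Longrightarrow> open (chart_image c)"
  by (auto simp: is_chart_def)

lemma chart_inj: "is_chart X c \<Longrightarrow> inj_on (coord c) (chart_dom c)"
  by (metis homeomorphic_imp_injective_map inf.absorb2 is_chart_def openin_subset
      topspace_subtopology)

lemma param_coord: "is_chart X c \<Longrightarrow> x \<in> chart_dom c \<Longrightarrow> param c (coord c x) = x"
  by (simp add: chart_inj inv_into_f_f)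

lemma coord_param: "w \<in> chart_image c \<Longrightarrow> coord c (param c w) = w"
  and param_in: "w \<in> chart_image c \<Longrightarrow> param c w \<in> chart_dom c"
  by (auto simp: f_inv_into_f inv_into_into)

lemma chart_subset: "is_chart X c \<Longrightarrow> chart_dom c \<subseteq> topspace X"
  by (simp add: is_chart_def openin_subset)

lemma chart_homeomorphic_maps:
  assumes "is_chart X c"
  shows "homeomorphic_maps (subtopology X (chart_dom c)) (top_of_set (chart_image c)) (coord c) (param c)"
proof -
  have *: "homeomorphic_map (subtopology X (chart_dom c)) (top_of_set (chart_image c)) (coord c)"
    using assms by (simp add: is_chart_def)
  then obtain g where g: "homeomorphic_maps (subtopology X (chart_dom c)) (top_of_set (chart_image c)) (coord c) g"
    using homeomorphic_map_maps by blast
  have ts: "topspace (subtopology X (chart_dom c)) = chart_dom c"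
    using chart_subset[OF assms] by auto
  show ?thesis
  proof (rule homeomorphic_maps_eq[OF g])
    fix w assume "w \<in> topspace (top_of_set (chart_image c))"
    then obtain x where "x \<in> chart_dom c" "w = coord c x" by auto
    then show "g w = param c w"
      using g ts assms by (simp add: homeomorphic_maps_def param_coord)
  qed auto
qed

lemma continuous_map_coord:
  "is_chart X c \<Longrightarrow> continuous_map (subtopology X (chart_dom c)) euclidean (coord c)"
  using chart_homeomorphic_maps unfolding homeomorphic_maps_def
  using continuous_map_in_subtopology by blast

lemma continuous_map_param:
  "is_chart X c \<Longrightarrow> continuous_map (top_of_set (chart_image c)) X (param c)"
  using chart_homeomorphic_maps unfolding homeomorphic_maps_def
  using continuous_map_in_subtopology by blast

lemma openin_coord_vimage:
  assumes "is_chart X c" "open W"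
  shows "openin X {x \<in> chart_dom c. coord c x \<in> W}"
proof -
  have ts: "topspace (subtopology X (chart_dom c)) = chart_dom c"
    using chart_subset[OF assms(1)] by auto
  have "openin (subtopology X (chart_dom c)) {x \<in> chart_dom c. coord c x \<in> W}"
    using openin_continuous_map_preimage[OF continuous_map_coord[OF assms(1)], of W] assms(2)
    unfolding ts by (simp only: open_openin)
  then show ?thesis
    by (rule openin_trans_full[OF _ chart_openin[OF assms(1)]])
qed

lemma open_coord_image:
  assumes "is_chart X c" "openin X U"
  shows "open (coord c ` (U \<inter> chart_dom c))"
proof -
  have "openin (top_of_set (chart_image c)) {w \<in> topspace (top_of_set (chart_image c)). param c w \<in> U}"
    using openin_continuous_map_preimage[OF continuous_map_param[OF assms(1)] assms(2)] .
  moreover have "{w \<in> topspace (top_of_set (chart_image c)). param c w \<in> U} = coord c ` (U \<inter> chart_dom c)"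
    using assms(1) by (auto simp: param_coord)
  ultimately show ?thesis
    using chart_open_image[OF assms(1)] openin_open_eq by metis
qed

lemma openin_param_image:
  assumes "is_chart X c" "open W" "W \<subseteq> chart_image c"
  shows "openin X (param c ` W)"
proof -
  have "param c ` W \<subseteq> {x \<in> chart_dom c. coord c x \<in> W}"
  proof
    fix x assume "x \<in> param c ` W"
    then obtain w where w: "w \<in> W" "x = param c w" by blast
    then have wi: "w \<in> chart_image c" using assms(3) by blast
    show "x \<in> {x \<in> chart_dom c. coord c x \<in> W}"
      unfolding w(2) mem_Collect_eq coord_param[OF wi]
      using w(1) param_in[OF wi] by (rule conjI[rotated])
  qed
  moreover have "{x \<in> chart_dom c. coord c x \<in> W} \<subseteq> param c ` W"
  proof
    fix x assume "x \<in> {x \<in> chart_dom c. coord c x \<in> W}"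
    then have "x = param c (coord c x)" "coord c x \<in> W"
      using param_coord[OF assms(1)] by auto
    then show "x \<in> param c ` W" by blast
  qed
  ultimately have "param c ` W = {x \<in> chart_dom c. coord c x \<in> W}" by blast
  then show ?thesis
    using openin_coord_vimage[OF assms(1,2)] by simp
qed

lemma connectedin_param_image:
  assumes "is_chart X c" "connected W" "W \<subseteq> chart_image c"
  shows "connectedin X (param c ` W)"
  using connectedin_continuous_map_image[OF continuous_map_param[OF assms(1)]] assms
  by (simp add: connectedin_subtopology)

lemma compactin_param_image:
  assumes "is_chart X c" "compact W" "W \<subseteq> chart_image c"
  shows "compactin X (param c ` W)"
  using image_compactin[OF _ continuous_map_param[OF assms(1)]] assms
  by (simp add: compactin_subtopology)

section \<open>Derivatives of smooth maps\<close>

lemma smooth_on_has_derivative: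
  assumes "smooth_on U g" "x \<in> U"
  shows "(g has_derivative frechet_derivative g (at x)) (at x)"
proof -
  have "Ck_on (Suc 0) U g" using assms by (simp add: smooth_on_def)
  then show ?thesis using assms(2) frechet_derivative_works by auto
qed

lemma smooth_on_continuous_derivative:
  assumes "smooth_on U g"
  shows "continuous_on U (\<lambda>x. frechet_derivative g (at x) v)"
proof -
  have "Ck_on (Suc 0) U g" using assms by (simp add: smooth_on_def)
  then show ?thesis by simp
qed

text \<open>The oriented area of the parallelogram spanned by two vectors.\<close>

definition cross :: "real ^ 2 \<Rightarrow> real ^ 2 \<Rightarrow> real" where
  "cross u v = u $ 1 * v $ 2 - u $ 2 * v $ 1"

lemma cross_simps [simp]: "cross u 0 = 0" "cross 0 u = 0" "cross u u = 0"
  and cross_add: "cross (u + u') v = cross u v + cross u' v" "cross u (v + v') = cross u v + cross u v'"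
  and cross_scale: "cross (r *\<^sub>R u) v = r * cross u v" "cross u (r *\<^sub>R v) = r * cross u v"
  and cross_swap: "cross v u = - cross u v"
  by (auto simp: cross_def algebra_simps)

lemma vec2_expand: "(v :: real ^ 2) = v $ 1 *\<^sub>R axis 1 1 + v $ 2 *\<^sub>R axis 2 1"
  by (simp add: vec_eq_iff forall_2 axis_def)

lemma det_matrix_cross:
  "det (matrix (L :: real ^ 2 \<Rightarrow> real ^ 2)) = cross (L (axis 1 1)) (L (axis 2 1))"
  by (simp add: det_2 matrix_def cross_def)

text \<open>The reason why signs of Jacobians describe the change of left and right.\<close>

lemma cross_linear:
  assumes "linear L"
  shows "cross (L u) (L v) = det (matrix L) * cross u v"
proof -
  have "L w = w $ 1 *\<^sub>R L (axis 1 1) + w $ 2 *\<^sub>R L (axis 2 1)" for w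
    using arg_cong[OF vec2_expand[of w], of L] by (simp add: assms linear_add linear_scale)
  note * = this[of u] this[of v]
  show ?thesis
    unfolding * det_matrix_cross by (simp only: cross_add cross_scale cross_simps) (simp add: cross_swap[of "L (axis 2 1)"] cross_def[of u] algebra_simps)
qed

lemma continuous_cross [continuous_intros]:
  "continuous_on U f \<Longrightarrow> continuous_on U g \<Longrightarrow> continuous_on U (\<lambda>x. cross (f x) (g x))"
  unfolding cross_def by (intro continuous_intros)

lemma cross_rotate_pos:
  fixes u :: "real ^ 2"
  assumes "u \<noteq> 0"
  shows "cross u (vector [- u $ 2, u $ 1]) > 0"
proof -
  have "cross u (vector [- u $ 2, u $ 1]) = u $ 1 * u $ 1 + u $ 2 * u $ 2"
    by (simp add: cross_def)
  moreover have "u $ 1 \<noteq> 0 \<or> u $ 2 \<noteq> 0" using assms by (simp add: vec_eq_iff forall_2)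
  then have "u $ 1 * u $ 1 + u $ 2 * u $ 2 > 0" by (metis sum_squares_gt_zero_iff)
  ultimately show ?thesis by simp
qed

text \<open>Turns transversality, as a statement about images of differentials, into the nonvanishing of an
  area. Were it zero, every vector would be parallel to \<open>K 1\<close>, including \<open>K 1\<close> turned by a right angle.\<close>

lemma cross_nonzero_if_spanning:
  fixes L K :: "real \<Rightarrow> real ^ 2"
  assumes "linear L" "linear K" "{u + v |u v. u \<in> range L \<and> v \<in> range K} = UNIV" "K 1 \<noteq> 0"
  shows "cross (L 1) (K 1) \<noteq> 0"
proof
  assume 0: "cross (L 1) (K 1) = 0"
  have LK: "L h = h *\<^sub>R L 1" "K h = h *\<^sub>R K 1" for h
    using linear_scale[OF assms(1), of h 1] linear_scale[OF assms(2), of h 1] by simp_all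
  have "cross (K 1) z = 0" for z
  proof -
    have "z \<in> {u + v |u v. u \<in> range L \<and> v \<in> range K}" using assms(3) by blast
    then obtain h h' where "z = L h + K h'" by blast
    then have "z = h *\<^sub>R L 1 + h' *\<^sub>R K 1" using LK by metis
    then show ?thesis using 0 by (simp add: cross_add cross_scale cross_swap[of "L 1"])
  qed
  then show False using cross_rotate_pos[OF assms(4)] by simp
qed

section \<open>Maps in charts\<close>

lemma in_charts_coord:
  "is_chart X b \<Longrightarrow> p \<in> chart_dom b \<Longrightarrow> in_charts b c f (coord b p) = coord c (f p)"
  by (simp add: in_charts_def param_coord)

lemma in_charts_id_has_derivative:
  assumes "is_chart X c"  "p \<in> chart_dom c"
  shows "(in_charts c c id has_derivative id) (at (coord c p))"
proof (rule has_derivative_transform_within_open[where f=id and s="chart_image c"])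
  show "open (chart_image c)" using assms(1) by (rule chart_open_image)
  show "id w = in_charts c c id w" if "w \<in> chart_image c" for w
    using coord_param[OF that] by (simp add: in_charts_def)
qed (use assms(2) in \<open>auto simp: id_def\<close>)

text \<open>The chain rule. Coordinate maps are arbitrary off their domains, so the two sides agree only on an
  open neighbourhood of the point; this is where continuity of \<open>f\<close> enters.\<close>

lemma in_charts_compose_has_derivative:
  assumes b: "is_chart X b" and c: "is_chart Y c" and f: "continuous_map X Y f"
    and p: "p \<in> chart_dom b" "f p \<in> chart_dom c"
    and df: "(in_charts b c f has_derivative L) (at (coord b p))"
    and dg: "(in_charts c d g has_derivative K) (at (coord c (f p)))"
  shows "(in_charts b d (g \<circ> f) has_derivative (K \<circ> L)) (at (coord b p))"
proof -
  define U where "U = coord b ` ({q \<in> topspace X. f q \<in> chart_dom c} \<inter> chart_dom b)"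
  have "openin X {q \<in> topspace X. f q \<in> chart_dom c}"
    using f chart_openin[OF c] by (rule openin_continuous_map_preimage)
  then have oU: "open U"
    unfolding U_def by (rule open_coord_image[OF b])
  have pU: "coord b p \<in> U"
    using p chart_subset[OF b] by (auto simp: U_def)
  have hd: "((in_charts c d g \<circ> in_charts b c f) has_derivative (K \<circ> L)) (at (coord b p))"
    using df dg by (intro diff_chain_at) (simp_all add: in_charts_coord[OF b p(1)])
  have eq: "(in_charts c d g \<circ> in_charts b c f) w = in_charts b d (g \<circ> f) w" if "w \<in> U" for w
  proof -
    from that obtain q where q: "w = coord b q" "q \<in> chart_dom b" "f q \<in> chart_dom c"
      by (auto simp: U_def)
    then show ?thesis
      by (simp add: in_charts_coord[OF b] in_charts_coord[OF c])
  qed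
  show ?thesis
    by (rule has_derivative_transform_within_open[OF hd oU pU eq])
qed

lemma smooth_map_has_derivative:
  assumes "smooth_map X A Y B f" "c \<in> A" "d \<in> B" "p \<in> chart_dom c" "f p \<in> chart_dom d"
  shows "(in_charts c d f has_derivative deriv_in_charts c d f p) (at (coord c p))"
proof -
  have "smooth_on (coord c ` {p \<in> chart_dom c. f p \<in> chart_dom d}) (in_charts c d f)"
    using assms by (simp add: smooth_map_def)
  then show ?thesis
    unfolding deriv_in_charts_def by (rule smooth_on_has_derivative) (use assms in auto)
qed

lemma smooth_atlas_smooth_map_id:
  assumes "smooth_atlas X A"
  shows "smooth_map X A X A id"
  unfolding smooth_map_def
proof (intro conjI ballI)
  fix c d assume "c \<in> A" "d \<in> A"
  moreover have "{p \<in> chart_dom c. id p \<in> chart_dom d} = chart_dom c \<inter> chart_dom d" by auto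
  ultimately show "smooth_on (coord c ` {p \<in> chart_dom c. id p \<in> chart_dom d}) (in_charts c d id)"
    using assms by (simp add: smooth_atlas_def)
qed (simp add: id_def)

lemma connectedin_locally_constant:
  assumes con: "connectedin X U"
    and loc: "\<And>x. x \<in> U \<Longrightarrow> \<exists>V. openin X V \<and> x \<in> V \<and> (\<forall>y\<in>V \<inter> U. q y = q x)"
    and x: "x \<in> U" and y: "y \<in> U"
  shows "q y = q x"
proof (rule ccontr)
  assume ne: "q y \<noteq> q x"
  define O1 where "O1 = \<Union>{V. openin X V \<and> (\<forall>z\<in>V \<inter> U. q z = q x)}"
  define O2 where "O2 = \<Union>{V. openin X V \<and> (\<forall>z\<in>V \<inter> U. q z \<noteq> q x)}"
  have "openin X O1" "openin X O2" unfolding O1_def O2_def by auto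
  moreover have "U \<subseteq> O1 \<union> O2"
  proof
    fix z assume z: "z \<in> U"
    from loc[OF z] obtain V where V: "openin X V" "z \<in> V" "\<forall>y\<in>V \<inter> U. q y = q z" by blast
    show "z \<in> O1 \<union> O2"
      using V by (cases "q z = q x") (auto simp: O1_def O2_def)
  qed
  moreover have "O1 \<inter> O2 \<inter> U = {}" by (auto simp: O1_def O2_def)
  moreover have "O1 \<inter> U \<noteq> {}" using loc[OF x] x by (auto simp: O1_def)
  moreover have "O2 \<inter> U \<noteq> {}"
  proof -
    from loc[OF y] obtain V where "openin X V" "y \<in> V" "\<forall>z\<in>V \<inter> U. q z = q y" by blast
    then have "y \<in> O2" using ne by (auto simp: O2_def)
    then show ?thesis using y by blast
  qed
  ultimately show False using con unfolding connectedin by blast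
qed

section \<open>Local orientations of a surface\<close>

definition jacobian_sign :: "('a, real ^ 2) chart \<Rightarrow> ('a, real ^ 2) chart \<Rightarrow> 'a \<Rightarrow> real" where
  "jacobian_sign c d x = sgn (det (matrix (deriv_in_charts c d id x)))"

locale surface_atlas =
  fixes S :: "'a topology" and A :: "('a, real ^ 2) chart set"
  assumes surface: "surface S A"
begin

lemma atlas: "smooth_atlas S A"
  and Hausdorff: "Hausdorff_space S"
  using surface by (auto simp: surface_def smooth_manifold_def)

lemma atlas_chart: "c \<in> A \<Longrightarrow> is_chart S c"
  using atlas by (simp add: smooth_atlas_def)

lemma atlas_cover: "x \<in> topspace S \<Longrightarrow> \<exists>c\<in>A. x \<in> chart_dom c"
  using atlas by (auto simp: smooth_atlas_def)

lemma atlas_topspace: "c \<in> A \<Longrightarrow> x \<in> chart_dom c \<Longrightarrow> x \<in> topspace S"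
  using atlas by (auto simp: smooth_atlas_def)

lemma transition_has_derivative:
  assumes "c \<in> A" "d \<in> A" "x \<in> chart_dom c" "x \<in> chart_dom d"
  shows "(in_charts c d id has_derivative deriv_in_charts c d id x) (at (coord c x))"
  by (rule smooth_map_has_derivative[OF smooth_atlas_smooth_map_id[OF atlas]]) (use assms in auto)

lemma transition_linear:
  assumes "c \<in> A" "d \<in> A" "x \<in> chart_dom c" "x \<in> chart_dom d"
  shows "linear (deriv_in_charts c d id x)"
  using transition_has_derivative[OF assms] by (rule has_derivative_linear)

lemma transition_compose:
  assumes "c \<in> A" "d \<in> A" "e \<in> A" "x \<in> chart_dom c" "x \<in> chart_dom d" "x \<in> chart_dom e"
  shows "deriv_in_charts c e id x = deriv_in_charts d e id x \<circ> deriv_in_charts c d id x"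
proof -
  have "(in_charts c e (id \<circ> id) has_derivative
      (deriv_in_charts d e id x \<circ> deriv_in_charts c d id x)) (at (coord c x))"
  proof (rule in_charts_compose_has_derivative[OF atlas_chart[OF assms(1)] atlas_chart[OF assms(2)]])
    show "continuous_map S S id" by (simp add: id_def)
    show "(in_charts d e id has_derivative deriv_in_charts d e id x) (at (coord d (id x)))"
      using transition_has_derivative[OF assms(2,3,5,6)] by simp
  qed (use assms transition_has_derivative[OF assms(1,2,4,5)] in simp_all)
  then show ?thesis
    using transition_has_derivative[OF assms(1,3,4,6)] has_derivative_unique by auto
qed

lemma transition_refl:
  assumes "c \<in> A" "x \<in> chart_dom c"
  shows "deriv_in_charts c c id x = id"
  using transition_has_derivative[OF assms(1,1,2,2)]
    in_charts_id_has_derivative[OF atlas_chart[OF assms(1)] assms(2)]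
  by (rule has_derivative_unique)

lemma jacobian_sign_cocycle:
  assumes "c \<in> A" "d \<in> A" "e \<in> A" "x \<in> chart_dom c" "x \<in> chart_dom d" "x \<in> chart_dom e"
  shows "jacobian_sign c e x = jacobian_sign c d x * jacobian_sign d e x"
  unfolding jacobian_sign_def transition_compose[OF assms]
  by (subst matrix_compose) (simp_all add: assms transition_linear det_mul sgn_mult)

lemma jacobian_sign_refl: "c \<in> A \<Longrightarrow> x \<in> chart_dom c \<Longrightarrow> jacobian_sign c c x = 1"
  by (simp add: jacobian_sign_def transition_refl matrix_id_mat_1[unfolded mat_def] flip: mat_def)

lemma jacobian_sign_square:
  assumes "c \<in> A" "d \<in> A" "x \<in> chart_dom c" "x \<in> chart_dom d"
  shows "jacobian_sign c d x \<in> {1, -1}" "jacobian_sign c d x * jacobian_sign c d x = 1" "jacobian_sign d c x = jacobian_sign c d x"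
proof -
  have *: "jacobian_sign c d x * jacobian_sign d c x = 1"
    using jacobian_sign_cocycle[of c d c x] assms by (simp add: jacobian_sign_refl)
  moreover have "sgn r \<in> {1, 0, -1}" for r :: real by (auto simp: sgn_if)
  then have "jacobian_sign c d x \<in> {1, 0, -1}" "jacobian_sign d c x \<in> {1, 0, -1}"
    unfolding jacobian_sign_def by blast+
  ultimately show "jacobian_sign c d x \<in> {1, -1}" "jacobian_sign c d x * jacobian_sign c d x = 1" "jacobian_sign d c x = jacobian_sign c d x"
    by auto
qed

lemma jacobian_sign_locally_constant:
  assumes "c \<in> A" "d \<in> A" "x \<in> chart_dom c" "x \<in> chart_dom d"
  shows "\<exists>V. openin S V \<and> x \<in> V \<and> V \<subseteq> chart_dom c \<inter> chart_dom d \<and> (\<forall>y\<in>V. jacobian_sign c d y = jacobian_sign c d x)"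
proof -
  define U where "U = coord c ` (chart_dom c \<inter> chart_dom d)"
  define g where "g w = frechet_derivative (in_charts c d id) (at w)" for w
  define h where "h w = cross (g w (axis 1 1)) (g w (axis 2 1))" for w
  have "open U"
    unfolding U_def using open_coord_image[OF atlas_chart[OF assms(1)] chart_openin[OF atlas_chart[OF assms(2)]]]
    by (simp add: Int_commute)
  have "smooth_on U (in_charts c d id)"
    using atlas assms by (simp add: smooth_atlas_def U_def)
  then have ch: "continuous_on U h"
    unfolding h_def g_def by (intro continuous_cross smooth_on_continuous_derivative)
  have jh: "jacobian_sign c d y = sgn (h (coord c y))" for y
    by (simp add: jacobian_sign_def deriv_in_charts_def h_def g_def det_matrix_cross)
  define W where "W = U \<inter> (\<lambda>w. h w * h (coord c x)) -` {0<..}"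
  have "open W"
    unfolding W_def using \<open>open U\<close> ch by (intro continuous_open_preimage continuous_intros) auto
  have nz: "h (coord c x) \<noteq> 0"
    using jacobian_sign_square(1)[OF assms] jh[of x] by auto
  define V where "V = {y \<in> chart_dom c. coord c y \<in> W}"
  have "openin S V"
    unfolding V_def by (rule openin_coord_vimage[OF atlas_chart[OF assms(1)] \<open>open W\<close>])
  moreover have "x \<in> V"
  proof -
    have "h (coord c x) * h (coord c x) > 0" using nz not_real_square_gt_zero by blast
    then show ?thesis using assms by (auto simp: V_def W_def U_def)
  qed
  moreover have "V \<subseteq> chart_dom c \<inter> chart_dom d"
  proof
    fix y assume "y \<in> V"
    then have "y \<in> chart_dom c" "coord c y \<in> U" by (auto simp: V_def W_def)
    then show "y \<in> chart_dom c \<inter> chart_dom d"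
      unfolding U_def using chart_inj[OF atlas_chart[OF assms(1)]] by (auto dest: inj_onD)
  qed
  moreover have "jacobian_sign c d y = jacobian_sign c d x" if "y \<in> V" for y
  proof -
    have "h (coord c y) * h (coord c x) > 0" using that by (simp add: V_def W_def)
    then show ?thesis unfolding jh by (auto simp: zero_less_mult_iff)
  qed
  ultimately show ?thesis by blast
qed

lemma w1_cocycle_jsign:
  assumes "c \<in> A" "d \<in> A" "x \<in> chart_dom c" "x \<in> chart_dom d"
  shows "jacobian_sign c d x = (if w1_cocycle c d x = 0 then 1 else -1)"
  using jacobian_sign_square(1)[OF assms] by (auto simp: w1_cocycle_def jacobian_sign_def sgn_if split: if_splits)

text \<open>A reference chart at each point. It makes a local orientation at \<open>x\<close> a single number, so
  that two orientations can be compared by plain equality, and the cocycle condition is automatic.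
  No continuity in \<open>x\<close> is to be expected.\<close>

definition home_chart :: "'a \<Rightarrow> ('a, real ^ 2) chart" where
  "home_chart x = (SOME c. c \<in> A \<and> x \<in> chart_dom c)"

lemma home_chart: "x \<in> topspace S \<Longrightarrow> home_chart x \<in> A" "x \<in> topspace S \<Longrightarrow> x \<in> chart_dom (home_chart x)"
  using someI_ex[of "\<lambda>c. c \<in> A \<and> x \<in> chart_dom c"] atlas_cover[of x] unfolding home_chart_def
  by blast+

text \<open>The sign of the orientation \<open>\<epsilon>\<close> with respect to the chart \<open>c\<close>: \<open>1\<close> if \<open>c\<close> preserves orientation.\<close>

definition local_sign :: "('a \<Rightarrow> real) \<Rightarrow> 'a \<Rightarrow> ('a, real ^ 2) chart \<Rightarrow> real" where
  "local_sign \<epsilon> x c = jacobian_sign (home_chart x) c x * \<epsilon> x"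

definition orients :: "'a set \<Rightarrow> ('a \<Rightarrow> real) \<Rightarrow> bool" where
  "orients U \<epsilon> \<longleftrightarrow> U \<subseteq> topspace S \<and> (\<forall>x\<in>U. \<epsilon> x \<in> {1, -1} \<and>
     (\<forall>c\<in>A. x \<in> chart_dom c \<longrightarrow> (\<exists>V. openin S V \<and> x \<in> V \<and> (\<forall>y\<in>V \<inter> U. local_sign \<epsilon> y c = local_sign \<epsilon> x c))))"

lemma local_sign_change:
  assumes "c \<in> A" "d \<in> A" "x \<in> chart_dom c" "x \<in> chart_dom d"
  shows "local_sign \<epsilon> x d = jacobian_sign c d x * local_sign \<epsilon> x c"
  using jacobian_sign_cocycle[OF home_chart(1) assms(1,2) home_chart(2) assms(3,4)] atlas_topspace[OF assms(1,3)]
  by (simp add: local_sign_def)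

text \<open>The sign of the transition function occurs twice. So a product of two orientations is a number
  that makes sense without a chart.\<close>

lemma local_sign_mult:
  assumes "c \<in> A" "x \<in> chart_dom c"
  shows "local_sign \<epsilon> x c * local_sign \<epsilon>' x c = \<epsilon> x * \<epsilon>' x"
proof -
  have "x \<in> topspace S" using atlas_topspace assms .
  then have "jacobian_sign (home_chart x) c x * jacobian_sign (home_chart x) c x = 1"
    using home_chart jacobian_sign_square(2) assms by blast
  then show ?thesis unfolding local_sign_def by (metis (no_types, lifting) mult.assoc mult.left_commute mult_1)
qed

lemma local_sign_eqD:
  assumes "c \<in> A" "x \<in> chart_dom c" "local_sign \<epsilon> x c = local_sign \<epsilon>' x c"
  shows "\<epsilon> x = \<epsilon>' x"
proof -
  have "x \<in> topspace S" using atlas_topspace assms by blast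
  then have "jacobian_sign (home_chart x) c x \<in> {1, -1}"
    using home_chart jacobian_sign_square(1) assms by blast
  then show ?thesis using assms(3) unfolding local_sign_def by auto
qed

lemma local_sign_values:
  assumes "c \<in> A" "x \<in> chart_dom c" "\<epsilon> x \<in> {1, -1}"
  shows "local_sign \<epsilon> x c \<in> {1, -1}"
proof -
  have "x \<in> topspace S" using atlas_topspace assms by blast
  then have "jacobian_sign (home_chart x) c x \<in> {1, -1}"
    using home_chart jacobian_sign_square(1) assms by blast
  then show ?thesis using assms(3) unfolding local_sign_def by auto
qed

text \<open>One chart around each point suffices, since signs of transition functions are locally constant.\<close>

lemma orientsI:
  assumes "U \<subseteq> topspace S"
    and "\<And>x. x \<in> U \<Longrightarrow> \<epsilon> x \<in> {1, -1}"
    and "\<And>x. x \<in> U \<Longrightarrow> \<exists>c V. c \<in> A \<and> x \<in> chart_dom c \<and> openin S V \<and> x \<in> V \<and> (\<forall>y\<in>V \<inter> U. local_sign \<epsilon> y c = local_sign \<epsilon> x c)"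
  shows "orients U \<epsilon>"
  unfolding orients_def
proof (intro conjI ballI impI)
  fix x d assume x: "x \<in> U" and d: "d \<in> A" "x \<in> chart_dom d"
  from assms(3)[OF x] obtain c V where c: "c \<in> A" "x \<in> chart_dom c" and V: "openin S V" "x \<in> V"
    "\<forall>y\<in>V \<inter> U. local_sign \<epsilon> y c = local_sign \<epsilon> x c" by blast
  from jacobian_sign_locally_constant[OF c(1) d(1) c(2) d(2)] obtain V' where
    V': "openin S V'" "x \<in> V'" "V' \<subseteq> chart_dom c \<inter> chart_dom d" "\<forall>y\<in>V'. jacobian_sign c d y = jacobian_sign c d x" by blast
  have "local_sign \<epsilon> y d = local_sign \<epsilon> x d" if "y \<in> (V \<inter> V') \<inter> U" for y
  proof -
    have "y \<in> chart_dom c" "y \<in> chart_dom d" using V' that by auto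
    then have "local_sign \<epsilon> y d = jacobian_sign c d y * local_sign \<epsilon> y c" by (rule local_sign_change[OF c(1) d(1)])
    also have "local_sign \<epsilon> y c = local_sign \<epsilon> x c" using V(3) that by blast
    also have "jacobian_sign c d y = jacobian_sign c d x" using V'(4) that by blast
    finally show ?thesis using local_sign_change[OF c(1) d(1) c(2) d(2), of \<epsilon>] by (rule trans[OF _ sym])
  qed
  then show "\<exists>V. openin S V \<and> x \<in> V \<and> (\<forall>y\<in>V \<inter> U. local_sign \<epsilon> y d = local_sign \<epsilon> x d)"
    using V V' by (intro exI[of _ "V \<inter> V'"]) auto
qed (use assms in auto)

lemma orients_local:
  assumes "orients U \<epsilon>" "x \<in> U" "c \<in> A" "x \<in> chart_dom c"
  obtains V where "openin S V" "x \<in> V" "V \<subseteq> chart_dom c" "\<forall>y\<in>V \<inter> U. local_sign \<epsilon> y c = local_sign \<epsilon> x c"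
proof -
  from assms obtain V where V: "openin S V" "x \<in> V" "\<forall>y\<in>V \<inter> U. local_sign \<epsilon> y c = local_sign \<epsilon> x c"
    unfolding orients_def by blast
  show thesis
    by (rule that[of "V \<inter> chart_dom c"]) (use V assms(3,4) chart_openin[OF atlas_chart[OF assms(3)]] in blast)+
qed

lemma orients_sign: "orients U \<epsilon> \<Longrightarrow> x \<in> U \<Longrightarrow> \<epsilon> x \<in> {1, -1}"
  and orients_topspace: "orients U \<epsilon> \<Longrightarrow> U \<subseteq> topspace S"
  by (auto simp: orients_def)

lemma orients_mono:
  assumes "orients U \<epsilon>" "U' \<subseteq> U"
  shows "orients U' \<epsilon>"
  unfolding orients_def
proof (intro conjI ballI impI)
  show "U' \<subseteq> topspace S" using assms orients_topspace by blast
  fix x assume "x \<in> U'"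
  then have x: "x \<in> U" using assms(2) by blast
  show "\<epsilon> x \<in> {1, -1}" using orients_sign[OF assms(1) x] .
  fix c assume c: "c \<in> A" "x \<in> chart_dom c"
  obtain V where "openin S V" "x \<in> V" "V \<subseteq> chart_dom c" "\<forall>y\<in>V \<inter> U. local_sign \<epsilon> y c = local_sign \<epsilon> x c"
    by (rule orients_local[OF assms(1) x c])
  then show "\<exists>V. openin S V \<and> x \<in> V \<and> (\<forall>y\<in>V \<inter> U'. local_sign \<epsilon> y c = local_sign \<epsilon> x c)"
    using assms(2) by blast
qed

text \<open>In a single chart, an orientation is the same thing as a locally constant sign \<open>h\<close>.\<close>

lemma orients_chart:
  assumes c: "c \<in> A" and U: "U \<subseteq> chart_dom c"
    and h: "\<And>x. x \<in> U \<Longrightarrow> h x \<in> {1, -1}"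
    and loc: "\<And>x. x \<in> U \<Longrightarrow> \<exists>V. openin S V \<and> x \<in> V \<and> (\<forall>y\<in>V \<inter> U. h y = h x)"
  shows "orients U (\<lambda>x. jacobian_sign (home_chart x) c x * h x)"
    and "x \<in> U \<Longrightarrow> local_sign (\<lambda>x. jacobian_sign (home_chart x) c x * h x) x c = h x"
proof -
  have s: "jacobian_sign (home_chart x) c x \<in> {1, -1}" if "x \<in> U" for x
    using that c U atlas_topspace[OF c] home_chart by (intro jacobian_sign_square(1)) auto
  have v: "local_sign (\<lambda>x. jacobian_sign (home_chart x) c x * h x) x c = h x" if "x \<in> U" for x
    using s[OF that] by (auto simp: local_sign_def)
  show "orients U (\<lambda>x. jacobian_sign (home_chart x) c x * h x)"
  proof (rule orientsI)
    fix x assume x: "x \<in> U"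
    show "jacobian_sign (home_chart x) c x * h x \<in> {1, -1}" using s[OF x] h[OF x] by auto
    from loc[OF x] obtain V where "openin S V" "x \<in> V" "\<forall>y\<in>V \<inter> U. h y = h x" by blast
    moreover have "local_sign (\<lambda>x. jacobian_sign (home_chart x) c x * h x) y c = local_sign (\<lambda>x. jacobian_sign (home_chart x) c x * h x) x c"
      if "y \<in> V \<inter> U" for y using that v[of y] v[OF x] calculation by simp
    ultimately show "\<exists>d V. d \<in> A \<and> x \<in> chart_dom d \<and> openin S V \<and> x \<in> V \<and>
        (\<forall>y\<in>V \<inter> U. local_sign (\<lambda>x. jacobian_sign (home_chart x) c x * h x) y d = local_sign (\<lambda>x. jacobian_sign (home_chart x) c x * h x) x d)"
      using c U x by blast
  qed (use U atlas_topspace[OF c] in auto)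
  show "x \<in> U \<Longrightarrow> local_sign (\<lambda>x. jacobian_sign (home_chart x) c x * h x) x c = h x" by (rule v)
qed

lemma orients_scale:
  assumes "orients U \<epsilon>" "r \<in> {1, -1}"
  shows "orients U (\<lambda>x. r * \<epsilon> x)"
proof -
  have "local_sign (\<lambda>x. r * \<epsilon> x) x c = r * local_sign \<epsilon> x c" for x c by (simp add: local_sign_def)
  then show ?thesis using assms unfolding orients_def by auto
qed

lemma orients_connected_ratio:
  assumes "orients U \<epsilon>" "orients U \<epsilon>'" "connectedin S U" "x \<in> U" "y \<in> U"
  shows "\<epsilon> y * \<epsilon>' y = \<epsilon> x * \<epsilon>' x"
proof (rule connectedin_locally_constant[OF assms(3) _ assms(4,5)])
  fix x assume x: "x \<in> U"
  then have "x \<in> topspace S" using assms(1) orients_topspace by blast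
  then obtain c where c: "c \<in> A" "x \<in> chart_dom c" using atlas_cover by blast
  obtain V where V: "openin S V" "x \<in> V" "V \<subseteq> chart_dom c"
    "\<forall>y\<in>V \<inter> U. local_sign \<epsilon> y c = local_sign \<epsilon> x c" by (rule orients_local[OF assms(1) x c])
  obtain V' where V': "openin S V'" "x \<in> V'" "V' \<subseteq> chart_dom c"
    "\<forall>y\<in>V' \<inter> U. local_sign \<epsilon>' y c = local_sign \<epsilon>' x c" by (rule orients_local[OF assms(2) x c])
  have "\<epsilon> y * \<epsilon>' y = \<epsilon> x * \<epsilon>' x" if "y \<in> (V \<inter> V') \<inter> U" for y
  proof -
    have "y \<in> chart_dom c" "local_sign \<epsilon> y c = local_sign \<epsilon> x c" "local_sign \<epsilon>' y c = local_sign \<epsilon>' x c"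
      using V(3,4) V'(4) that by blast+
    then show ?thesis
      using local_sign_mult[of c y \<epsilon> \<epsilon>'] local_sign_mult[of c x \<epsilon> \<epsilon>'] c by simp
  qed
  then show "\<exists>V. openin S V \<and> x \<in> V \<and> (\<forall>y\<in>V \<inter> U. \<epsilon> y * \<epsilon>' y = \<epsilon> x * \<epsilon>' x)"
    using openin_Int[OF V(1) V'(1)] V(2) V'(2) by blast
qed

lemma orients_connected_agree:
  assumes "orients U \<epsilon>" "orients U \<epsilon>'" "connectedin S U" "x \<in> U" "y \<in> U" "\<epsilon> x = \<epsilon>' x"
  shows "\<epsilon> y = \<epsilon>' y"
proof -
  have "\<epsilon> y * \<epsilon>' y = \<epsilon> x * \<epsilon>' x" by (rule orients_connected_ratio[OF assms(1-5)])
  also have "\<dots> = 1" using orients_sign[OF assms(1,4)] assms(6) by auto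
  finally show ?thesis using orients_sign[OF assms(1,5)] by auto
qed

lemma orients_locally:
  assumes "\<And>x. x \<in> U \<Longrightarrow> \<exists>V \<epsilon>'. openin S V \<and> x \<in> V \<and> orients (V \<inter> U) \<epsilon>' \<and> (\<forall>y\<in>V \<inter> U. \<epsilon> y = \<epsilon>' y)"
  shows "orients U \<epsilon>"
proof (rule orientsI)
  show "U \<subseteq> topspace S" using assms orients_topspace by blast
  fix x assume x: "x \<in> U"
  from assms[OF x] obtain V \<epsilon>' where V: "openin S V" "x \<in> V" "orients (V \<inter> U) \<epsilon>'" "\<forall>y\<in>V \<inter> U. \<epsilon> y = \<epsilon>' y"
    by blast
  show "\<epsilon> x \<in> {1, -1}" using orients_sign[OF V(3), of x] V x by auto
  have xV: "x \<in> V \<inter> U" using x V by blast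
  then have "x \<in> topspace S" using V(3) orients_topspace by blast
  then obtain c where c: "c \<in> A" "x \<in> chart_dom c" using atlas_cover by blast
  obtain W where W: "openin S W" "x \<in> W" "W \<subseteq> chart_dom c"
    "\<forall>y\<in>W \<inter> (V \<inter> U). local_sign \<epsilon>' y c = local_sign \<epsilon>' x c" by (rule orients_local[OF V(3) xV c])
  have "local_sign \<epsilon> y c = local_sign \<epsilon>' y c" if "y \<in> V \<inter> U" for y using V(4) that by (simp add: local_sign_def)
  moreover have "local_sign \<epsilon>' y c = local_sign \<epsilon>' x c" if "y \<in> (V \<inter> W) \<inter> U" for y using W(4) that by blast
  ultimately have "\<forall>y\<in>(V \<inter> W) \<inter> U. local_sign \<epsilon> y c = local_sign \<epsilon> x c" using xV by (metis Int_iff)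
  then show "\<exists>c V. c \<in> A \<and> x \<in> chart_dom c \<and> openin S V \<and> x \<in> V \<and> (\<forall>y\<in>V \<inter> U. local_sign \<epsilon> y c = local_sign \<epsilon> x c)"
    using c openin_Int[OF V(1) W(1)] V(2) W(2) by blast
qed

lemma orients_UNION:
  assumes op: "\<And>i. i \<in> I \<Longrightarrow> openin S (W i)" and or: "\<And>i. i \<in> I \<Longrightarrow> orients (W i) (e i)"
    and agree: "\<And>i j x. i \<in> I \<Longrightarrow> j \<in> I \<Longrightarrow> x \<in> W i \<Longrightarrow> x \<in> W j \<Longrightarrow> e i x = e j x"
  obtains \<epsilon> where "orients (\<Union>i\<in>I. W i) \<epsilon>" "\<And>i x. i \<in> I \<Longrightarrow> x \<in> W i \<Longrightarrow> \<epsilon> x = e i x"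
proof
  define \<epsilon> where "\<epsilon> x = e (SOME i. i \<in> I \<and> x \<in> W i) x" for x
  show *: "\<epsilon> x = e i x" if "i \<in> I" "x \<in> W i" for i x
  proof -
    have "(SOME i. i \<in> I \<and> x \<in> W i) \<in> I \<and> x \<in> W (SOME i. i \<in> I \<and> x \<in> W i)"
      using that by (metis (mono_tags, lifting) someI_ex)
    then show ?thesis unfolding \<epsilon>_def using agree that by blast
  qed
  show "orients (\<Union>i\<in>I. W i) \<epsilon>"
  proof (rule orients_locally)
    fix x assume "x \<in> (\<Union>i\<in>I. W i)"
    then obtain i where i: "i \<in> I" "x \<in> W i" by blast
    then have "W i \<inter> (\<Union>i\<in>I. W i) = W i" by blast
    then show "\<exists>V \<epsilon>'. openin S V \<and> x \<in> V \<and> orients (V \<inter> (\<Union>i\<in>I. W i)) \<epsilon>' \<and> (\<forall>y\<in>V \<inter> (\<Union>i\<in>I. W i). \<epsilon> y = \<epsilon>' y)"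
      using i op or * by (intro exI[of _ "W i"] exI[of _ "e i"]) auto
  qed
qed

text \<open>On the connected intersection the two orientations agree up to one sign, which is corrected on
  \<open>V\<close>.\<close>

lemma orients_Un:
  assumes "openin S U" "openin S V" "connectedin S (U \<inter> V)" "orients U e" "orients V e'"
  shows "\<exists>\<epsilon>. orients (U \<union> V) \<epsilon>"
proof -
  have "\<exists>r\<in>{1, -1}. \<forall>x\<in>U \<inter> V. e x = r * e' x"
  proof (cases "U \<inter> V = {}")
    case False
    then obtain z where z: "z \<in> U \<inter> V" by blast
    define r where "r = e z * e' z"
    have s: "e x \<in> {1, -1}" "e' x \<in> {1, -1}" if "x \<in> U \<inter> V" for x
      using that assms orients_sign by blast+
    have "e x = r * e' x" if "x \<in> U \<inter> V" for x
    proof -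
      have "e x * e' x = r"
        unfolding r_def by (rule orients_connected_ratio[OF _ _ assms(3) z that])
          (use assms orients_mono in \<open>blast+\<close>)
      then show ?thesis using s[OF that] by auto
    qed
    moreover have "r \<in> {1, -1}" using s[OF z] by (auto simp: r_def)
    ultimately show ?thesis by blast
  qed auto
  then obtain r where r: "r \<in> {1, -1}" "\<And>x. x \<in> U \<inter> V \<Longrightarrow> e x = r * e' x" by blast
  define W where "W b = (if b then U else V)" for b
  define f where "f b = (if b then e else (\<lambda>x. r * e' x))" for b
  have "orients V (\<lambda>x. r * e' x)" by (rule orients_scale[OF assms(5) r(1)])
  then have or: "orients (W b) (f b)" for b
    using assms(4) by (simp add: W_def f_def)
  have op: "openin S (W b)" for b
    using assms(1,2) by (simp add: W_def)
  have agree: "f b x = f b' x" if "x \<in> W b" "x \<in> W b'" for b b' x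
    using that r(2)[of x] by (cases b; cases b') (simp_all add: W_def f_def)
  obtain \<epsilon> where "orients (\<Union>b\<in>UNIV. W b) \<epsilon>"
    by (rule orients_UNION[of UNIV W f]) (use or op agree in blast)+
  moreover have "(\<Union>b\<in>UNIV. W b) = U \<union> V" by (auto simp: W_def split: if_splits)
  ultimately show ?thesis by auto
qed

end

section \<open>Disks are orientable\<close>

lemma convex_tube:
  fixes K :: "'e::real_normed_vector set"
  assumes "convex K"
  shows "convex (\<Union>z\<in>K. ball z r)"
proof -
  have "(\<Union>z\<in>K. ball z r) = (\<Union>z\<in>K. \<Union>v\<in>ball 0 r. {z + v})"
  proof (intro equalityI subsetI)
    fix w assume "w \<in> (\<Union>z\<in>K. ball z r)"
    then obtain z where "z \<in> K" "dist z w < r" by auto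
    then have "w = z + (w - z)" "w - z \<in> ball 0 r" by (auto simp: dist_norm norm_minus_commute)
    then show "w \<in> (\<Union>z\<in>K. \<Union>v\<in>ball 0 r. {z + v})" using \<open>z \<in> K\<close> by blast
  next
    fix w assume "w \<in> (\<Union>z\<in>K. \<Union>v\<in>ball 0 r. {z + v})"
    then obtain z v where "z \<in> K" "norm v < r" "w = z + v" by auto
    then show "w \<in> (\<Union>z\<in>K. ball z r)" by (intro UN_I[of z]) (simp_all add: dist_norm)
  qed
  then show ?thesis using convex_sums[OF assms convex_ball[of 0 r]] by simp
qed

context surface_atlas
begin

lemma orients_in_chart:
  assumes "c \<in> A" "U \<subseteq> chart_dom c"
  shows "\<exists>\<epsilon>. orients U \<epsilon>"
proof -
  have "orients U (\<lambda>x. jacobian_sign (home_chart x) c x * 1)"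
  proof (rule orients_chart(1)[OF assms, of "\<lambda>_. 1"])
    fix x assume "x \<in> U"
    then show "\<exists>V. openin S V \<and> x \<in> V \<and> (\<forall>y\<in>V \<inter> U. (1::real) = 1)"
      using assms atlas_topspace by blast
  qed simp
  then show ?thesis by blast
qed

text \<open>Fix a point \<open>a\<close> of \<open>D\<close>. Around the segment from \<open>a\<close> to a point \<open>x\<close> an orientation
  is built by following the segment: the tube around an initial piece of the segment and the next ball
  in a chart have convex, hence connected intersection. Normalize these orientations at \<open>a\<close>. Two tubes
  are convex and both contain \<open>a\<close>, so they meet in a connected set, where the orientations
  agree. Thus there is no monodromy, and they can be glued. The map \<open>g\<close> is only a homeomorphism,
  which is why the argument is topological.\<close>

lemma orients_convex_image:
  fixes g :: "'e::euclidean_space \<Rightarrow> 'a"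
  assumes D: "open D" "convex D" and cont: "continuous_map (top_of_set D) S g"
    and op: "open_map (top_of_set D) S g" and inj: "inj_on g D"
  shows "\<exists>\<epsilon>. orients (g ` D) \<epsilon>"
proof (cases "D = {}")
  case True
  then show ?thesis by (simp add: orients_def)
next
  case False
  then obtain a where a: "a \<in> D" by blast
  have opI: "openin S (g ` W)" if "open W" "W \<subseteq> D" for W
  proof -
    have "openin (top_of_set D) W" using that D(1) by (simp add: openin_open_eq)
    then show ?thesis using op by (simp add: open_map_def)
  qed
  have conI: "connectedin S (g ` W)" if "convex W" "W \<subseteq> D" for W
    using connectedin_continuous_map_image[OF cont, of W] that convex_connected[OF that(1)]
    by (simp add: connectedin_subtopology)
  have tube: "\<exists>W \<epsilon>. open W \<and> convex W \<and> a \<in> W \<and> x \<in> W \<and> W \<subseteq> D \<and> orients (g ` W) \<epsilon>" if x: "x \<in> D" for x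
  proof -
    define G where "G = (\<lambda>c. {w \<in> D. g w \<in> chart_dom c}) ` A"
    have seg: "closed_segment a x \<subseteq> D" using a x D(2) by (simp add: closed_segment_subset)
    have "closed_segment a x \<subseteq> \<Union>G"
    proof
      fix w assume "w \<in> closed_segment a x"
      then have w: "w \<in> D" using seg by blast
      then have "g w \<in> topspace S" using cont by (auto simp: continuous_map_def)
      then show "w \<in> \<Union>G" using atlas_cover w unfolding G_def by blast
    qed
    moreover have "open B" if "B \<in> G" for B
    proof -
      from that obtain c where c: "c \<in> A" "B = {w \<in> topspace (top_of_set D). g w \<in> chart_dom c}" by (auto simp: G_def)
      have "openin (top_of_set D) B"
        unfolding c(2) by (rule openin_continuous_map_preimage[OF cont chart_openin[OF atlas_chart[OF c(1)]]])
      then show ?thesis using D(1) by (simp add: openin_open_eq)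
    qed
    ultimately have "\<exists>e>0. \<forall>z\<in>closed_segment a x. \<exists>B\<in>G. ball z e \<subseteq> B"
      using Heine_Borel_lemma[OF compact_segment, of a x G] by metis
    then obtain e where e: "0 < e" "\<And>z. z \<in> closed_segment a x \<Longrightarrow> \<exists>B\<in>G. ball z e \<subseteq> B"
      by blast
    have ball_D: "ball z e \<subseteq> D" if "z \<in> closed_segment a x" for z
      using e(2)[OF that] by (auto simp: G_def)
    have ball_or: "\<exists>\<epsilon>. orients (g ` W) \<epsilon>" if "z \<in> closed_segment a x" "W \<subseteq> ball z e" for z W
    proof -
      from e(2)[OF that(1)] obtain c where "c \<in> A" "ball z e \<subseteq> {w \<in> D. g w \<in> chart_dom c}"
        by (auto simp: G_def)
      then show ?thesis using that(2) by (intro orients_in_chart[of c]) auto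
    qed
    \<comment> \<open>The segment is cut into \<open>n\<close> pieces shorter than \<open>e / 2\<close>, so that the tube of radius
      \<open>e / 2\<close> around a piece lies in a ball of radius \<open>e\<close>, hence in one chart.\<close>
    obtain n :: nat where n: "norm (x - a) < real n * (e / 2)" and n0: "n > 0"
    proof -
      obtain n :: nat where "norm (x - a) < real n * (e / 2)"
        using reals_Archimedean3[of "e / 2"] e(1) by auto
      then show thesis by (intro that[of n]) (auto intro: gr0I)
    qed
    define p where "p k = a + (real k / real n) *\<^sub>R (x - a)" for k :: nat
    define T where "T k = (\<Union>z\<in>closed_segment a (p k). ball z (e / 2))" for k
    have pn: "p n = x" and p0: "p 0 = a" using n0 by (simp_all add: p_def)
    have p_seg: "p k \<in> closed_segment a (p l)" if "k \<le> l" for k l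
    proof (cases "l = 0")
      case False
      have "p k = (1 - real k / real l) *\<^sub>R a + (real k / real l) *\<^sub>R p l"
        using False n0 by (simp add: p_def algebra_simps)
      then show ?thesis using that False unfolding closed_segment_def
        by (intro CollectI exI[of _ "real k / real l"]) (auto simp: divide_simps)
    qed (use that in \<open>simp add: p0\<close>)
    have seg_k: "closed_segment a (p k) \<subseteq> closed_segment a x" if "k \<le> n" for k
      using p_seg[OF that] pn by (simp add: subset_closed_segment)
    have T_D: "T k \<subseteq> D" if "k \<le> n" for k
    proof -
      have "ball z (e / 2) \<subseteq> D" if "z \<in> closed_segment a (p k)" for z
      proof -
        have "ball z (e / 2) \<subseteq> ball z e" using e(1) by (simp add: subset_ball)
        also have "\<dots> \<subseteq> D" using ball_D seg_k[OF \<open>k \<le> n\<close>] that by blast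
        finally show ?thesis .
      qed
      then show ?thesis unfolding T_def by blast
    qed
    have T_cv: "convex (T k)" for k unfolding T_def by (intro convex_tube) simp
    have T_op: "open (T k)" for k unfolding T_def by auto
    have "\<exists>\<epsilon>. orients (g ` T k) \<epsilon>" if "k \<le> n" for k
      using that
    proof (induction k)
      case 0
      have "T 0 \<subseteq> ball a e" using e(1) by (auto simp: T_def p0)
      then show ?case by (intro ball_or[of a]) auto
    next
      case (Suc k)
      define R where "R = (\<Union>z\<in>closed_segment (p k) (p (Suc k)). ball z (e / 2))"
      have pk: "p k \<in> closed_segment a x" using seg_k[of k] Suc.prems by auto
      have R_ball: "R \<subseteq> ball (p k) e"
      proof
        fix w assume "w \<in> R"
        then obtain z where z: "z \<in> closed_segment (p k) (p (Suc k))" "dist z w < e / 2" by (auto simp: R_def)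
        have diff: "p (Suc k) - p k = (1 / real n) *\<^sub>R (x - a)"
          by (simp add: p_def flip: scaleR_diff_left diff_divide_distrib)
        have "dist (p k) z \<le> dist (p k) (p (Suc k))" using z(1)
          by (metis dist_commute dist_norm segment_bound(1))
        also have "dist (p k) (p (Suc k)) = norm (x - a) / real n"
          by (subst dist_commute) (simp add: dist_norm diff)
        also have "\<dots> < e / 2" using n n0 by (simp add: divide_simps mult.commute)
        finally have "dist (p k) w < e" using z(2) dist_triangle[of "p k" w z] by simp
        then show "w \<in> ball (p k) e" by simp
      qed
      have R_D: "R \<subseteq> D" using R_ball ball_D[OF pk] by blast
      have R_cv: "convex R" unfolding R_def by (intro convex_tube) simp
      have R_op: "open R" unfolding R_def by auto
      have TD: "T k \<subseteq> D" using T_D Suc.prems by simp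
      have eq: "T (Suc k) = T k \<union> R"
        unfolding T_def R_def using Un_closed_segment[OF p_seg[of k "Suc k"]] by (metis UN_Un le_SucI order_refl)
      obtain \<epsilon>1 where 1: "orients (g ` T k) \<epsilon>1" using Suc by auto
      obtain \<epsilon>2 where 2: "orients (g ` R) \<epsilon>2" using ball_or[OF pk R_ball] by blast
      have "connectedin S (g ` T k \<inter> g ` R)"
        using conI[of "T k \<inter> R"] T_cv R_cv TD inj_on_image_Int[OF inj TD R_D] by (simp add: convex_Int le_infI1)
      then have "\<exists>\<epsilon>. orients (g ` T k \<union> g ` R) \<epsilon>"
        using opI[OF T_op TD] opI[OF R_op R_D] 1 2 by (intro orients_Un)
      then show ?case by (simp add: eq image_Un)
    qed
    then obtain \<epsilon> where "orients (g ` T n) \<epsilon>" by blast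
    moreover have "a \<in> T n"
      unfolding T_def pn by (rule UN_I[of a]) (use e(1) in simp_all)
    moreover have "x \<in> T n"
      unfolding T_def pn by (rule UN_I[of x]) (use e(1) in simp_all)
    ultimately show ?thesis using T_op T_cv T_D[of n] by blast
  qed
  have "\<exists>W \<epsilon>. open W \<and> convex W \<and> a \<in> W \<and> x \<in> W \<and> W \<subseteq> D \<and> orients (g ` W) \<epsilon> \<and> \<epsilon> (g a) = 1" if x: "x \<in> D" for x
  proof -
    from tube[OF x] obtain W \<epsilon> where W: "open W" "convex W" "a \<in> W" "x \<in> W" "W \<subseteq> D" "orients (g ` W) \<epsilon>" by blast
    have s: "\<epsilon> (g a) \<in> {1, -1}" by (rule orients_sign[OF W(6)]) (use W(3) in blast)
    then have "orients (g ` W) (\<lambda>y. \<epsilon> (g a) * \<epsilon> y)" by (rule orients_scale[OF W(6)])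
    moreover have "\<epsilon> (g a) * \<epsilon> (g a) = 1" using s by auto
    ultimately show ?thesis using W by (intro exI[of _ W] exI[of _ "\<lambda>y. \<epsilon> (g a) * \<epsilon> y"]) simp
  qed
  then obtain W e where W: "\<And>x. x \<in> D \<Longrightarrow> open (W x) \<and> convex (W x) \<and> a \<in> W x \<and> x \<in> W x \<and> W x \<subseteq> D \<and>
      orients (g ` W x) (e x) \<and> e x (g a) = 1"
    by metis
  have agree: "e i y = e j y" if ij: "i \<in> D" "j \<in> D" and y: "y \<in> g ` W i" "y \<in> g ` W j" for i j y
  proof -
    have eq: "g ` (W i \<inter> W j) = g ` W i \<inter> g ` W j"
      using inj_on_image_Int[OF inj] W ij by blast
    have con: "connectedin S (g ` (W i \<inter> W j))"
      using W[OF ij(1)] W[OF ij(2)] by (intro conI convex_Int) auto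
    have "orients (g ` (W i \<inter> W j)) (e i)" "orients (g ` (W i \<inter> W j)) (e j)"
      using W[OF ij(1)] W[OF ij(2)] by (blast intro: orients_mono)+
    then show ?thesis
      by (rule orients_connected_agree[OF _ _ con, of _ _ "g a"]) (use W[OF ij(1)] W[OF ij(2)] y eq in auto)
  qed
  have op': "openin S (g ` W x)" and or': "orients (g ` W x) (e x)" if "x \<in> D" for x
    using W[OF that] opI by blast+
  have eq: "(\<Union>x\<in>D. g ` W x) = g ` D" using W by blast
  have "\<exists>\<epsilon>. orients (\<Union>x\<in>D. g ` W x) \<epsilon>"
  proof (rule orients_UNION[of D "\<lambda>x. g ` W x" e])
    fix \<epsilon> assume "orients (\<Union>x\<in>D. g ` W x) \<epsilon>"
    then show "\<exists>\<epsilon>. orients (\<Union>x\<in>D. g ` W x) \<epsilon>" by blast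
  next
    fix i j y assume "i \<in> D" "j \<in> D" "y \<in> g ` W i" "y \<in> g ` W j"
    then show "e i y = e j y" by (rule agree)
  qed (fact op' or')+
  then show ?thesis by (simp only: eq)
qed

end

section \<open>Straightening two transverse arcs in the plane\<close>

text \<open>The domain on which two arcs, each parametrized by an interval, can be straightened together.\<close>

definition square :: "real \<Rightarrow> (real ^ 2) set" where
  "square r = {w. \<bar>w $ 1\<bar> < r \<and> \<bar>w $ 2\<bar> < r}"

lemma open_square: "open (square r)"
  unfolding square_def by (intro open_Collect_conj open_Collect_less continuous_intros)

lemma square_subset_open:
  assumes "open W" "0 \<in> W"
  obtains r where "r > 0" "square r \<subseteq> W"
proof -
  from assms obtain e where e: "e > 0" "ball 0 e \<subseteq> W" by (meson openE)
  have "w \<in> ball 0 e" if "w \<in> square (e / 2)" for w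
  proof -
    have "norm w \<le> (\<Sum>i\<in>UNIV. \<bar>w $ i\<bar>)" by (rule norm_le_l1_cart)
    also have "\<dots> < e" using that by (simp add: sum_2 square_def)
    finally show ?thesis by simp
  qed
  then have "square (e / 2) \<subseteq> W" using e(2) by blast
  then show thesis using e(1) by (intro that[of "e / 2"]) auto
qed

text \<open>The map \<open>\<Phi>\<close> sends the two axes to the two arcs and its differential at a point sends the basis
  vectors to velocities of the arcs. Hence it straightens both arcs at once, and the inverse function
  theorem applies. With \<open>\<beta>\<close> a straight line it serves for regular points of the curve, with
  \<open>\<beta>\<close> the second branch it serves for double points.\<close>

lemma straighten:
  fixes \<alpha> \<beta> \<alpha>' \<beta>' :: "real \<Rightarrow> real ^ 2"
  assumes r: "r > 0"
    and \<alpha>: "\<And>s. \<bar>s\<bar> < r \<Longrightarrow> (\<alpha> has_vector_derivative \<alpha>' s) (at s)"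
    and \<beta>: "\<And>s. \<bar>s\<bar> < r \<Longrightarrow> (\<beta> has_vector_derivative \<beta>' s) (at s)"
    and c\<alpha>: "continuous_on {-r<..<r} \<alpha>'" and c\<beta>: "continuous_on {-r<..<r} \<beta>'"
    and cr: "cross (\<alpha>' 0) (\<beta>' 0) \<noteq> 0"
    and \<Phi>: "\<And>w. \<Phi> w = \<alpha> (w $ 1) + \<beta> (w $ 2) - q"
  obtains \<rho> \<Psi> where "0 < \<rho>" "\<rho> \<le> r" "continuous_on (square \<rho>) \<Phi>"
    "\<And>w. w \<in> square \<rho> \<Longrightarrow> \<Psi> (\<Phi> w) = w"
    "\<And>W. open W \<Longrightarrow> W \<subseteq> square \<rho> \<Longrightarrow> open (\<Phi> ` W)"
    "\<And>w. w \<in> square \<rho> \<Longrightarrow> \<exists>\<Psi>'. (\<Psi> has_derivative \<Psi>') (at (\<Phi> w)) \<and>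
        (\<forall>v. \<Psi>' (v $ 1 *\<^sub>R \<alpha>' (w $ 1) + v $ 2 *\<^sub>R \<beta>' (w $ 2)) = v)"
    "\<And>w. w \<in> square \<rho> \<Longrightarrow> sgn (cross (\<alpha>' (w $ 1)) (\<beta>' (w $ 2))) = sgn (cross (\<alpha>' 0) (\<beta>' 0))"
proof -
  define D where "D = cross (\<alpha>' 0) (\<beta>' 0)"
  define f' where "f' w = (blinfun_scaleR_left (\<alpha>' (w $ 1)) o\<^sub>L blinfun_inner_left (axis 1 1 :: real ^ 2)) +
    (blinfun_scaleR_left (\<beta>' (w $ 2)) o\<^sub>L blinfun_inner_left (axis 2 1 :: real ^ 2))" for w :: "real ^ 2"
  have f'_apply: "blinfun_apply (f' w) v = v $ 1 *\<^sub>R \<alpha>' (w $ 1) + v $ 2 *\<^sub>R \<beta>' (w $ 2)"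
    for w v :: "real ^ 2"
    by (simp add: f'_def plus_blinfun.rep_eq inner_axis)
  have \<alpha>1: "continuous_on (square r) (\<lambda>w. \<alpha>' (w $ 1))"
    by (rule continuous_on_compose2[OF c\<alpha>]) (auto intro!: continuous_intros simp: square_def)
  have \<beta>2: "continuous_on (square r) (\<lambda>w. \<beta>' (w $ 2))"
    by (rule continuous_on_compose2[OF c\<beta>]) (auto intro!: continuous_intros simp: square_def)
  have cf': "continuous_on (square r) f'"
    unfolding f'_def
    by (intro continuous_on_add bounded_bilinear.continuous_on[OF bounded_bilinear_blinfun_compose]
          continuous_on_const bounded_linear.continuous_on[OF bounded_linear_blinfun_scaleR_left] \<alpha>1 \<beta>2)
  have nth: "((\<lambda>w::real^2. w $ i) has_derivative (\<lambda>w. w $ i)) (at w)" for i w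
    by (rule bounded_linear_imp_has_derivative[OF bounded_linear_vec_nth])
  have d\<Phi>: "(\<Phi> has_derivative blinfun_apply (f' w)) (at w)" if "w \<in> square r" for w
  proof -
    have 1: "(\<alpha> has_derivative (\<lambda>h. h *\<^sub>R \<alpha>' (w $ 1))) (at (w $ 1))"
      and 2: "(\<beta> has_derivative (\<lambda>h. h *\<^sub>R \<beta>' (w $ 2))) (at (w $ 2))"
      using \<alpha> \<beta> that by (simp_all add: square_def has_vector_derivative_def)
    have "((\<lambda>w. \<alpha> (w $ 1) + \<beta> (w $ 2) - q) has_derivative
        (\<lambda>v. v $ 1 *\<^sub>R \<alpha>' (w $ 1) + v $ 2 *\<^sub>R \<beta>' (w $ 2) - 0)) (at w)"
      by (intro has_derivative_diff has_derivative_add has_derivative_const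
           has_derivative_compose[OF nth 1] has_derivative_compose[OF nth 2])
    then show ?thesis by (simp add: f'_apply[abs_def] \<Phi>[abs_def])
  qed
  \<comment> \<open>The inverse of the differential at the origin, by Cramer's rule.\<close>
  define L :: "real ^ 2 \<Rightarrow> real ^ 2"
    where "L v = (cross v (\<beta>' 0) / D) *\<^sub>R axis 1 1 + (cross (\<alpha>' 0) v / D) *\<^sub>R axis 2 1" for v
  have "linear L"
    by (rule linearI) (simp_all add: L_def cross_add cross_scale add_divide_distrib scaleR_add_left scaleR_add_right algebra_simps)
  then have L: "blinfun_apply (Blinfun L) v = L v" for v
    by (simp add: bounded_linear_Blinfun_apply linear_conv_bounded_linear)
  have inv: "Blinfun L o\<^sub>L f' 0 = id_blinfun"
  proof (rule blinfun_eqI)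
    fix v :: "real ^ 2"
    have "L (v $ 1 *\<^sub>R \<alpha>' 0 + v $ 2 *\<^sub>R \<beta>' 0) = v"
      using cr by (simp add: L_def cross_add cross_scale D_def flip: vec2_expand)
    then show "blinfun_apply (Blinfun L o\<^sub>L f' 0) v = blinfun_apply id_blinfun v"
      by (simp add: L f'_apply)
  qed
  have z: "0 \<in> square r" using r by (simp add: square_def)
  have "\<exists>U' V g g'. open U' \<and> U' \<subseteq> square r \<and> 0 \<in> U' \<and> open V \<and> homeomorphism U' V \<Phi> g \<and>
      (\<forall>y\<in>V. (g has_derivative (g' y)) (at y) \<and> g' y = Hilbert_Choice.inv (blinfun_apply (f' (g y))) \<and>
        bij (blinfun_apply (f' (g y))))"
  proof (rule inverse_function_theorem[OF open_square d\<Phi> cf' z inv])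
    fix U' V g g'
    assume "open U'" "U' \<subseteq> square r" "0 \<in> U'" "open V" "\<Phi> 0 \<in> V" "homeomorphism U' V \<Phi> g"
      and "\<And>y. y \<in> V \<Longrightarrow> (g has_derivative (g' y)) (at y)"
        "\<And>y. y \<in> V \<Longrightarrow> g' y = Hilbert_Choice.inv (blinfun_apply (f' (g y)))"
        "\<And>y. y \<in> V \<Longrightarrow> bij (blinfun_apply (f' (g y)))"
    then show ?thesis by blast
  qed
  then obtain U' V g g' where U': "open U'" "U' \<subseteq> square r" "0 \<in> U'" "open V" "homeomorphism U' V \<Phi> g"
    and g: "\<And>y. y \<in> V \<Longrightarrow> (g has_derivative (g' y)) (at y)"
    "\<And>y. y \<in> V \<Longrightarrow> g' y = Hilbert_Choice.inv (blinfun_apply (f' (g y)))"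
    "\<And>y. y \<in> V \<Longrightarrow> bij (blinfun_apply (f' (g y)))"
    by blast
  \<comment> \<open>Points where the sign of the Jacobian is the same as at the origin.\<close>
  define P where "P = U' \<inter> (\<lambda>w. cross (\<alpha>' (w $ 1)) (\<beta>' (w $ 2)) * D) -` {0<..}"
  have "open P"
  proof -
    have "continuous_on U' (\<lambda>w. cross (\<alpha>' (w $ 1)) (\<beta>' (w $ 2)) * D)"
      using \<alpha>1 \<beta>2 U'(2) by (intro continuous_intros) (auto intro: continuous_on_subset)
    then show ?thesis unfolding P_def using U'(1) by (intro continuous_open_preimage) auto
  qed
  moreover have "0 \<in> P"
  proof -
    have "cross (\<alpha>' 0) (\<beta>' 0) * cross (\<alpha>' 0) (\<beta>' 0) > 0" using cr not_real_square_gt_zero by blast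
    then show ?thesis using U'(3) by (simp add: P_def D_def)
  qed
  ultimately obtain \<rho> where \<rho>: "\<rho> > 0" "square \<rho> \<subseteq> P" by (rule square_subset_open)
  have \<rho>U: "square \<rho> \<subseteq> U'" using \<rho>(2) by (auto simp: P_def)
  have \<rho>r: "\<rho> \<le> r"
  proof (rule ccontr)
    assume "\<not> \<rho> \<le> r"
    then have "(r *\<^sub>R axis 1 1 :: real ^ 2) \<in> square \<rho>" using r by (simp add: square_def axis_def)
    then have "(r *\<^sub>R axis 1 1 :: real ^ 2) \<in> square r" using \<rho>U U'(2) by blast
    then show False using r by (simp add: square_def axis_def)
  qed
  have \<Phi>V: "\<Phi> w \<in> V" and g\<Phi>: "g (\<Phi> w) = w" if "w \<in> square \<rho>" for w
    using U'(5) \<rho>U that unfolding homeomorphism_def by blast+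
  show thesis
  proof (rule that[of \<rho> g])
    show "continuous_on (square \<rho>) \<Phi>"
      by (rule continuous_on_subset[OF homeomorphism_cont1[OF U'(5)] \<rho>U])
    show "open (\<Phi> ` W)" if W: "open W" "W \<subseteq> square \<rho>" for W
    proof -
      have "openin (top_of_set V) (\<Phi> ` W)"
        using homeomorphism_imp_open_map[OF U'(5)] W \<rho>U U'(1) by (simp add: openin_open_eq)
      then show ?thesis using U'(4) by (simp add: openin_open_eq)
    qed
    show "\<exists>\<Psi>'. (g has_derivative \<Psi>') (at (\<Phi> w)) \<and>
        (\<forall>v. \<Psi>' (v $ 1 *\<^sub>R \<alpha>' (w $ 1) + v $ 2 *\<^sub>R \<beta>' (w $ 2)) = v)" if w: "w \<in> square \<rho>" for w
    proof (intro exI conjI allI)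
      show "(g has_derivative g' (\<Phi> w)) (at (\<Phi> w))" by (rule g(1)[OF \<Phi>V[OF w]])
      fix v :: "real ^ 2"
      have "g' (\<Phi> w) (blinfun_apply (f' w) v) = v"
        using g(2,3)[OF \<Phi>V[OF w]] g\<Phi>[OF w] by (simp add: bij_is_inj)
      then show "g' (\<Phi> w) (v $ 1 *\<^sub>R \<alpha>' (w $ 1) + v $ 2 *\<^sub>R \<beta>' (w $ 2)) = v"
        by (simp add: f'_apply)
    qed
    show "sgn (cross (\<alpha>' (w $ 1)) (\<beta>' (w $ 2))) = sgn (cross (\<alpha>' 0) (\<beta>' 0))" if "w \<in> square \<rho>" for w
    proof -
      have "cross (\<alpha>' (w $ 1)) (\<beta>' (w $ 2)) * cross (\<alpha>' 0) (\<beta>' 0) > 0"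
        using subsetD[OF \<rho>(2) that] by (simp add: P_def D_def)
      then show ?thesis by (auto simp: zero_less_mult_iff)
    qed
  qed (use \<rho> \<rho>r g\<Phi> in auto)
qed

section \<open>Orientations adapted to an oriented curve\<close>

text \<open>A generic curve together with a fixed orientation \<open>dir\<close> of the chord diagram.\<close>

locale oriented_generic_curve = surface_atlas S A
  for S :: "'a topology" and A :: "('a, real ^ 2) chart set" +
  fixes M :: "'b topology" and B :: "('b, real) chart set" and f :: "'b \<Rightarrow> 'a"
    and dir :: "'b \<Rightarrow> ('b, real) chart \<Rightarrow> real"
  assumes closed: "closed_1_manifold M B"
    and generic: "generic_immersion M B S A f"
    and orientation: "chord_diagram_orientation M B (chords M f) dir"
begin

abbreviation curve :: "'a set" where
  "curve \<equiv> f ` topspace M"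

definition regular :: "'b \<Rightarrow> bool" where
  "regular p \<longleftrightarrow> p \<in> topspace M \<and> (\<forall>q\<in>topspace M. f q = f p \<longrightarrow> q = p)"

definition velocity :: "('b, real) chart \<Rightarrow> ('a, real ^ 2) chart \<Rightarrow> 'b \<Rightarrow> real ^ 2" where
  "velocity b c p = deriv_in_charts b c f p 1"

lemma base_atlas: "smooth_atlas M B" and compact_base: "compact_space M"
  using closed by (auto simp: closed_1_manifold_def smooth_manifold_def)

lemma base_chart: "b \<in> B \<Longrightarrow> is_chart M b"
  using base_atlas by (simp add: smooth_atlas_def)

lemma base_cover: "p \<in> topspace M \<Longrightarrow> \<exists>b\<in>B. p \<in> chart_dom b"
  using base_atlas by (auto simp: smooth_atlas_def)

lemma base_topspace: "b \<in> B \<Longrightarrow> p \<in> chart_dom b \<Longrightarrow> p \<in> topspace M"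
  using base_atlas by (auto simp: smooth_atlas_def)

lemma immersed: "immersion M B S A f"
  using generic by (simp add: generic_immersion_def)

lemma smooth_curve: "smooth_map M B S A f"
  using immersed by (simp add: immersion_def)

lemma continuous_curve: "continuous_map M S f"
  using smooth_curve by (simp add: smooth_map_def)

lemma compact_curve: "compactin S curve"
  using image_compactin[OF _ continuous_curve] compact_base by (simp add: compact_space_def)

lemma curve_topspace: "curve \<subseteq> topspace S"
  using compact_curve compactin_subset_topspace by blast

lemma closed_curve: "closedin S curve"
  using compactin_imp_closedin[OF Hausdorff compact_curve] .

lemma velocity:
  assumes "b \<in> B" "c \<in> A" "p \<in> chart_dom b" "f p \<in> chart_dom c"
  shows "(in_charts b c f has_vector_derivative velocity b c p) (at (coord b p))" and "velocity b c p \<noteq> 0"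
proof -
  have d: "(in_charts b c f has_derivative deriv_in_charts b c f p) (at (coord b p))"
    by (rule smooth_map_has_derivative[OF smooth_curve assms])
  then have lin: "linear (deriv_in_charts b c f p)" by (rule has_derivative_linear)
  have "deriv_in_charts b c f p h = h *\<^sub>R velocity b c p" for h
    using linear_scale[OF lin, of h 1] by (simp add: velocity_def)
  then have "deriv_in_charts b c f p = (\<lambda>h. h *\<^sub>R velocity b c p)" by blast
  then show "(in_charts b c f has_vector_derivative velocity b c p) (at (coord b p))"
    using d by (simp add: has_vector_derivative_def)
  have "inj (deriv_in_charts b c f p)"
    using immersed assms by (simp add: immersion_def)
  then show "velocity b c p \<noteq> 0"
    unfolding velocity_def using linear_0[OF lin] by (metis injD zero_neq_one)
qed

lemma regular_iff: "regular p \<longleftrightarrow> p \<in> topspace M - \<Union>(chords M f)"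
proof -
  have "p \<in> \<Union>(chords M f) \<longleftrightarrow> p \<in> topspace M \<and> (\<exists>q\<in>topspace M. p \<noteq> q \<and> f p = f q)"
  proof
    assume "p \<in> \<Union>(chords M f)"
    then obtain p' q' where "p \<in> {p', q'}" "p' \<in> topspace M" "q' \<in> topspace M" "p' \<noteq> q'" "f p' = f q'"
      unfolding chords_def by blast
    then show "p \<in> topspace M \<and> (\<exists>q\<in>topspace M. p \<noteq> q \<and> f p = f q)" by auto
  next
    assume "p \<in> topspace M \<and> (\<exists>q\<in>topspace M. p \<noteq> q \<and> f p = f q)"
    then obtain q where "p \<in> topspace M" "q \<in> topspace M" "p \<noteq> q" "f p = f q" by blast
    then have "{p, q} \<in> chords M f" unfolding chords_def by blast
    then show "p \<in> \<Union>(chords M f)" by blast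
  qed
  then show ?thesis unfolding regular_def by auto
qed

lemma dir_sign: "regular p \<Longrightarrow> b \<in> B \<Longrightarrow> p \<in> chart_dom b \<Longrightarrow> dir p b \<in> {1, -1}"
  and dir_change: "regular p \<Longrightarrow> b \<in> B \<Longrightarrow> b' \<in> B \<Longrightarrow> p \<in> chart_dom b \<Longrightarrow> p \<in> chart_dom b' \<Longrightarrow>
    dir p b' = sgn (deriv (in_charts b b' id) (coord b p)) * dir p b"
  using orientation unfolding chord_diagram_orientation_def orientation_1_def regular_iff by blast+

lemma dir_locally_constant:
  assumes "regular p" "b \<in> B" "p \<in> chart_dom b"
  obtains N where "openin M N" "p \<in> N" "\<forall>q\<in>N. regular q \<longrightarrow> dir q b = dir p b"
proof -
  define W where "W = topspace M - \<Union>(chords M f)"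
  have "\<forall>\<^sub>F q in atin (subtopology M W) p. dir q b = dir p b"
    using orientation assms unfolding chord_diagram_orientation_def orientation_1_def regular_iff W_def by blast
  then obtain U where U: "openin (subtopology M W) U" "p \<in> U" "\<forall>q\<in>U - {p}. dir q b = dir p b"
    using assms(1) unfolding eventually_atin regular_iff W_def by auto
  then obtain N where N: "openin M N" "U = N \<inter> W" by (auto simp: openin_subtopology)
  show thesis
  proof (rule that[OF N(1)])
    show "p \<in> N" using U N by blast
    show "\<forall>q\<in>N. regular q \<longrightarrow> dir q b = dir p b"
      using U(3) N(2) unfolding regular_iff W_def by blast
  qed
qed

text \<open>Changing the chart of the curve rescales the velocity, changing the chart of the surface
  transforms it linearly.\<close>

lemma velocity_change:
  assumes "b \<in> B" "b' \<in> B" "c \<in> A" "c' \<in> A" "p \<in> chart_dom b" "p \<in> chart_dom b'"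
    "f p \<in> chart_dom c" "f p \<in> chart_dom c'"
  shows "velocity b c p = deriv (in_charts b b' id) (coord b p) *\<^sub>R deriv_in_charts c' c id (f p) (velocity b' c' p)"
proof -
  define K where "K = deriv_in_charts c' c id (f p)"
  define H where "H = deriv_in_charts b b' id p"
  have dK: "(in_charts c' c id has_derivative K) (at (coord c' (f p)))"
    unfolding K_def by (rule transition_has_derivative) (use assms in auto)
  have dH: "(in_charts b b' id has_derivative H) (at (coord b p))"
    unfolding H_def
    by (rule smooth_map_has_derivative[OF smooth_atlas_smooth_map_id[OF base_atlas]]) (use assms in auto)
  define F where "F = deriv_in_charts b' c' f p"
  have dF: "(in_charts b' c' f has_derivative F) (at (coord b' p))"
    unfolding F_def by (rule smooth_map_has_derivative[OF smooth_curve]) (use assms in auto)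
  have "(in_charts b c' (f \<circ> id) has_derivative F \<circ> H) (at (coord b p))"
    by (rule in_charts_compose_has_derivative[OF base_chart[OF assms(1)] base_chart[OF assms(2)] _ assms(5)])
      (use dF dH assms in simp_all)
  then have "(in_charts b c (id \<circ> (f \<circ> id)) has_derivative K \<circ> (F \<circ> H)) (at (coord b p))"
    by (intro in_charts_compose_has_derivative[OF base_chart[OF assms(1)] atlas_chart[OF assms(4)] _ assms(5)])
      (use dK assms continuous_curve in simp_all)
  then have "(in_charts b c f has_derivative K \<circ> (F \<circ> H)) (at (coord b p))" by (simp only: id_comp comp_id)
  with smooth_map_has_derivative[OF smooth_curve assms(1,3,5,7)]
  have "deriv_in_charts b c f p = K \<circ> (F \<circ> H)" by (rule has_derivative_unique)
  then have 1: "velocity b c p = K (F (H 1))" by (simp add: velocity_def)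
  have linH: "linear H" and linF: "linear F" and linK: "linear K"
    using dH dF dK has_derivative_linear by blast+
  have "H h = H 1 * h" for h
    using linear_scale[OF linH, of h 1] by (simp only: real_scaleR_def mult_1_right) (rule mult.commute)
  then have "H = (*) (H 1)" by (intro ext)
  then have "(in_charts b b' id has_field_derivative H 1) (at (coord b p))"
    using dH by (simp only: has_field_derivative_def)
  then have 2: "H 1 = deriv (in_charts b b' id) (coord b p)" by (simp add: DERIV_imp_deriv)
  have 3: "F (H 1) = H 1 *\<^sub>R velocity b' c' p"
    using linear_scale[OF linF, of "H 1" 1] by (simp add: F_def velocity_def)
  show ?thesis
    unfolding K_def[symmetric] 2[symmetric] 1 3 by (rule linear_scale[OF linK])
qed

text \<open>The sign that the rule ``positive to the left of the curve'' prescribes at the point \<open>x\<close> reached at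
  time \<open>t\<close> by a path that crosses the curve at \<open>f p\<close> at time \<open>0\<close> with velocity \<open>v\<close>. The path
  goes from right to left of the direction \<open>dir\<close> iff the product of the last two factors
  is \<open>1\<close>.\<close>

definition crossing_sign ::
    "('a \<Rightarrow> real) \<Rightarrow> 'b \<Rightarrow> ('b, real) chart \<Rightarrow> ('a, real ^ 2) chart \<Rightarrow> real ^ 2 \<Rightarrow> real \<Rightarrow> 'a \<Rightarrow> bool" where
  "crossing_sign \<epsilon> p b c v t x \<longleftrightarrow> x \<notin> curve \<and>
     local_sign \<epsilon> x c = sgn t * sgn (cross (velocity b c p) v) * dir p b"

text \<open>The paths are given in coordinates, and only need a derivative at time \<open>0\<close>, as this property
  survives changes of charts.\<close>

definition adapted_in :: "('a \<Rightarrow> real) \<Rightarrow> 'b \<Rightarrow> ('b, real) chart \<Rightarrow> ('a, real ^ 2) chart \<Rightarrow> bool" where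
  "adapted_in \<epsilon> p b c \<longleftrightarrow> (\<forall>\<delta> v. \<delta> 0 = coord c (f p) \<longrightarrow> (\<delta> has_vector_derivative v) (at 0) \<longrightarrow>
     cross (velocity b c p) v \<noteq> 0 \<longrightarrow>
     (\<forall>\<^sub>F t in at (0::real). \<delta> t \<in> chart_image c \<and> crossing_sign \<epsilon> p b c v t (param c (\<delta> t))))"

definition adapted :: "('a \<Rightarrow> real) \<Rightarrow> 'b \<Rightarrow> bool" where
  "adapted \<epsilon> p \<longleftrightarrow> (\<forall>b\<in>B. \<forall>c\<in>A. p \<in> chart_dom b \<longrightarrow> f p \<in> chart_dom c \<longrightarrow> adapted_in \<epsilon> p b c)"

lemma path_eventually:
  assumes "c \<in> A" "z \<in> chart_dom c" "openin S U" "z \<in> U" "isCont \<delta> (0::real)" "\<delta> 0 = coord c z"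
  shows "\<forall>\<^sub>F t in at 0. \<delta> t \<in> chart_image c \<and> param c (\<delta> t) \<in> U \<inter> chart_dom c"
proof -
  have "open (coord c ` (U \<inter> chart_dom c))"
    using open_coord_image[OF atlas_chart] assms by blast
  moreover have "\<delta> 0 \<in> coord c ` (U \<inter> chart_dom c)" using assms by blast
  ultimately have "\<forall>\<^sub>F t in at 0. \<delta> t \<in> coord c ` (U \<inter> chart_dom c)"
    using assms(5) unfolding isCont_def by (rule topological_tendstoD[rotated])
  then show ?thesis
  proof (rule eventually_mono)
    fix t assume "\<delta> t \<in> coord c ` (U \<inter> chart_dom c)"
    then obtain x where "x \<in> U" "x \<in> chart_dom c" "\<delta> t = coord c x" by blast
    then show "\<delta> t \<in> chart_image c \<and> param c (\<delta> t) \<in> U \<inter> chart_dom c"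
      using param_coord[OF atlas_chart[OF assms(1)]] by auto
  qed
qed

text \<open>The three signs that enter change simultaneously: the local orientation and the area by the sign
  of the Jacobian, the area and \<open>dir\<close> by the sign of the derivative of the transition function of
  the base. Each of them occurs twice and cancels.\<close>

lemma adapted_in_change:
  assumes reg: "regular p" and b: "b \<in> B" "b' \<in> B" "p \<in> chart_dom b" "p \<in> chart_dom b'"
    and c: "c \<in> A" "c' \<in> A" "f p \<in> chart_dom c" "f p \<in> chart_dom c'"
    and ad: "adapted_in \<epsilon> p b c"
  shows "adapted_in \<epsilon> p b' c'"
  unfolding adapted_in_def
proof (intro allI impI)
  fix \<delta>' v' assume \<delta>': "\<delta>' 0 = coord c' (f p)" "(\<delta>' has_vector_derivative v') (at 0)"
    and cr: "cross (velocity b' c' p) v' \<noteq> 0"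
  define g where "g = in_charts c' c id"
  define L where "L = deriv_in_charts c' c id (f p)"
  define r where "r = deriv (in_charts b b' id) (coord b p)"
  have dg: "(g has_derivative L) (at (\<delta>' 0))"
    unfolding g_def L_def \<delta>'(1) by (rule transition_has_derivative[OF c(2,1,4,3)])
  then have linL: "linear L" by (rule has_derivative_linear)
  have g0: "g (\<delta>' 0) = coord c (f p)"
    unfolding g_def \<delta>'(1) by (simp add: in_charts_coord[OF atlas_chart[OF c(2)] c(4)])
  have d\<delta>: "((\<lambda>t. g (\<delta>' t)) has_vector_derivative L v') (at 0)"
    using has_derivative_compose[OF \<delta>'(2)[unfolded has_vector_derivative_def] dg]
    by (simp add: has_vector_derivative_def linear_scale[OF linL])
  have velocity_eq: "velocity b c p = r *\<^sub>R L (velocity b' c' p)"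
    unfolding r_def L_def by (rule velocity_change[OF b(1,2) c(1,2) b(3,4) c(3,4)])
  have r0: "r \<noteq> 0"
    using velocity(2)[OF b(1) c(1) b(3) c(3)] velocity_eq by auto
  have crL: "cross (velocity b c p) (L v') = r * det (matrix L) * cross (velocity b' c' p) v'"
    unfolding velocity_eq cross_scale cross_linear[OF linL] by simp
  have jL: "sgn (det (matrix L)) = jacobian_sign c c' (f p)"
    using jacobian_sign_square(3)[OF c] by (simp add: jacobian_sign_def L_def)
  have js: "jacobian_sign c c' (f p) \<in> {1, -1}" by (rule jacobian_sign_square(1)[OF c])
  have crL0: "cross (velocity b c p) (L v') \<noteq> 0"
    unfolding crL using r0 cr jL js by auto
  have ev: "\<forall>\<^sub>F t in at 0. g (\<delta>' t) \<in> chart_image c \<and> crossing_sign \<epsilon> p b c (L v') t (param c (g (\<delta>' t)))"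
    using ad[unfolded adapted_in_def, rule_format, of "\<lambda>t. g (\<delta>' t)" "L v'"] g0 d\<delta> crL0 by blast
  obtain V where V: "openin S V" "f p \<in> V" "V \<subseteq> chart_dom c \<inter> chart_dom c'" "\<forall>y\<in>V. jacobian_sign c c' y = jacobian_sign c c' (f p)"
    using jacobian_sign_locally_constant[OF c] by blast
  have "\<forall>\<^sub>F t in at 0. \<delta>' t \<in> chart_image c' \<and> param c' (\<delta>' t) \<in> V \<inter> chart_dom c'"
    using path_eventually[OF c(2,4) V(1,2) has_vector_derivative_continuous[OF \<delta>'(2)] \<delta>'(1)] .
  with ev show "\<forall>\<^sub>F t in at 0. \<delta>' t \<in> chart_image c' \<and> crossing_sign \<epsilon> p b' c' v' t (param c' (\<delta>' t))"
  proof (rule eventually_elim2)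
    fix t assume "g (\<delta>' t) \<in> chart_image c \<and> crossing_sign \<epsilon> p b c (L v') t (param c (g (\<delta>' t)))"
      and 2: "\<delta>' t \<in> chart_image c' \<and> param c' (\<delta>' t) \<in> V \<inter> chart_dom c'"
    define x where "x = param c' (\<delta>' t)"
    note 1 = \<open>g (\<delta>' t) \<in> chart_image c \<and> _\<close>[unfolded crossing_sign_def]
    have x: "x \<in> V" "x \<in> chart_dom c'" "x \<in> chart_dom c" using 2 V(3) by (auto simp: x_def)
    have "\<delta>' t = coord c' x" using 2 coord_param by (metis x_def)
    then have "g (\<delta>' t) = coord c x"
      unfolding g_def by (simp add: in_charts_coord[OF atlas_chart[OF c(2)] x(2)])
    then have gx: "param c (g (\<delta>' t)) = x" using param_coord[OF atlas_chart[OF c(1)] x(3)] by simp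
    have off: "\<delta>' t \<in> chart_image c'" "param c' (\<delta>' t) \<notin> curve"
      using 1 2 gx by (auto simp: x_def)
    have "local_sign \<epsilon> x c' = jacobian_sign c c' x * local_sign \<epsilon> x c" by (rule local_sign_change[OF c(1,2) x(3,2)])
    also have "jacobian_sign c c' x = jacobian_sign c c' (f p)" using V(4) x(1) by blast
    also have "local_sign \<epsilon> x c = sgn t * sgn (cross (velocity b c p) (L v')) * dir p b" using 1 gx by simp
    also have "\<dots> = sgn t * (sgn r * jacobian_sign c c' (f p) * sgn (cross (velocity b' c' p) v')) * dir p b"
      unfolding crL by (simp add: sgn_mult jL)
    also have "jacobian_sign c c' (f p) * \<dots> = sgn t * sgn (cross (velocity b' c' p) v') * (sgn r * dir p b)"
      using js by auto
    also have "sgn r * dir p b = dir p b'"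
      unfolding r_def using dir_change[OF reg b] by simp
    finally have "local_sign \<epsilon> (param c' (\<delta>' t)) c' = sgn t * sgn (cross (velocity b' c' p) v') * dir p b'"
      by (simp add: x_def)
    then show "\<delta>' t \<in> chart_image c' \<and> crossing_sign \<epsilon> p b' c' v' t (param c' (\<delta>' t))"
      using off by (simp add: crossing_sign_def)
  qed
qed

lemma adaptedI:
  assumes "regular p" "b \<in> B" "p \<in> chart_dom b" "c \<in> A" "f p \<in> chart_dom c" "adapted_in \<epsilon> p b c"
  shows "adapted \<epsilon> p"
  unfolding adapted_def using assms adapted_in_change by blast

lemma adapted_cong:
  assumes ad: "adapted \<epsilon> p" and U: "openin S U" "f p \<in> U" and eq: "\<And>x. x \<in> U \<Longrightarrow> x \<notin> curve \<Longrightarrow> \<epsilon> x = \<epsilon>' x"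
  shows "adapted \<epsilon>' p"
  unfolding adapted_def adapted_in_def
proof (intro ballI allI impI)
  fix b c \<delta> v
  assume h: "b \<in> B" "c \<in> A" "p \<in> chart_dom b" "f p \<in> chart_dom c" "\<delta> 0 = coord c (f p)"
    "(\<delta> has_vector_derivative v) (at 0)" "cross (velocity b c p) v \<noteq> 0"
  have 1: "\<forall>\<^sub>F t in at 0. \<delta> t \<in> chart_image c \<and> crossing_sign \<epsilon> p b c v t (param c (\<delta> t))"
    using ad h unfolding adapted_def adapted_in_def by blast
  have "\<forall>\<^sub>F t in at 0. \<delta> t \<in> chart_image c \<and> param c (\<delta> t) \<in> U \<inter> chart_dom c"
    using path_eventually[OF h(2,4) U has_vector_derivative_continuous[OF h(6)] h(5)] .
  with 1 show "\<forall>\<^sub>F t in at 0. \<delta> t \<in> chart_image c \<and> crossing_sign \<epsilon>' p b c v t (param c (\<delta> t))"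
  proof (rule eventually_elim2)
    fix t assume 1: "\<delta> t \<in> chart_image c \<and> crossing_sign \<epsilon> p b c v t (param c (\<delta> t))"
      and 2: "\<delta> t \<in> chart_image c \<and> param c (\<delta> t) \<in> U \<inter> chart_dom c"
    have "\<epsilon> (param c (\<delta> t)) = \<epsilon>' (param c (\<delta> t))" using 1 2 eq unfolding crossing_sign_def by blast
    then have "local_sign \<epsilon>' (param c (\<delta> t)) c = local_sign \<epsilon> (param c (\<delta> t)) c" by (simp add: local_sign_def)
    then show "\<delta> t \<in> chart_image c \<and> crossing_sign \<epsilon>' p b c v t (param c (\<delta> t))"
      using 1 by (simp add: crossing_sign_def)
  qed
qed

end

section \<open>Coordinate boxes around the points of the curve\<close>

text \<open>A path that leaves a coordinate line transversally changes sides there.\<close>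

lemma sgn_eventually_of_derivative:
  fixes g :: "real \<Rightarrow> real"
  assumes "(g has_vector_derivative l) (at 0)" "g 0 = 0" "l \<noteq> 0"
  shows "\<forall>\<^sub>F t in at 0. sgn (g t) = sgn t * sgn l"
proof -
  have "(g has_field_derivative l) (at 0)"
    using assms(1) by (simp add: has_real_derivative_iff_has_vector_derivative)
  then have "((\<lambda>t. g t / t) \<longlongrightarrow> l) (at 0)"
    using assms(2) by (simp add: has_field_derivative_iff)
  then have "((\<lambda>t. g t / t * l) \<longlongrightarrow> l * l) (at 0)" by (intro tendsto_intros)
  moreover have "l * l > 0" using assms(3) not_real_square_gt_zero by blast
  ultimately have "\<forall>\<^sub>F t in at 0. g t / t * l > 0" by (rule order_tendstoD)
  then show ?thesis
    by (rule eventually_mono) (auto simp: sgn_if zero_less_mult_iff zero_less_divide_iff divide_less_0_iff mult_less_0_iff)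
qed

lemma cross_cramer:
  assumes "cross a b \<noteq> 0"
  shows "(v :: real ^ 2) = (cross v b / cross a b) *\<^sub>R a + (cross a v / cross a b) *\<^sub>R b"
proof -
  have "cross a b *\<^sub>R v = cross v b *\<^sub>R a + cross a v *\<^sub>R b"
    by (simp add: vec_eq_iff forall_2 cross_def algebra_simps)
  then have "(1 / cross a b) *\<^sub>R (cross a b *\<^sub>R v) = (1 / cross a b) *\<^sub>R (cross v b *\<^sub>R a + cross a v *\<^sub>R b)"
    by simp
  then show ?thesis using assms by (simp add: scaleR_add_right)
qed

text \<open>The outcome of straightening the curve around \<open>y\<close>. In the coordinates \<open>w\<close> on a square, the curve
  consists of the first axis, parametrized by \<open>\<mu>\<close>, and, if \<open>dbl\<close> holds, of the second axis,
  parametrized by \<open>\<nu>\<close>. The vectors \<open>\<alpha>'\<close> and \<open>\<beta>'\<close> are the images of the basis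
  vectors under the differential of \<open>\<Phi>\<close>. The last assumption says that the square meets no other
  part of the curve.\<close>

locale crossing_box = oriented_generic_curve S A M B f dir
  for S :: "'a topology" and A :: "('a, real ^ 2) chart set"
    and M :: "'b topology" and B :: "('b, real) chart set" and f dir +
  fixes c :: "('a, real ^ 2) chart" and y :: 'a and dbl :: bool and \<mu> \<nu> :: "real \<Rightarrow> 'b"
    and \<alpha>' \<beta>' :: "real \<Rightarrow> real ^ 2" and \<Phi> \<Psi> :: "real ^ 2 \<Rightarrow> real ^ 2" and \<rho> :: real
  assumes c: "c \<in> A" and y: "y \<in> chart_dom c" and \<rho>: "\<rho> > 0" and \<Phi>0: "\<Phi> 0 = coord c y"
    and \<Phi>_in: "\<And>w. w \<in> square \<rho> \<Longrightarrow> \<Phi> w \<in> chart_image c"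
    and \<Psi>: "\<And>w. w \<in> square \<rho> \<Longrightarrow> \<Psi> (\<Phi> w) = w"
    and \<Phi>_open: "\<And>W. open W \<Longrightarrow> W \<subseteq> square \<rho> \<Longrightarrow> open (\<Phi> ` W)"
    and \<Phi>_cont: "continuous_on (square \<rho>) \<Phi>"
    and \<Psi>_deriv: "\<And>w. w \<in> square \<rho> \<Longrightarrow> \<exists>\<Psi>'. (\<Psi> has_derivative \<Psi>') (at (\<Phi> w)) \<and>
        (\<forall>v. \<Psi>' (v $ 1 *\<^sub>R \<alpha>' (w $ 1) + v $ 2 *\<^sub>R \<beta>' (w $ 2)) = v)"
    and cross_nz: "cross (\<alpha>' 0) (\<beta>' 0) \<noteq> 0"
    and cross_sgn: "\<And>w. w \<in> square \<rho> \<Longrightarrow> sgn (cross (\<alpha>' (w $ 1)) (\<beta>' (w $ 2))) = sgn (cross (\<alpha>' 0) (\<beta>' 0))"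
    and axis_curve: "\<And>w. w \<in> square \<rho> \<Longrightarrow> w $ 2 = 0 \<or> dbl \<and> w $ 1 = 0 \<Longrightarrow> param c (\<Phi> w) \<in> f ` topspace M"
    and hit: "\<And>w m. w \<in> square \<rho> \<Longrightarrow> m \<in> topspace M \<Longrightarrow> f m = param c (\<Phi> w) \<Longrightarrow>
        w $ 2 = 0 \<and> m = \<mu> (w $ 1) \<or> dbl \<and> w $ 1 = 0 \<and> m = \<nu> (w $ 2)"
begin

definition box_point :: "real ^ 2 \<Rightarrow> 'a" where
  "box_point w = param c (\<Phi> w)"

lemma box_coord: "w \<in> square \<rho> \<Longrightarrow> coord c (box_point w) = \<Phi> w"
  and box_dom: "w \<in> square \<rho> \<Longrightarrow> box_point w \<in> chart_dom c"
  unfolding box_point_def using coord_param[OF \<Phi>_in] param_in[OF \<Phi>_in] by blast+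

lemma box_inverse: "w \<in> square \<rho> \<Longrightarrow> \<Psi> (coord c (box_point w)) = w"
  by (simp add: box_coord \<Psi>)

lemma zero_in_square: "0 \<in> square \<rho>"
  using \<rho> by (simp add: square_def)

lemma box_0: "box_point 0 = y"
  unfolding box_point_def \<Phi>0 by (rule param_coord[OF atlas_chart[OF c] y])

lemma openin_box:
  assumes "open W" "W \<subseteq> square \<rho>"
  shows "openin S (box_point ` W)"
proof -
  have "\<Phi> ` W \<subseteq> chart_image c" using \<Phi>_in assms(2) by blast
  then have "openin S (param c ` (\<Phi> ` W))"
    by (rule openin_param_image[OF atlas_chart[OF c] \<Phi>_open[OF assms]])
  then show ?thesis by (simp add: box_point_def image_image)
qed

lemma connectedin_box:
  assumes "connected W" "W \<subseteq> square \<rho>"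
  shows "connectedin S (box_point ` W)"
proof -
  have "\<Phi> ` W \<subseteq> chart_image c" using \<Phi>_in assms(2) by blast
  moreover have "connected (\<Phi> ` W)"
    by (rule connected_continuous_image[OF continuous_on_subset[OF \<Phi>_cont assms(2)] assms(1)])
  ultimately have "connectedin S (param c ` (\<Phi> ` W))"
    by (intro connectedin_param_image[OF atlas_chart[OF c]])
  then show ?thesis by (simp add: box_point_def image_image)
qed

lemma box_curve: "w \<in> square \<rho> \<Longrightarrow> box_point w \<in> curve \<longleftrightarrow> w $ 2 = 0 \<or> dbl \<and> w $ 1 = 0"
  using axis_curve hit unfolding box_point_def by (metis imageE)

text \<open>The orientation of the square minus the curve whose sign with respect to \<open>c\<close> is that of \<open>k * h\<close>. For
  regular points \<open>h\<close> will be the second coordinate, for double points the product of both, in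
  accordance with the alternation of signs around the four quadrants.\<close>

definition box_orientation :: "real \<Rightarrow> (real ^ 2 \<Rightarrow> real) \<Rightarrow> 'a \<Rightarrow> real" where
  "box_orientation k h x = jacobian_sign (home_chart x) c x * (k * sgn (h (\<Psi> (coord c x))))"

lemma box_orientation:
  assumes k: "k \<in> {1, -1}" and h: "continuous_on UNIV h"
    and hz: "\<And>w. w \<in> square \<rho> \<Longrightarrow> h w = 0 \<longleftrightarrow> w $ 2 = 0 \<or> dbl \<and> w $ 1 = 0"
  shows "orients (box_point ` square \<rho> - curve) (box_orientation k h)"
    and "w \<in> square \<rho> \<Longrightarrow> box_point w \<notin> curve \<Longrightarrow> local_sign (box_orientation k h) (box_point w) c = k * sgn (h w)"
proof -
  define U where "U = box_point ` square \<rho> - curve"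
  define H where "H x = k * sgn (h (\<Psi> (coord c x)))" for x
  have U: "U \<subseteq> chart_dom c" unfolding U_def using box_dom by blast
  have Hb: "H (box_point w) = k * sgn (h w)" if "w \<in> square \<rho>" for w
    unfolding H_def using box_inverse[OF that] by simp
  have nz: "h w \<noteq> 0" if "w \<in> square \<rho>" "box_point w \<notin> curve" for w
    using that hz box_curve by blast
  have sH: "H x \<in> {1, -1}" if "x \<in> U" for x
  proof -
    from that obtain w where w: "x = box_point w" "w \<in> square \<rho>" "box_point w \<notin> curve" unfolding U_def by blast
    then show ?thesis using nz[OF w(2,3)] k Hb[OF w(2)] by (auto simp: sgn_if)
  qed
  have lH: "\<exists>V. openin S V \<and> x \<in> V \<and> (\<forall>z\<in>V \<inter> U. H z = H x)" if "x \<in> U" for x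
  proof -
    from that obtain w where w: "x = box_point w" "w \<in> square \<rho>" "box_point w \<notin> curve" unfolding U_def by blast
    \<comment> \<open>The points where \<open>h\<close> has the same sign as at \<open>w\<close>.\<close>
    define W where "W = square \<rho> \<inter> (\<lambda>w'. h w' * h w) -` {0<..}"
    have "open W" unfolding W_def
      by (intro continuous_open_preimage[OF _ open_square] continuous_intros continuous_on_subset[OF h]) auto
    then have "openin S (box_point ` W)" by (rule openin_box) (auto simp: W_def)
    moreover have "h w * h w > 0" using nz[OF w(2,3)] not_real_square_gt_zero by blast
    then have "x \<in> box_point ` W" unfolding w(1) W_def using w(2) by auto
    moreover have "H z = H x" if z: "z \<in> box_point ` W" for z
    proof -
      from z obtain w' where w': "z = box_point w'" "w' \<in> square \<rho>" "h w' * h w > 0" by (auto simp: W_def)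
      from w'(3) have "sgn (h w') = sgn (h w)" by (auto simp: zero_less_mult_iff)
      then show ?thesis unfolding w(1) w'(1) by (simp add: Hb w(2) w'(2))
    qed
    ultimately show ?thesis by blast
  qed
  have eq: "box_orientation k h = (\<lambda>x. jacobian_sign (home_chart x) c x * H x)"
    by (simp add: fun_eq_iff box_orientation_def H_def)
  show "orients (box_point ` square \<rho> - curve) (box_orientation k h)"
    unfolding eq U_def[symmetric] by (rule orients_chart(1)[OF c U sH lH])
  show "local_sign (box_orientation k h) (box_point w) c = k * sgn (h w)" if w: "w \<in> square \<rho>" "box_point w \<notin> curve"
  proof -
    have "box_point w \<in> U" using w by (simp add: U_def)
    then have "local_sign (\<lambda>x. jacobian_sign (home_chart x) c x * H x) (box_point w) c = H (box_point w)"
      by (intro orients_chart(2)[OF c U sH lH])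
    then show ?thesis unfolding eq using Hb[OF w(1)] by simp
  qed
qed

text \<open>Here \<open>i\<close> is the coordinate transverse to the branch through \<open>w0\<close>. The sign of a path in
  direction \<open>v\<close> is determined by the \<open>i\<close>-th coordinate of \<open>v\<close>, on which the area depends with the
  sign \<open>\<eta>\<close>; beside the branch, \<open>h\<close> is \<open>\<sigma>\<close> times that coordinate. So everything
  reduces to the equation for \<open>dir m b\<close>.\<close>

lemma box_orientation_adapted:
  fixes i :: 2
  assumes k: "k \<in> {1, -1}" and h: "continuous_on UNIV h"
    and hz: "\<And>w. w \<in> square \<rho> \<Longrightarrow> h w = 0 \<longleftrightarrow> w $ 2 = 0 \<or> dbl \<and> w $ 1 = 0"
    and reg: "regular m" and b: "b \<in> B" "m \<in> chart_dom b" and w0: "w0 \<in> square \<rho>" "f m = box_point w0" "w0 $ i = 0"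
    and W: "open W" "w0 \<in> W" "\<And>w. w \<in> W \<Longrightarrow> sgn (h w) = sgn (w $ i) * \<sigma>" and \<sigma>: "\<sigma> \<in> {1, -1}"
    and \<eta>: "\<And>u. sgn (cross (velocity b c m) (u $ 1 *\<^sub>R \<alpha>' (w0 $ 1) + u $ 2 *\<^sub>R \<beta>' (w0 $ 2))) = \<eta> * sgn (u $ i)"
    and \<eta>1: "\<eta> \<in> {1, -1}" and dirm: "dir m b = k * \<sigma> * \<eta>"
  shows "adapted (box_orientation k h) m"
proof (rule adaptedI[OF reg b c])
  show "f m \<in> chart_dom c" using w0 box_dom by simp
  show "adapted_in (box_orientation k h) m b c"
    unfolding adapted_in_def
  proof (intro allI impI)
    fix \<delta> v assume \<delta>: "\<delta> 0 = coord c (f m)" "(\<delta> has_vector_derivative v) (at 0)"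
      and cr: "cross (velocity b c m) v \<noteq> 0"
    have \<delta>0: "\<delta> 0 = \<Phi> w0" unfolding \<delta>(1) w0(2) by (rule box_coord[OF w0(1)])
    obtain \<Psi>' where \<Psi>': "(\<Psi> has_derivative \<Psi>') (at (\<Phi> w0))"
      "\<And>v. \<Psi>' (v $ 1 *\<^sub>R \<alpha>' (w0 $ 1) + v $ 2 *\<^sub>R \<beta>' (w0 $ 2)) = v"
      using \<Psi>_deriv[OF w0(1)] by blast
    have cr0: "cross (\<alpha>' (w0 $ 1)) (\<beta>' (w0 $ 2)) \<noteq> 0"
      using cross_sgn[OF w0(1)] cross_nz by (metis sgn_0_0)
    obtain u :: "real ^ 2" where u: "v = u $ 1 *\<^sub>R \<alpha>' (w0 $ 1) + u $ 2 *\<^sub>R \<beta>' (w0 $ 2)"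
    proof
      show "v = (vector [cross v (\<beta>' (w0 $ 2)) / cross (\<alpha>' (w0 $ 1)) (\<beta>' (w0 $ 2)),
          cross (\<alpha>' (w0 $ 1)) v / cross (\<alpha>' (w0 $ 1)) (\<beta>' (w0 $ 2))] :: real ^ 2) $ 1 *\<^sub>R \<alpha>' (w0 $ 1) +
        (vector [cross v (\<beta>' (w0 $ 2)) / cross (\<alpha>' (w0 $ 1)) (\<beta>' (w0 $ 2)),
          cross (\<alpha>' (w0 $ 1)) v / cross (\<alpha>' (w0 $ 1)) (\<beta>' (w0 $ 2))] :: real ^ 2) $ 2 *\<^sub>R \<beta>' (w0 $ 2)"
        unfolding vector_2 by (rule cross_cramer[OF cr0])
    qed
    have \<Psi>'v: "\<Psi>' v = u" unfolding u by (rule \<Psi>'(2))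
    have sgn_cr: "sgn (cross (velocity b c m) v) = \<eta> * sgn (u $ i)" unfolding u by (rule \<eta>)
    then have ui: "u $ i \<noteq> 0" using cr by (auto simp: sgn_0_0)
    have lin: "linear \<Psi>'" using \<Psi>'(1) has_derivative_linear by blast
    have "((\<lambda>t. \<Psi> (\<delta> t)) has_vector_derivative u) (at 0)"
      using has_derivative_compose[OF \<delta>(2)[unfolded has_vector_derivative_def], of \<Psi> \<Psi>'] \<Psi>'(1) \<Psi>'v \<delta>0
      by (simp add: has_vector_derivative_def linear_scale[OF lin])
    then have "((\<lambda>t. \<Psi> (\<delta> t) $ i) has_vector_derivative u $ i) (at 0)"
      by (rule bounded_linear.has_vector_derivative[OF bounded_linear_vec_nth])
    then have ev1: "\<forall>\<^sub>F t in at 0. sgn (\<Psi> (\<delta> t) $ i) = sgn t * sgn (u $ i)"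
      by (rule sgn_eventually_of_derivative) (use ui w0 \<delta>0 \<Psi> in simp_all)
    have oW: "open (\<Phi> ` (W \<inter> square \<rho>))" by (rule \<Phi>_open) (use W(1) open_square in auto)
    have "(\<delta> \<longlongrightarrow> \<delta> 0) (at 0)"
      using has_vector_derivative_continuous[OF \<delta>(2)] by (simp add: isCont_def)
    then have ev2: "\<forall>\<^sub>F t in at 0. \<delta> t \<in> \<Phi> ` (W \<inter> square \<rho>)"
      by (rule topological_tendstoD[OF _ oW]) (use \<delta>0 w0(1) W(2) in blast)
    have ev3: "\<forall>\<^sub>F t in at (0::real). t \<noteq> 0" by (simp add: eventually_at_filter)
    from ev1 ev2 ev3 show "\<forall>\<^sub>F t in at 0. \<delta> t \<in> chart_image c \<and> crossing_sign (box_orientation k h) m b c v t (param c (\<delta> t))"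
    proof eventually_elim
      case (elim t)
      then obtain w where w: "w \<in> W" "w \<in> square \<rho>" "\<delta> t = \<Phi> w" by blast
      have pw: "param c (\<delta> t) = box_point w" by (simp add: box_point_def w(3))
      have sw: "sgn (w $ i) = sgn t * sgn (u $ i)" using elim(1) \<Psi>[OF w(2)] w(3) by simp
      have hw: "sgn (h w) = sgn t * sgn (u $ i) * \<sigma>" using W(3)[OF w(1)] sw by simp
      have "sgn (h w) \<noteq> 0" unfolding hw using elim(3) ui \<sigma> by (auto simp: sgn_zero_iff)
      then have "h w \<noteq> 0" by auto
      then have nc: "box_point w \<notin> curve" using box_curve[OF w(2)] hz[OF w(2)] by blast
      have "local_sign (box_orientation k h) (box_point w) c = k * sgn (h w)"
        by (rule box_orientation(2)[OF k h hz w(2) nc])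
      also have "\<dots> = sgn t * (\<eta> * sgn (u $ i)) * (k * \<sigma> * \<eta>)"
        unfolding hw using \<eta>1 by auto
      finally show ?case
        unfolding pw crossing_sign_def sgn_cr dirm using \<Phi>_in[OF w(2)] w(3) nc by simp
    qed
  qed
qed

end

context oriented_generic_curve
begin

text \<open>The image of the compact set of points outside \<open>N\<close> is closed and misses \<open>y\<close>.\<close>

lemma fibre_neighbourhood:
  assumes "openin M N" "y \<in> topspace S" "\<And>p. p \<in> topspace M \<Longrightarrow> f p = y \<Longrightarrow> p \<in> N"
  obtains U where "openin S U" "y \<in> U" "\<And>p. p \<in> topspace M \<Longrightarrow> f p \<in> U \<Longrightarrow> p \<in> N"
proof -
  define K where "K = topspace M - N"
  have "closedin M K" unfolding K_def using assms(1) by blast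
  then have "compactin M K" using compact_base closedin_compact_space by blast
  then have "compactin S (f ` K)" by (rule image_compactin[OF _ continuous_curve])
  then have "closedin S (f ` K)" using compactin_imp_closedin[OF Hausdorff] by blast
  then have 1: "openin S (topspace S - f ` K)" by blast
  show thesis
  proof (rule that[OF 1])
    show "y \<in> topspace S - f ` K" using assms(2,3) by (auto simp: K_def)
    show "p \<in> N" if "p \<in> topspace M" "f p \<in> topspace S - f ` K" for p
      using that by (auto simp: K_def)
  qed
qed

text \<open>Parametrizes the curve near \<open>p\<close> by the coordinate, shifted so that \<open>p\<close> has parameter \<open>0\<close>.\<close>

definition arc_point :: "('b, real) chart \<Rightarrow> 'b \<Rightarrow> real \<Rightarrow> 'b" where
  "arc_point b p s = param b (coord b p + s)"

lemma arc_in_chart: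
  assumes "b \<in> B" "c \<in> A" "p \<in> chart_dom b" "f p \<in> chart_dom c"
  obtains r where "r > 0"
    "\<And>s. \<bar>s\<bar> < r \<Longrightarrow> arc_point b p s \<in> chart_dom b \<and> f (arc_point b p s) \<in> chart_dom c \<and> coord b (arc_point b p s) = coord b p + s"
    "\<And>s. \<bar>s\<bar> < r \<Longrightarrow> ((\<lambda>s. coord c (f (arc_point b p s))) has_vector_derivative velocity b c (arc_point b p s)) (at s)"
    "continuous_on {-r<..<r} (\<lambda>s. velocity b c (arc_point b p s))"
proof -
  define U where "U = coord b ` {q \<in> chart_dom b. f q \<in> chart_dom c}"
  have sm: "smooth_on U (in_charts b c f)"
    unfolding U_def using smooth_curve assms by (simp add: smooth_map_def)
  have "openin M {q \<in> topspace M. f q \<in> chart_dom c}"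
    by (rule openin_continuous_map_preimage[OF continuous_curve chart_openin[OF atlas_chart[OF assms(2)]]])
  then have "open (coord b ` ({q \<in> topspace M. f q \<in> chart_dom c} \<inter> chart_dom b))"
    by (rule open_coord_image[OF base_chart[OF assms(1)]])
  moreover have "{q \<in> topspace M. f q \<in> chart_dom c} \<inter> chart_dom b = {q \<in> chart_dom b. f q \<in> chart_dom c}"
    using base_topspace[OF assms(1)] by blast
  ultimately have "open U" by (simp add: U_def)
  moreover have "coord b p \<in> U" using assms by (auto simp: U_def)
  ultimately obtain r where r: "r > 0" "ball (coord b p) r \<subseteq> U" by (meson openE)
  have inU: "coord b p + s \<in> U" if "\<bar>s\<bar> < r" for s
    using r(2) that by (auto simp: dist_real_def)
  have 1: "arc_point b p s \<in> chart_dom b \<and> f (arc_point b p s) \<in> chart_dom c \<and> coord b (arc_point b p s) = coord b p + s"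
    if "\<bar>s\<bar> < r" for s
  proof -
    from inU[OF that] obtain q where q: "coord b p + s = coord b q" "q \<in> chart_dom b" "f q \<in> chart_dom c"
      unfolding U_def by blast
    have "arc_point b p s = q" unfolding arc_point_def q(1) by (rule param_coord[OF base_chart[OF assms(1)] q(2)])
    then show ?thesis using q by simp
  qed
  have eq: "coord c (f (arc_point b p s)) = in_charts b c f (coord b p + s)" for s
    by (simp add: in_charts_def arc_point_def)
  show thesis
  proof (rule that[OF r(1) 1])
    fix s assume s: "\<bar>s\<bar> < r"
    have "(in_charts b c f has_vector_derivative velocity b c (arc_point b p s)) (at (coord b p + s))"
      using velocity(1)[OF assms(1,2), of "arc_point b p s"] 1[OF s] by simp
    moreover have "((\<lambda>s. coord b p + s) has_vector_derivative 1) (at s)"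
      by (auto intro!: derivative_eq_intros)
    ultimately have "(in_charts b c f \<circ> (\<lambda>s. coord b p + s) has_vector_derivative 1 *\<^sub>R velocity b c (arc_point b p s)) (at s)"
      by (intro vector_diff_chain_at)
    then show "((\<lambda>s. coord c (f (arc_point b p s))) has_vector_derivative velocity b c (arc_point b p s)) (at s)"
      by (simp add: eq o_def)
  next
    have "continuous_on {-r<..<r} (\<lambda>s. frechet_derivative (in_charts b c f) (at (coord b p + s)) 1)"
      by (rule continuous_on_compose2[OF smooth_on_continuous_derivative[OF sm, of 1]])
        (use inU in \<open>auto intro!: continuous_intros simp: abs_less_iff\<close>)
    then show "continuous_on {-r<..<r} (\<lambda>s. velocity b c (arc_point b p s))"
      by (rule continuous_on_eq) (use 1 in \<open>auto simp: velocity_def deriv_in_charts_def abs_less_iff\<close>)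
  qed auto
qed

text \<open>The straightening yields a first square, of size \<open>\<rho>0\<close>. All points of the curve close to \<open>y\<close> have
  parameters less than \<open>\<rho>0\<close> by \<open>near\<close>, so they lie on the axes of the first square; a second,
  smaller square is chosen among the points close to \<open>y\<close>. Injectivity on the first square then
  identifies the parameters.\<close>

lemma crossing_box_exists:
  assumes c: "c \<in> A" and y: "y \<in> chart_dom c" and U: "openin S U" "y \<in> U" and r: "r > 0"
    and \<alpha>: "\<And>s. \<bar>s\<bar> < r \<Longrightarrow> (\<alpha> has_vector_derivative \<alpha>' s) (at s)"
    and \<beta>: "\<And>s. \<bar>s\<bar> < r \<Longrightarrow> (\<beta> has_vector_derivative \<beta>' s) (at s)"
    and c\<alpha>: "continuous_on {-r<..<r} \<alpha>'" and c\<beta>: "continuous_on {-r<..<r} \<beta>'"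
    and \<alpha>0: "\<alpha> 0 = coord c y" and \<beta>0: "\<beta> 0 = coord c y" and cr: "cross (\<alpha>' 0) (\<beta>' 0) \<noteq> 0"
    and \<mu>: "\<And>s. \<bar>s\<bar> < r \<Longrightarrow> \<mu> s \<in> topspace M \<and> f (\<mu> s) \<in> chart_dom c \<and> \<alpha> s = coord c (f (\<mu> s))"
    and \<nu>: "\<And>s. dbl \<Longrightarrow> \<bar>s\<bar> < r \<Longrightarrow> \<nu> s \<in> topspace M \<and> f (\<nu> s) \<in> chart_dom c \<and> \<beta> s = coord c (f (\<nu> s))"
    and near: "\<And>\<rho>. 0 < \<rho> \<Longrightarrow> \<rho> \<le> r \<Longrightarrow> \<exists>U1. openin S U1 \<and> y \<in> U1 \<and>
        (\<forall>m\<in>topspace M. f m \<in> U1 \<longrightarrow> (\<exists>s. \<bar>s\<bar> < \<rho> \<and> (m = \<mu> s \<or> dbl \<and> m = \<nu> s)))"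
    and \<Phi>: "\<And>w. \<Phi> w = \<alpha> (w $ 1) + \<beta> (w $ 2) - coord c y"
  obtains \<Psi> \<rho> where "crossing_box S A M B f dir c y dbl \<mu> \<nu> \<alpha>' \<beta>' \<Phi> \<Psi> \<rho>" "\<rho> \<le> r"
    "\<And>w. w \<in> square \<rho> \<Longrightarrow> param c (\<Phi> w) \<in> U"
proof -
  obtain \<rho>0 \<Psi> where st: "0 < \<rho>0" "\<rho>0 \<le> r" "continuous_on (square \<rho>0) \<Phi>"
    "\<And>w. w \<in> square \<rho>0 \<Longrightarrow> \<Psi> (\<Phi> w) = w"
    "\<And>W. open W \<Longrightarrow> W \<subseteq> square \<rho>0 \<Longrightarrow> open (\<Phi> ` W)"
    "\<And>w. w \<in> square \<rho>0 \<Longrightarrow> \<exists>\<Psi>'. (\<Psi> has_derivative \<Psi>') (at (\<Phi> w)) \<and>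
        (\<forall>v. \<Psi>' (v $ 1 *\<^sub>R \<alpha>' (w $ 1) + v $ 2 *\<^sub>R \<beta>' (w $ 2)) = v)"
    "\<And>w. w \<in> square \<rho>0 \<Longrightarrow> sgn (cross (\<alpha>' (w $ 1)) (\<beta>' (w $ 2))) = sgn (cross (\<alpha>' 0) (\<beta>' 0))"
    using straighten[OF r \<alpha> \<beta> c\<alpha> c\<beta> cr \<Phi>] by metis
  obtain U1 where U1: "openin S U1" "y \<in> U1"
    "\<And>m. m \<in> topspace M \<Longrightarrow> f m \<in> U1 \<Longrightarrow> \<exists>s. \<bar>s\<bar> < \<rho>0 \<and> (m = \<mu> s \<or> dbl \<and> m = \<nu> s)"
    using near[OF st(1,2)] by blast
  define G where "G = coord c ` ((U1 \<inter> U) \<inter> chart_dom c)"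
  have "open G" unfolding G_def
    by (rule open_coord_image[OF atlas_chart[OF c] openin_Int[OF U1(1) U(1)]])
  then have "open (square \<rho>0 \<inter> \<Phi> -` G)" by (intro continuous_open_preimage st(3) open_square)
  moreover have "0 \<in> square \<rho>0 \<inter> \<Phi> -` G"
    using st(1) U1(2) U(2) y by (simp add: square_def \<Phi> \<alpha>0 \<beta>0 G_def)
  ultimately obtain \<rho> where \<rho>: "\<rho> > 0" "square \<rho> \<subseteq> square \<rho>0 \<inter> \<Phi> -` G" by (rule square_subset_open)
  have sub: "w \<in> square \<rho>0" and inG: "\<Phi> w \<in> G" if "w \<in> square \<rho>" for w using \<rho>(2) that by blast+
  have inGD: "\<Phi> w \<in> chart_image c" "param c (\<Phi> w) \<in> U1" "param c (\<Phi> w) \<in> U" if w: "w \<in> square \<rho>" for w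
  proof -
    from inG[OF w] obtain x where x: "x \<in> U1" "x \<in> U" "x \<in> chart_dom c" "\<Phi> w = coord c x"
      unfolding G_def by blast
    show "\<Phi> w \<in> chart_image c" using x by simp
    have "param c (\<Phi> w) = x" unfolding x(4) by (rule param_coord[OF atlas_chart[OF c] x(3)])
    then show "param c (\<Phi> w) \<in> U1" "param c (\<Phi> w) \<in> U" using x by simp_all
  qed
  have w_lt: "\<bar>w $ i\<bar> < \<rho>0" if "w \<in> square \<rho>" for w i
    using sub[OF that] exhaust_2[of i] by (auto simp: square_def)
  have w_r: "\<bar>w $ i\<bar> < r" if "w \<in> square \<rho>" for w i
    using w_lt[OF that, of i] st(2) by linarith
  have \<rho>le: "\<rho> \<le> r"
  proof (rule ccontr)
    assume "\<not> \<rho> \<le> r"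
    then have "(r *\<^sub>R axis 1 1 :: real ^ 2) \<in> square \<rho>" using r by (simp add: square_def axis_def)
    from w_r[OF this, of 1] r show False by (simp add: axis_def)
  qed
  have "crossing_box S A M B f dir c y dbl \<mu> \<nu> \<alpha>' \<beta>' \<Phi> \<Psi> \<rho>"
  proof unfold_locales
    show "c \<in> A" "y \<in> chart_dom c" "\<rho> > 0" "cross (\<alpha>' 0) (\<beta>' 0) \<noteq> 0" using c y \<rho> cr by auto
    show "\<Phi> 0 = coord c y" by (simp add: \<Phi> \<alpha>0 \<beta>0)
    show "continuous_on (square \<rho>) \<Phi>" using st(3) sub by (meson continuous_on_subset subsetI)
    show "open (\<Phi> ` W)" if "open W" "W \<subseteq> square \<rho>" for W using st(5) that sub by blast
    fix w assume w: "w \<in> square \<rho>"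
    show "\<Phi> w \<in> chart_image c" by (rule inGD(1)[OF w])
    show "\<Psi> (\<Phi> w) = w" by (rule st(4)[OF sub[OF w]])
    show "\<exists>\<Psi>'. (\<Psi> has_derivative \<Psi>') (at (\<Phi> w)) \<and>
        (\<forall>v. \<Psi>' (v $ 1 *\<^sub>R \<alpha>' (w $ 1) + v $ 2 *\<^sub>R \<beta>' (w $ 2)) = v)"
      by (rule st(6)[OF sub[OF w]])
    show "sgn (cross (\<alpha>' (w $ 1)) (\<beta>' (w $ 2))) = sgn (cross (\<alpha>' 0) (\<beta>' 0))"
      by (rule st(7)[OF sub[OF w]])
    show "param c (\<Phi> w) \<in> f ` topspace M" if "w $ 2 = 0 \<or> dbl \<and> w $ 1 = 0"
      using that
    proof
      assume w2: "w $ 2 = 0"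
      have m: "\<mu> (w $ 1) \<in> topspace M" "f (\<mu> (w $ 1)) \<in> chart_dom c" "\<alpha> (w $ 1) = coord c (f (\<mu> (w $ 1)))"
        using \<mu>[OF w_r[OF w]] by auto
      have "\<Phi> w = coord c (f (\<mu> (w $ 1)))" using w2 m(3) by (simp add: \<Phi> \<beta>0)
      then have "param c (\<Phi> w) = f (\<mu> (w $ 1))" using param_coord[OF atlas_chart[OF c] m(2)] by simp
      then show ?thesis using m(1) by blast
    next
      assume w1: "dbl \<and> w $ 1 = 0"
      have m: "\<nu> (w $ 2) \<in> topspace M" "f (\<nu> (w $ 2)) \<in> chart_dom c" "\<beta> (w $ 2) = coord c (f (\<nu> (w $ 2)))"
        using \<nu>[OF _ w_r[OF w]] w1 by auto
      have "\<Phi> w = coord c (f (\<nu> (w $ 2)))" using w1 m(3) by (simp add: \<Phi> \<alpha>0)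
      then have "param c (\<Phi> w) = f (\<nu> (w $ 2))" using param_coord[OF atlas_chart[OF c] m(2)] by simp
      then show ?thesis using m(1) by blast
    qed
    fix m assume m: "m \<in> topspace M" "f m = param c (\<Phi> w)"
    have "f m \<in> U1" using m(2) inGD(2)[OF w] by simp
    then obtain s where s: "\<bar>s\<bar> < \<rho>0" "m = \<mu> s \<or> dbl \<and> m = \<nu> s" using U1(3) m(1) by blast
    have sr: "\<bar>s\<bar> < r" using s(1) st(2) by linarith
    have cm: "coord c (f m) = \<Phi> w" unfolding m(2) by (rule coord_param[OF inGD(1)[OF w]])
    from s(2) show "w $ 2 = 0 \<and> m = \<mu> (w $ 1) \<or> dbl \<and> w $ 1 = 0 \<and> m = \<nu> (w $ 2)"
    proof
      assume ms: "m = \<mu> s"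
      define w' where "w' = (s *\<^sub>R axis 1 1 :: real ^ 2)"
      have w': "w' $ 1 = s" "w' $ 2 = 0" by (simp_all add: w'_def axis_def)
      have "w' \<in> square \<rho>0" using s(1) st(1) w' by (simp add: square_def)
      moreover have "\<Phi> w' = \<Phi> w" using \<mu>[OF sr] cm ms by (simp add: \<Phi>[of w'] w' \<beta>0)
      ultimately have "w' = w" using st(4)[of w'] st(4)[OF sub[OF w]] by metis
      then show ?thesis using w' ms by auto
    next
      assume ms: "dbl \<and> m = \<nu> s"
      define w' where "w' = (s *\<^sub>R axis 2 1 :: real ^ 2)"
      have w': "w' $ 2 = s" "w' $ 1 = 0" by (simp_all add: w'_def axis_def)
      have "w' \<in> square \<rho>0" using s(1) st(1) w' by (simp add: square_def)
      moreover have "\<Phi> w' = \<Phi> w" using \<nu>[OF _ sr] cm ms by (simp add: \<Phi>[of w'] w' \<alpha>0)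
      ultimately have "w' = w" using st(4)[of w'] st(4)[OF sub[OF w]] by metis
      then show ?thesis using w' ms by auto
    qed
  qed
  then show thesis using that[of \<Psi> \<rho>] \<rho>le inGD(3) by blast
qed

end

section \<open>Adapted orientations near the curve\<close>

lemma convex_half_square: "convex (square \<rho> \<inter> {w. w $ 2 > 0})" "convex (square \<rho> \<inter> {w. w $ 2 < 0})"
proof -
  have "convex {w :: real ^ 2. \<bar>w $ i\<bar> < \<rho>}" for i
  proof -
    have "{w :: real ^ 2. \<bar>w $ i\<bar> < \<rho>} = {w. inner (axis i 1) w < \<rho>} \<inter> {w. inner (axis i 1) w > - \<rho>}"
      by (auto simp: inner_axis' abs_less_iff)
    then show ?thesis by (simp add: convex_Int convex_halfspace_lt convex_halfspace_gt)
  qed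
  moreover have "square \<rho> = {w. \<bar>w $ 1\<bar> < \<rho>} \<inter> {w. \<bar>w $ 2\<bar> < \<rho>}" by (auto simp: square_def)
  ultimately have cvsq: "convex (square \<rho>)" by (simp add: convex_Int)
  have half: "{w :: real ^ 2. w $ 2 > 0} = {w. inner (axis 2 1) w > 0}"
    "{w :: real ^ 2. w $ 2 < 0} = {w. inner (axis 2 1) w < 0}" by (auto simp: inner_axis')
  show "convex (square \<rho> \<inter> {w. w $ 2 > 0})" "convex (square \<rho> \<inter> {w. w $ 2 < 0})"
    unfolding half by (intro convex_Int cvsq convex_halfspace_lt convex_halfspace_gt)+
qed

context oriented_generic_curve
begin

lemma openin_coord_ball:
  assumes "b \<in> B"
  shows "openin M {m \<in> chart_dom b. \<bar>coord b m - coord b p\<bar> < \<rho>}"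
  using openin_coord_vimage[OF base_chart[OF assms], of "ball (coord b p) \<rho>"]
  by (simp add: dist_real_def abs_minus_commute)

lemma arc_point_coord: "b \<in> B \<Longrightarrow> m \<in> chart_dom b \<Longrightarrow> arc_point b p (coord b m - coord b p) = m"
  unfolding arc_point_def by (simp add: param_coord[OF base_chart])

lemma arc_point_0: "b \<in> B \<Longrightarrow> p \<in> chart_dom b \<Longrightarrow> arc_point b p 0 = p"
  unfolding arc_point_def by (simp add: param_coord[OF base_chart])

lemma arc_point_in_neighbourhood:
  assumes b: "b \<in> B" "p \<in> chart_dom b" and N: "openin M N" "p \<in> N"
  obtains r where "r > 0" "\<And>s. \<bar>s\<bar> < r \<Longrightarrow> arc_point b p s \<in> N"
proof -
  have "open (coord b ` (N \<inter> chart_dom b))" by (rule open_coord_image[OF base_chart[OF b(1)] N(1)])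
  moreover have "coord b p \<in> coord b ` (N \<inter> chart_dom b)" using b N by blast
  ultimately obtain r where r: "r > 0" "ball (coord b p) r \<subseteq> coord b ` (N \<inter> chart_dom b)" by (meson openE)
  show thesis
  proof (rule that[OF r(1)])
    fix s :: real assume "\<bar>s\<bar> < r"
    then have "coord b p + s \<in> coord b ` (N \<inter> chart_dom b)" using r(2) by (auto simp: dist_real_def)
    then obtain m where m: "coord b p + s = coord b m" "m \<in> N" "m \<in> chart_dom b" by blast
    show "arc_point b p s \<in> N" unfolding arc_point_def m(1) using m param_coord[OF base_chart[OF b(1)]] by simp
  qed
qed

text \<open>The second axis is the straight line in the direction \<open>n\<close> of the velocity turned to the left.\<close>

lemma regular_box:
  assumes reg: "regular p" and b: "b \<in> B" "p \<in> chart_dom b" and c: "c \<in> A" "f p \<in> chart_dom c"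
    and U: "openin S U" "f p \<in> U"
  obtains n \<Phi> \<Psi> \<rho> where
    "crossing_box S A M B f dir c (f p) False (arc_point b p) (arc_point b p) (\<lambda>s. velocity b c (arc_point b p s)) (\<lambda>_. n) \<Phi> \<Psi> \<rho>"
    "\<And>w. w \<in> square \<rho> \<Longrightarrow> param c (\<Phi> w) \<in> U" "cross (velocity b c p) n > 0"
    "\<And>s. \<Phi> (s *\<^sub>R axis 2 1) = coord c (f p) + s *\<^sub>R n"
    "\<And>s. \<bar>s\<bar> < \<rho> \<Longrightarrow> arc_point b p s \<in> chart_dom b"
    "\<And>s. \<bar>s\<bar> < \<rho> \<Longrightarrow> regular (arc_point b p s) \<Longrightarrow> dir (arc_point b p s) b = dir p b"
proof -
  define n where "n = (vector [- velocity b c p $ 2, velocity b c p $ 1] :: real ^ 2)"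
  have n: "cross (velocity b c p) n > 0"
    unfolding n_def by (rule cross_rotate_pos[OF velocity(2)[OF b(1) c(1) b(2) c(2)]])
  obtain r1 where r1: "r1 > 0"
    "\<And>s. \<bar>s\<bar> < r1 \<Longrightarrow> arc_point b p s \<in> chart_dom b \<and> f (arc_point b p s) \<in> chart_dom c \<and> coord b (arc_point b p s) = coord b p + s"
    "\<And>s. \<bar>s\<bar> < r1 \<Longrightarrow> ((\<lambda>s. coord c (f (arc_point b p s))) has_vector_derivative velocity b c (arc_point b p s)) (at s)"
    "continuous_on {-r1<..<r1} (\<lambda>s. velocity b c (arc_point b p s))"
    using arc_in_chart[OF b(1) c(1) b(2) c(2)] by metis
  obtain N where N: "openin M N" "p \<in> N" "\<forall>q\<in>N. regular q \<longrightarrow> dir q b = dir p b"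
    by (rule dir_locally_constant[OF reg b])
  obtain r2 where r2: "r2 > 0" "\<And>s. \<bar>s\<bar> < r2 \<Longrightarrow> arc_point b p s \<in> N"
    using arc_point_in_neighbourhood[OF b N(1,2)] by metis
  define r where "r = min r1 r2"
  have r: "r > 0" "r \<le> r1" "r \<le> r2" using r1(1) r2(1) by (auto simp: r_def)
  define \<Phi> where "\<Phi> w = coord c (f (arc_point b p (w $ 1))) + (coord c (f p) + w $ 2 *\<^sub>R n) - coord c (f p)" for w :: "real ^ 2"
  have near: "\<exists>U1. openin S U1 \<and> f p \<in> U1 \<and>
        (\<forall>m\<in>topspace M. f m \<in> U1 \<longrightarrow> (\<exists>s. \<bar>s\<bar> < \<rho> \<and> (m = arc_point b p s \<or> False \<and> m = arc_point b p s)))" if "0 < \<rho>" for \<rho>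
  proof -
    define N where "N = {m \<in> chart_dom b. \<bar>coord b m - coord b p\<bar> < \<rho>}"
    have "openin M N" unfolding N_def by (rule openin_coord_ball[OF b(1)])
    moreover have "f p \<in> topspace S" using atlas_topspace c by blast
    moreover have "q \<in> N" if "q \<in> topspace M" "f q = f p" for q
      using that reg b(2) \<open>0 < \<rho>\<close> by (auto simp: regular_def N_def)
    ultimately obtain U1 where U1: "openin S U1" "f p \<in> U1" "\<And>q. q \<in> topspace M \<Longrightarrow> f q \<in> U1 \<Longrightarrow> q \<in> N"
      using fibre_neighbourhood by metis
    have "\<exists>s. \<bar>s\<bar> < \<rho> \<and> (m = arc_point b p s \<or> False \<and> m = arc_point b p s)" if "m \<in> topspace M" "f m \<in> U1" for m
    proof -
      have "m \<in> N" using U1(3) that by blast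
      then show ?thesis using arc_point_coord[OF b(1), of m p] by (intro exI[of _ "coord b m - coord b p"]) (auto simp: N_def)
    qed
    then show ?thesis using U1(1,2) by blast
  qed
  obtain \<Psi> \<rho> where box: "crossing_box S A M B f dir c (f p) False (arc_point b p) (arc_point b p) (\<lambda>s. velocity b c (arc_point b p s)) (\<lambda>_. n) \<Phi> \<Psi> \<rho>"
    and \<rho>: "\<rho> \<le> r" and inU: "\<And>w. w \<in> square \<rho> \<Longrightarrow> param c (\<Phi> w) \<in> U"
  proof (rule crossing_box_exists[OF c U r(1), where \<alpha> = "\<lambda>s. coord c (f (arc_point b p s))" and \<beta> = "\<lambda>s. coord c (f p) + s *\<^sub>R n"
        and \<alpha>' = "\<lambda>s. velocity b c (arc_point b p s)" and \<beta>' = "\<lambda>_. n" and dbl = False and \<mu> = "arc_point b p" and \<nu> = "arc_point b p" and \<Phi> = \<Phi>])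
    show "((\<lambda>s. coord c (f (arc_point b p s))) has_vector_derivative velocity b c (arc_point b p s)) (at s)" if "\<bar>s\<bar> < r" for s
      using r1(3) that r(2) by simp
    show "((\<lambda>s. coord c (f p) + s *\<^sub>R n) has_vector_derivative n) (at s)" for s
      by (auto intro!: derivative_eq_intros)
    show "continuous_on {-r<..<r} (\<lambda>s. velocity b c (arc_point b p s))"
      by (rule continuous_on_subset[OF r1(4)]) (use r(2) in auto)
    show "cross (velocity b c (arc_point b p 0)) n \<noteq> 0" using n by (simp add: arc_point_0 b)
    show "arc_point b p s \<in> topspace M \<and> f (arc_point b p s) \<in> chart_dom c \<and> coord c (f (arc_point b p s)) = coord c (f (arc_point b p s))"
      if "\<bar>s\<bar> < r" for s
      using r1(2)[of s] that r(2) base_topspace[OF b(1)] by auto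
  qed (use near in \<open>simp_all add: \<Phi>_def arc_point_0 b\<close>)
  show thesis
  proof (rule that[OF box inU n])
    show "\<Phi> (s *\<^sub>R axis 2 1) = coord c (f p) + s *\<^sub>R n" for s
      by (simp add: \<Phi>_def axis_def arc_point_0 b)
    fix s assume s: "\<bar>s\<bar> < \<rho>"
    then have "\<bar>s\<bar> < r1" "\<bar>s\<bar> < r2" using r \<rho> by linarith+
    then show "arc_point b p s \<in> chart_dom b" "regular (arc_point b p s) \<Longrightarrow> dir (arc_point b p s) b = dir p b"
      using r1(2) r2(2) N(3) by blast+
  qed
qed

lemma regular_charts:
  assumes "regular p"
  obtains b c where "b \<in> B" "p \<in> chart_dom b" "c \<in> A" "f p \<in> chart_dom c"
proof -
  have pM: "p \<in> topspace M" using assms by (simp add: regular_def)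
  obtain b where "b \<in> B" "p \<in> chart_dom b" using base_cover[OF pM] by blast
  moreover have "f p \<in> topspace S" using pM curve_topspace by blast
  then obtain c where "c \<in> A" "f p \<in> chart_dom c" using atlas_cover by blast
  ultimately show thesis by (rule that)
qed

text \<open>With the second axis pointing to the left of the curve, the sign of the second coordinate, times
  the direction of the curve in its parametrization, is what the rule demands.\<close>

lemma regular_patch:
  assumes reg: "regular p" and U: "openin S U" "f p \<in> U"
  obtains V \<epsilon> where "openin S V" "f p \<in> V" "V \<subseteq> U" "orients (V - curve) \<epsilon>"
    "\<And>m. m \<in> topspace M \<Longrightarrow> f m \<in> V \<Longrightarrow> regular m \<and> adapted \<epsilon> m"
proof -
  obtain b c where b: "b \<in> B" "p \<in> chart_dom b" and c: "c \<in> A" "f p \<in> chart_dom c"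
    by (rule regular_charts[OF reg])
  obtain n \<Phi> \<Psi> \<rho> where box: "crossing_box S A M B f dir c (f p) False (arc_point b p) (arc_point b p) (\<lambda>s. velocity b c (arc_point b p s)) (\<lambda>_. n) \<Phi> \<Psi> \<rho>"
    and inU: "\<And>w. w \<in> square \<rho> \<Longrightarrow> param c (\<Phi> w) \<in> U" and n: "cross (velocity b c p) n > 0"
    and pb: "\<And>s. \<bar>s\<bar> < \<rho> \<Longrightarrow> arc_point b p s \<in> chart_dom b"
    and dirp: "\<And>s. \<bar>s\<bar> < \<rho> \<Longrightarrow> regular (arc_point b p s) \<Longrightarrow> dir (arc_point b p s) b = dir p b"
    by (rule regular_box[OF reg b c U]) blast
  interpret crossing_box S A M B f dir c "f p" False "arc_point b p" "arc_point b p" "\<lambda>s. velocity b c (arc_point b p s)" "\<lambda>_. n" \<Phi> \<Psi> \<rho>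
    by (rule box)
  define k where "k = dir p b"
  define h where "h w = w $ 2" for w :: "real ^ 2"
  have k: "k \<in> {1, -1}" unfolding k_def by (rule dir_sign[OF reg b])
  have h: "continuous_on UNIV h" unfolding h_def by (intro continuous_intros)
  have hz: "h w = 0 \<longleftrightarrow> w $ 2 = 0 \<or> False \<and> w $ 1 = 0" for w by (simp add: h_def)
  show thesis
  proof (rule that[of "box_point ` square \<rho>" "box_orientation k h"])
    show "openin S (box_point ` square \<rho>)" by (rule openin_box[OF open_square]) simp
    show "f p \<in> box_point ` square \<rho>" using box_0 zero_in_square by (metis imageI)
    show "box_point ` square \<rho> \<subseteq> U" unfolding box_point_def using inU by blast
    show "orients (box_point ` square \<rho> - curve) (box_orientation k h)"
      by (rule box_orientation(1)[OF k h hz])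
    fix m assume m: "m \<in> topspace M" "f m \<in> box_point ` square \<rho>"
    then obtain w where w: "w \<in> square \<rho>" "f m = box_point w" by blast
    have hitw: "w $ 2 = 0 \<and> q = arc_point b p (w $ 1)" if "q \<in> topspace M" "f q = f m" for q
      using hit[OF w(1) that(1)] that(2) w(2) unfolding box_point_def by simp
    have regm: "regular m"
      unfolding regular_def using m(1) hitw by blast
    have w1: "\<bar>w $ 1\<bar> < \<rho>" using w(1) by (simp add: square_def)
    have mb: "m \<in> chart_dom b" using hitw[OF m(1)] pb[OF w1] by simp
    have "adapted (box_orientation k h) m"
    proof (rule box_orientation_adapted[OF k h hz regm b(1) mb w, where i = 2 and \<sigma> = 1 and \<eta> = 1 and W = UNIV])
      show "w $ 2 = 0" using hitw[OF m(1)] by simp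
      show "dir m b = k * 1 * 1"
        using dirp[OF w1] regm hitw[OF m(1)] by (simp add: k_def)
      fix u :: "real ^ 2"
      have "velocity b c m = velocity b c (arc_point b p (w $ 1))" using hitw[OF m(1)] by simp
      moreover have "sgn (cross (velocity b c (arc_point b p (w $ 1))) n) = 1"
        using cross_sgn[OF w(1)] n by (simp add: arc_point_0 b)
      ultimately show "sgn (cross (velocity b c m) (u $ 1 *\<^sub>R velocity b c (arc_point b p (w $ 1)) + u $ 2 *\<^sub>R n)) = 1 * sgn (u $ 2)"
        by (simp add: cross_add cross_scale sgn_mult)
    qed (auto simp: h_def)
    with regm show "regular m \<and> adapted (box_orientation k h) m" by blast
  qed
qed

text \<open>The two sides are the images of the two halves of a square, and a line transverse to the curve
  passes from one into the other.\<close>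

lemma regular_two_sides:
  assumes reg: "regular p" and b: "b \<in> B" "p \<in> chart_dom b" and cA: "c \<in> A" "f p \<in> chart_dom c"
    and U: "openin S U" "f p \<in> U"
  obtains V Q1 Q2 n where "openin S V" "f p \<in> V" "V \<subseteq> U" "V - curve = Q1 \<union> Q2"
    "connectedin S Q1" "connectedin S Q2" "cross (velocity b c p) n > 0"
    "\<forall>\<^sub>F t in at_right 0. param c (coord c (f p) + t *\<^sub>R n) \<in> Q1"
    "\<forall>\<^sub>F t in at_left 0. param c (coord c (f p) + t *\<^sub>R n) \<in> Q2"
proof -
  obtain n \<Phi> \<Psi> \<rho> where box: "crossing_box S A M B f dir c (f p) False (arc_point b p) (arc_point b p) (\<lambda>s. velocity b c (arc_point b p s)) (\<lambda>_. n) \<Phi> \<Psi> \<rho>"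
    and inU: "\<And>w. w \<in> square \<rho> \<Longrightarrow> param c (\<Phi> w) \<in> U" and n: "cross (velocity b c p) n > 0"
    and \<Phi>2: "\<And>s. \<Phi> (s *\<^sub>R axis 2 1) = coord c (f p) + s *\<^sub>R n"
    by (rule regular_box[OF reg b cA U]) blast
  interpret crossing_box S A M B f dir c "f p" False "arc_point b p" "arc_point b p" "\<lambda>s. velocity b c (arc_point b p s)" "\<lambda>_. n" \<Phi> \<Psi> \<rho>
    by (rule box)
  define Qp where "Qp = square \<rho> \<inter> {w. w $ 2 > 0}"
  define Qm where "Qm = square \<rho> \<inter> {w. w $ 2 < 0}"
  have cv: "convex Qp" "convex Qm"
    unfolding Qp_def Qm_def by (rule convex_half_square)+
  have line: "param c (coord c (f p) + t *\<^sub>R n) = box_point (t *\<^sub>R axis 2 1)" for t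
    by (simp add: box_point_def \<Phi>2)
  have half: "t *\<^sub>R axis 2 1 \<in> Qp \<longleftrightarrow> 0 < t \<and> t < \<rho>" "t *\<^sub>R axis 2 1 \<in> Qm \<longleftrightarrow> - \<rho> < t \<and> t < 0" for t
    using \<rho> by (auto simp: Qp_def Qm_def square_def axis_def)
  show thesis
  proof (rule that[of "box_point ` square \<rho>" "box_point ` Qp" "box_point ` Qm" n])
    show "openin S (box_point ` square \<rho>)" by (rule openin_box[OF open_square]) simp
    show "f p \<in> box_point ` square \<rho>" using box_0 zero_in_square by (metis imageI)
    show "box_point ` square \<rho> \<subseteq> U" unfolding box_point_def using inU by blast
    show "connectedin S (box_point ` Qp)"
      by (rule connectedin_box[OF convex_connected[OF cv(1)]]) (simp add: Qp_def)
    show "connectedin S (box_point ` Qm)"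
      by (rule connectedin_box[OF convex_connected[OF cv(2)]]) (simp add: Qm_def)
    have "\<forall>\<^sub>F t in at_right 0. t *\<^sub>R axis 2 1 \<in> Qp"
      unfolding half eventually_at_right_field using \<rho> by blast
    then show "\<forall>\<^sub>F t in at_right 0. param c (coord c (f p) + t *\<^sub>R n) \<in> box_point ` Qp"
      unfolding line by (rule eventually_mono) blast
    have "\<forall>\<^sub>F t in at_left 0. t *\<^sub>R axis 2 1 \<in> Qm"
      unfolding half eventually_at_left_field using \<rho> by (intro exI[of _ "- \<rho>"]) auto
    then show "\<forall>\<^sub>F t in at_left 0. param c (coord c (f p) + t *\<^sub>R n) \<in> box_point ` Qm"
      unfolding line by (rule eventually_mono) blast
    show "box_point ` square \<rho> - curve = box_point ` Qp \<union> box_point ` Qm"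
    proof (intro equalityI subsetI)
      fix x assume "x \<in> box_point ` square \<rho> - curve"
      then obtain w where w: "w \<in> square \<rho>" "x = box_point w" "box_point w \<notin> curve" by blast
      then have "w $ 2 \<noteq> 0" using box_curve[OF w(1)] by simp
      then have "w \<in> Qp \<or> w \<in> Qm" using w(1) by (auto simp: Qp_def Qm_def)
      then show "x \<in> box_point ` Qp \<union> box_point ` Qm" using w(2) by blast
    next
      fix x assume "x \<in> box_point ` Qp \<union> box_point ` Qm"
      then obtain w where w: "w \<in> square \<rho>" "x = box_point w" "w $ 2 \<noteq> 0" by (auto simp: Qp_def Qm_def)
      then have "box_point w \<notin> curve" using box_curve[OF w(1)] by simp
      then have "box_point w \<in> box_point ` square \<rho> - curve" using w(1) by blast
      then show "x \<in> box_point ` square \<rho> - curve" unfolding w(2) .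
    qed
  qed (rule n)
qed

text \<open>On each of the two connected sides the orientations can only differ by a constant sign, and a
  transverse path, along which both are prescribed, reaches both sides.\<close>

lemma adapted_agree:
  assumes reg: "regular p" and U: "openin S U" "f p \<in> U"
    and or: "orients (U - curve) \<epsilon>1" "orients (U - curve) \<epsilon>2" and ad: "adapted \<epsilon>1 p" "adapted \<epsilon>2 p"
  shows "\<exists>V. openin S V \<and> f p \<in> V \<and> V \<subseteq> U \<and> (\<forall>x\<in>V - curve. \<epsilon>1 x = \<epsilon>2 x)"
proof -
  obtain b c where b: "b \<in> B" "p \<in> chart_dom b" and c: "c \<in> A" "f p \<in> chart_dom c"
    by (rule regular_charts[OF reg])
  obtain V Q1 Q2 n where V: "openin S V" "f p \<in> V" "V \<subseteq> U" "V - curve = Q1 \<union> Q2"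
    and Q: "connectedin S Q1" "connectedin S Q2" and n: "cross (velocity b c p) n > 0"
    and hits: "\<forall>\<^sub>F t in at_right 0. param c (coord c (f p) + t *\<^sub>R n) \<in> Q1"
      "\<forall>\<^sub>F t in at_left 0. param c (coord c (f p) + t *\<^sub>R n) \<in> Q2"
    by (rule regular_two_sides[OF reg b c U])
  define \<delta> where "\<delta> s = coord c (f p) + s *\<^sub>R n" for s :: real
  have d: "\<delta> 0 = coord c (f p)" "(\<delta> has_vector_derivative n) (at 0)" "cross (velocity b c p) n \<noteq> 0"
    using n unfolding \<delta>_def by (auto intro!: derivative_eq_intros)
  have "\<forall>\<^sub>F t in at 0. \<delta> t \<in> chart_image c \<and> crossing_sign \<epsilon> p b c n t (param c (\<delta> t))" if "adapted \<epsilon> p" for \<epsilon>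
    using that[unfolded adapted_def, rule_format, OF b(1) c(1) b(2) c(2), unfolded adapted_in_def, rule_format, OF d] .
  from this[OF ad(1)] this[OF ad(2)] have "\<forall>\<^sub>F t in at 0. \<epsilon>1 (param c (\<delta> t)) = \<epsilon>2 (param c (\<delta> t))"
  proof (rule eventually_elim2)
    fix t assume 1: "\<delta> t \<in> chart_image c \<and> crossing_sign \<epsilon>1 p b c n t (param c (\<delta> t))"
      and 2: "\<delta> t \<in> chart_image c \<and> crossing_sign \<epsilon>2 p b c n t (param c (\<delta> t))"
    have "local_sign \<epsilon>1 (param c (\<delta> t)) c = local_sign \<epsilon>2 (param c (\<delta> t)) c"
      using 1 2 unfolding crossing_sign_def by (elim conjE) (rule trans[OF _ sym])
    then show "\<epsilon>1 (param c (\<delta> t)) = \<epsilon>2 (param c (\<delta> t))"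
      by (rule local_sign_eqD[OF c(1) param_in[OF conjunct1[OF 1]]])
  qed
  then have eq: "\<forall>\<^sub>F t in at_right 0. \<epsilon>1 (param c (\<delta> t)) = \<epsilon>2 (param c (\<delta> t))"
    "\<forall>\<^sub>F t in at_left 0. \<epsilon>1 (param c (\<delta> t)) = \<epsilon>2 (param c (\<delta> t))"
    unfolding eventually_at_split by blast+
  have agree: "\<epsilon>1 x = \<epsilon>2 x" if Q: "connectedin S Q" "Q \<subseteq> V - curve" "x \<in> Q"
    and ev: "\<forall>\<^sub>F t in F. param c (\<delta> t) \<in> Q" "\<forall>\<^sub>F t in F. \<epsilon>1 (param c (\<delta> t)) = \<epsilon>2 (param c (\<delta> t))" "F \<noteq> bot" for Q x F
  proof -
    obtain t where t: "param c (\<delta> t) \<in> Q" "\<epsilon>1 (param c (\<delta> t)) = \<epsilon>2 (param c (\<delta> t))"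
      using eventually_happens'[OF ev(3) eventually_conj[OF ev(1,2)]] by blast
    have sub: "Q \<subseteq> U - curve" using Q(2) V(3) by blast
    show ?thesis
      by (rule orients_connected_agree[OF orients_mono[OF or(1) sub] orients_mono[OF or(2) sub] Q(1) t(1) Q(3) t(2)])
  qed
  have "\<epsilon>1 x = \<epsilon>2 x" if "x \<in> V - curve" for x
  proof (cases "x \<in> Q1")
    case True
    then show ?thesis using agree[OF Q(1) _ _ _ eq(1)] hits(1) V(4) by (simp add: \<delta>_def)
  next
    case False
    then have "x \<in> Q2" using that V(4) by blast
    then show ?thesis using agree[OF Q(2) _ _ _ eq(2)] hits(2) V(4) by (simp add: \<delta>_def)
  qed
  then show ?thesis using V(1-3) by blast
qed

text \<open>The heart of the matter. Let the first axis be the branch through the attractive point \<open>p\<close>, the second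
  the branch through the repulsive point \<open>q\<close>, and suppose that the coordinates \<open>w\<close> preserve
  orientation (\<open>D = 1\<close>). The first axis is directed towards the origin, so its left side is below on
  the positive half and above on the negative half. The second axis is directed away from the
  origin, so its left side is to the left on the upper half and to the right on the lower half. All
  four half axes thus demand the same: positive in the second and fourth quadrants, negative in the
  others. This is the sign of \<open>- w $ 1 * w $ 2\<close>. Had both points been attractive, the demands would
  contradict each other.\<close>

lemma double_patch:
  assumes pq: "p \<in> topspace M" "q \<in> topspace M" "p \<noteq> q" "f p = f q"
    and att: "attractive M B dir p" and rep: "repulsive M B dir q"
  obtains V \<epsilon> where "openin S V" "f p \<in> V" "orients (V - curve) \<epsilon>"
    "\<And>m. m \<in> topspace M \<Longrightarrow> f m \<in> V \<Longrightarrow> f m = f p \<or> regular m \<and> adapted \<epsilon> m"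
proof -
  obtain b where b: "b \<in> B" "p \<in> chart_dom b" using base_cover[OF pq(1)] by blast
  obtain b' where b': "b' \<in> B" "q \<in> chart_dom b'" using base_cover[OF pq(2)] by blast
  have yS: "f p \<in> topspace S" using pq curve_topspace by blast
  then obtain c where c: "c \<in> A" "f p \<in> chart_dom c" using atlas_cover by blast
  have c': "f q \<in> chart_dom c" using c pq(4) by simp
  have preim: "m = p \<or> m = q" if m: "m \<in> topspace M" "f m = f p" for m
  proof (rule ccontr)
    assume "\<not> (m = p \<or> m = q)"
    then have "card {m, p, q} = 3" using pq(3) by simp
    moreover have sub: "{m, p, q} \<subseteq> {x \<in> topspace M. f x = f p}" using m pq by auto
    have fin: "finite {x \<in> topspace M. f x = f p}" and le: "card {x \<in> topspace M. f x = f p} \<le> 2"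
      using generic unfolding generic_immersion_def by blast+
    ultimately show False using card_mono[OF fin sub] le by linarith
  qed
  have cr: "cross (velocity b c p) (velocity b' c q) \<noteq> 0"
    unfolding velocity_def
  proof (rule cross_nonzero_if_spanning)
    have "transverse_at B B A f f p q" using generic pq unfolding generic_immersion_def by blast
    then show "{u + v |u v. u \<in> range (deriv_in_charts b c f p) \<and> v \<in> range (deriv_in_charts b' c f q)} = UNIV"
      unfolding transverse_at_def using b b' c c' by blast
    show "linear (deriv_in_charts b c f p)" "linear (deriv_in_charts b' c f q)"
      using smooth_map_has_derivative[OF smooth_curve b(1) c(1) b(2) c(2)]
        smooth_map_has_derivative[OF smooth_curve b'(1) c(1) b'(2) c'] has_derivative_linear by blast+
    show "deriv_in_charts b' c f q 1 \<noteq> 0"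
      using velocity(2)[OF b'(1) c(1) b'(2) c'] by (simp add: velocity_def)
  qed
  obtain r1 where r1: "r1 > 0"
    "\<And>s. \<bar>s\<bar> < r1 \<Longrightarrow> arc_point b p s \<in> chart_dom b \<and> f (arc_point b p s) \<in> chart_dom c \<and> coord b (arc_point b p s) = coord b p + s"
    "\<And>s. \<bar>s\<bar> < r1 \<Longrightarrow> ((\<lambda>s. coord c (f (arc_point b p s))) has_vector_derivative velocity b c (arc_point b p s)) (at s)"
    "continuous_on {-r1<..<r1} (\<lambda>s. velocity b c (arc_point b p s))"
    using arc_in_chart[OF b(1) c(1) b(2) c(2)] by metis
  obtain r2 where r2: "r2 > 0"
    "\<And>s. \<bar>s\<bar> < r2 \<Longrightarrow> arc_point b' q s \<in> chart_dom b' \<and> f (arc_point b' q s) \<in> chart_dom c \<and> coord b' (arc_point b' q s) = coord b' q + s"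
    "\<And>s. \<bar>s\<bar> < r2 \<Longrightarrow> ((\<lambda>s. coord c (f (arc_point b' q s))) has_vector_derivative velocity b' c (arc_point b' q s)) (at s)"
    "continuous_on {-r2<..<r2} (\<lambda>s. velocity b' c (arc_point b' q s))"
    using arc_in_chart[OF b'(1) c(1) b'(2) c'] by metis
  have "\<forall>\<^sub>F m in atin M p. dir m b = sgn (coord b p - coord b m)"
    using att b unfolding attractive_def by blast
  then obtain N where N: "openin M N" "p \<in> N" "\<And>m. m \<in> N - {p} \<Longrightarrow> dir m b = sgn (coord b p - coord b m)"
    using pq(1) unfolding eventually_atin by blast
  have "\<forall>\<^sub>F m in atin M q. dir m b' = sgn (coord b' m - coord b' q)"
    using rep b' unfolding repulsive_def by blast
  then obtain N' where N': "openin M N'" "q \<in> N'" "\<And>m. m \<in> N' - {q} \<Longrightarrow> dir m b' = sgn (coord b' m - coord b' q)"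
    using pq(2) unfolding eventually_atin by blast
  obtain r3 where r3: "r3 > 0" "\<And>s. \<bar>s\<bar> < r3 \<Longrightarrow> arc_point b p s \<in> N" using arc_point_in_neighbourhood[OF b N(1,2)] by metis
  obtain r4 where r4: "r4 > 0" "\<And>s. \<bar>s\<bar> < r4 \<Longrightarrow> arc_point b' q s \<in> N'" using arc_point_in_neighbourhood[OF b' N'(1,2)] by metis
  define r where "r = min (min r1 r2) (min r3 r4)"
  have r: "r > 0" "r \<le> r1" "r \<le> r2" "r \<le> r3" "r \<le> r4" using r1(1) r2(1) r3(1) r4(1) by (auto simp: r_def)
  \<comment> \<open>By compactness of the base, points of the curve close to \<open>f p\<close> come from points close
    to \<open>p\<close> or \<open>q\<close>.\<close>
  have near: "\<exists>U1. openin S U1 \<and> f p \<in> U1 \<and>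
        (\<forall>m\<in>topspace M. f m \<in> U1 \<longrightarrow> (\<exists>s. \<bar>s\<bar> < \<rho> \<and> (m = arc_point b p s \<or> True \<and> m = arc_point b' q s)))" if "0 < \<rho>" for \<rho>
  proof -
    define N1 where "N1 = {m \<in> chart_dom b. \<bar>coord b m - coord b p\<bar> < \<rho>}"
    define N2 where "N2 = {m \<in> chart_dom b'. \<bar>coord b' m - coord b' q\<bar> < \<rho>}"
    have o: "openin M (N1 \<union> N2)" unfolding N1_def N2_def by (intro openin_Un openin_coord_ball b(1) b'(1))
    have "p \<in> N1" "q \<in> N2" using b b' \<open>0 < \<rho>\<close> by (auto simp: N1_def N2_def)
    then have "m \<in> N1 \<union> N2" if "m \<in> topspace M" "f m = f p" for m using preim[OF that] by blast
    then obtain U1 where U1: "openin S U1" "f p \<in> U1" "\<And>q. q \<in> topspace M \<Longrightarrow> f q \<in> U1 \<Longrightarrow> q \<in> N1 \<union> N2"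
      using fibre_neighbourhood[OF o yS] by metis
    have "\<exists>s. \<bar>s\<bar> < \<rho> \<and> (m = arc_point b p s \<or> True \<and> m = arc_point b' q s)" if "m \<in> topspace M" "f m \<in> U1" for m
    proof -
      have "m \<in> N1 \<or> m \<in> N2" using U1(3) that by blast
      then show ?thesis
      proof
        assume "m \<in> N1"
        then show ?thesis using arc_point_coord[OF b(1), of m p]
          by (intro exI[of _ "coord b m - coord b p"]) (auto simp: N1_def)
      next
        assume "m \<in> N2"
        then show ?thesis using arc_point_coord[OF b'(1), of m q]
          by (intro exI[of _ "coord b' m - coord b' q"]) (auto simp: N2_def)
      qed
    qed
    then show ?thesis using U1(1,2) by blast
  qed
  define \<Phi> where "\<Phi> w = coord c (f (arc_point b p (w $ 1))) + coord c (f (arc_point b' q (w $ 2))) - coord c (f p)" for w :: "real ^ 2"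
  obtain \<Psi> \<rho> where box: "crossing_box S A M B f dir c (f p) True (arc_point b p) (arc_point b' q) (\<lambda>s. velocity b c (arc_point b p s)) (\<lambda>s. velocity b' c (arc_point b' q s)) \<Phi> \<Psi> \<rho>"
    and \<rho>r: "\<rho> \<le> r"
  proof (rule crossing_box_exists[OF c openin_topspace yS r(1), where \<alpha> = "\<lambda>s. coord c (f (arc_point b p s))"
        and \<beta> = "\<lambda>s. coord c (f (arc_point b' q s))"
        and \<alpha>' = "\<lambda>s. velocity b c (arc_point b p s)" and \<beta>' = "\<lambda>s. velocity b' c (arc_point b' q s)" and dbl = True and \<mu> = "arc_point b p" and \<nu> = "arc_point b' q" and \<Phi> = \<Phi>])
    show "((\<lambda>s. coord c (f (arc_point b p s))) has_vector_derivative velocity b c (arc_point b p s)) (at s)" if "\<bar>s\<bar> < r" for s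
      using r1(3) that r(2) by simp
    show "((\<lambda>s. coord c (f (arc_point b' q s))) has_vector_derivative velocity b' c (arc_point b' q s)) (at s)" if "\<bar>s\<bar> < r" for s
      using r2(3) that r(3) by simp
    show "continuous_on {-r<..<r} (\<lambda>s. velocity b c (arc_point b p s))"
      by (rule continuous_on_subset[OF r1(4)]) (use r(2) in auto)
    show "continuous_on {-r<..<r} (\<lambda>s. velocity b' c (arc_point b' q s))"
      by (rule continuous_on_subset[OF r2(4)]) (use r(3) in auto)
    show "cross (velocity b c (arc_point b p 0)) (velocity b' c (arc_point b' q 0)) \<noteq> 0" using cr by (simp add: arc_point_0 b b')
    show "arc_point b p s \<in> topspace M \<and> f (arc_point b p s) \<in> chart_dom c \<and> coord c (f (arc_point b p s)) = coord c (f (arc_point b p s))"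
      if "\<bar>s\<bar> < r" for s
      using r1(2)[of s] that r(2) base_topspace[OF b(1)] by auto
    show "arc_point b' q s \<in> topspace M \<and> f (arc_point b' q s) \<in> chart_dom c \<and> coord c (f (arc_point b' q s)) = coord c (f (arc_point b' q s))"
      if "\<bar>s\<bar> < r" for s
      using r2(2)[of s] that r(3) base_topspace[OF b'(1)] by auto
  qed (use near pq(4) in \<open>simp_all add: \<Phi>_def arc_point_0 b b'\<close>)
  interpret crossing_box S A M B f dir c "f p" True "arc_point b p" "arc_point b' q" "\<lambda>s. velocity b c (arc_point b p s)" "\<lambda>s. velocity b' c (arc_point b' q s)" \<Phi> \<Psi> \<rho>
    by (rule box)
  define D where "D = sgn (cross (velocity b c p) (velocity b' c q))"
  have D: "D \<in> {1, -1}" using cr by (auto simp: D_def sgn_if)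
  define k where "k = - D"
  define h where "h w = w $ 1 * w $ 2" for w :: "real ^ 2"
  have k: "k \<in> {1, -1}" using D by (auto simp: k_def)
  have h: "continuous_on UNIV h" unfolding h_def by (intro continuous_intros)
  have hz: "h w = 0 \<longleftrightarrow> w $ 2 = 0 \<or> True \<and> w $ 1 = 0" for w by (auto simp: h_def)
  have Dw: "sgn (cross (velocity b c (arc_point b p (w $ 1))) (velocity b' c (arc_point b' q (w $ 2)))) = D" if "w \<in> square \<rho>" for w
    using cross_sgn[OF that] by (simp add: D_def arc_point_0 b b')
  show thesis
  proof (rule that[of "box_point ` square \<rho>" "box_orientation k h"])
    show "openin S (box_point ` square \<rho>)" by (rule openin_box[OF open_square]) simp
    show "f p \<in> box_point ` square \<rho>" using box_0 zero_in_square by (metis imageI)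
    show "orients (box_point ` square \<rho> - curve) (box_orientation k h)"
      by (rule box_orientation(1)[OF k h hz])
    fix m assume m: "m \<in> topspace M" "f m \<in> box_point ` square \<rho>"
    then obtain w where w: "w \<in> square \<rho>" "f m = box_point w" by blast
    have hitw: "w $ 2 = 0 \<and> m' = arc_point b p (w $ 1) \<or> w $ 1 = 0 \<and> m' = arc_point b' q (w $ 2)"
      if "m' \<in> topspace M" "f m' = f m" for m'
      using hit[OF w(1) that(1)] that(2) w(2) unfolding box_point_def by simp
    have wr: "\<bar>w $ 1\<bar> < r" "\<bar>w $ 2\<bar> < r" using w(1) \<rho>r by (auto simp: square_def)
    show "f m = f p \<or> regular m \<and> adapted (box_orientation k h) m"
    proof (cases "w = 0")
      case True
      then show ?thesis using w(2) box_0 by simp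
    next
      case False
      then have nz: "\<not> (w $ 1 = 0 \<and> w $ 2 = 0)" by (simp add: vec_eq_iff forall_2)
      have regm: "regular m"
        unfolding regular_def using m(1) hitw nz by metis
      from hitw[OF m(1) refl] have "adapted (box_orientation k h) m"
      proof
        assume w2: "w $ 2 = 0 \<and> m = arc_point b p (w $ 1)"
        then have w1: "w $ 1 \<noteq> 0" using nz by blast
        have mb: "m \<in> chart_dom b" "coord b m = coord b p + w $ 1" "m \<in> N"
          using w2 r1(2)[of "w $ 1"] r3(2)[of "w $ 1"] wr r by auto
        show ?thesis
        proof (rule box_orientation_adapted[OF k h hz regm b(1) mb(1) w, where i = 2 and \<sigma> = "sgn (w $ 1)" and \<eta> = D
              and W = "{w'. inner (w $ 1 *\<^sub>R axis 1 1) w' > 0}"])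
          show "w $ 2 = 0" using w2 by simp
          show "open {w'. inner (w $ 1 *\<^sub>R axis 1 1) w' > 0}" by (rule open_halfspace_gt)
          show "w \<in> {w'. inner (w $ 1 *\<^sub>R axis 1 1) w' > 0}"
          proof -
            have "w $ 1 * w $ 1 > 0" using w1 not_real_square_gt_zero by blast
            then show ?thesis by (simp add: inner_axis')
          qed
          show "sgn (h w') = sgn (w' $ 2) * sgn (w $ 1)" if "w' \<in> {w'. inner (w $ 1 *\<^sub>R axis 1 1) w' > 0}" for w'
          proof -
            have "w $ 1 * w' $ 1 > 0" using that by (simp add: inner_axis')
            then have "sgn (w' $ 1) = sgn (w $ 1)" by (auto simp: zero_less_mult_iff)
            then show ?thesis by (simp add: h_def sgn_mult)
          qed
          show "sgn (w $ 1) \<in> {1, -1}" using w1 by (auto simp: sgn_if)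
          show "D \<in> {1, -1}" by (rule D)
          have "m \<noteq> p" using mb(2) w1 by auto
          then have "dir m b = sgn (- (w $ 1))" using N(3)[of m] mb(2,3) by simp
          then show "dir m b = k * sgn (w $ 1) * D" using D by (auto simp: k_def sgn_minus)
          fix u :: "real ^ 2"
          show "sgn (cross (velocity b c m) (u $ 1 *\<^sub>R velocity b c (arc_point b p (w $ 1)) + u $ 2 *\<^sub>R velocity b' c (arc_point b' q (w $ 2)))) = D * sgn (u $ 2)"
            using Dw[OF w(1)] w2 by (simp add: cross_add cross_scale sgn_mult)
        qed
      next
        assume w1: "w $ 1 = 0 \<and> m = arc_point b' q (w $ 2)"
        then have w2: "w $ 2 \<noteq> 0" using nz by blast
        have mb: "m \<in> chart_dom b'" "coord b' m = coord b' q + w $ 2" "m \<in> N'"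
          using w1 r2(2)[of "w $ 2"] r4(2)[of "w $ 2"] wr r by auto
        show ?thesis
        proof (rule box_orientation_adapted[OF k h hz regm b'(1) mb(1) w, where i = 1 and \<sigma> = "sgn (w $ 2)" and \<eta> = "- D"
              and W = "{w'. inner (w $ 2 *\<^sub>R axis 2 1) w' > 0}"])
          show "w $ 1 = 0" using w1 by simp
          show "open {w'. inner (w $ 2 *\<^sub>R axis 2 1) w' > 0}" by (rule open_halfspace_gt)
          show "w \<in> {w'. inner (w $ 2 *\<^sub>R axis 2 1) w' > 0}"
          proof -
            have "w $ 2 * w $ 2 > 0" using w2 not_real_square_gt_zero by blast
            then show ?thesis by (simp add: inner_axis')
          qed
          show "sgn (h w') = sgn (w' $ 1) * sgn (w $ 2)" if "w' \<in> {w'. inner (w $ 2 *\<^sub>R axis 2 1) w' > 0}" for w'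
          proof -
            have "w $ 2 * w' $ 2 > 0" using that by (simp add: inner_axis')
            then have "sgn (w' $ 2) = sgn (w $ 2)" by (auto simp: zero_less_mult_iff)
            then show ?thesis by (simp add: h_def sgn_mult)
          qed
          show "sgn (w $ 2) \<in> {1, -1}" using w2 by (auto simp: sgn_if)
          show "- D \<in> {1, -1}" using D by auto
          have "m \<noteq> q" using mb(2) w2 by auto
          then have "dir m b' = sgn (w $ 2)" using N'(3)[of m] mb(2,3) by simp
          then show "dir m b' = k * sgn (w $ 2) * - D" using D by (auto simp: k_def)
          fix u :: "real ^ 2"
          have "sgn (cross (velocity b' c (arc_point b' q (w $ 2))) (velocity b c (arc_point b p (w $ 1)))) = - D"
            unfolding Dw[OF w(1), symmetric] by (subst cross_swap) (simp add: sgn_minus)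
          then show "sgn (cross (velocity b' c m) (u $ 1 *\<^sub>R velocity b c (arc_point b p (w $ 1)) + u $ 2 *\<^sub>R velocity b' c (arc_point b' q (w $ 2)))) = - D * sgn (u $ 1)"
            using w1 by (simp add: cross_add cross_scale sgn_mult)
        qed
      qed
      with regm show ?thesis by blast
    qed
  qed
qed

text \<open>Points of the patch other than \<open>y\<close> are regular, since the double points are isolated.\<close>

lemma curve_patch:
  assumes "y \<in> curve"
  shows "\<exists>V \<epsilon>. openin S V \<and> y \<in> V \<and> orients (V - curve) \<epsilon> \<and>
    (\<forall>m\<in>topspace M. f m \<in> V \<longrightarrow> f m = y \<or> regular m) \<and> (\<forall>m. regular m \<longrightarrow> f m \<in> V \<longrightarrow> adapted \<epsilon> m)"
proof -
  from assms obtain p where p: "p \<in> topspace M" "y = f p" by blast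
  show ?thesis
  proof (cases "regular p")
    case True
    have "y \<in> topspace S" using assms curve_topspace by blast
    then obtain V \<epsilon> where "openin S V" "f p \<in> V" "V \<subseteq> topspace S" "orients (V - curve) \<epsilon>"
      "\<And>m. m \<in> topspace M \<Longrightarrow> f m \<in> V \<Longrightarrow> regular m \<and> adapted \<epsilon> m"
      using regular_patch[OF True openin_topspace] unfolding p(2) by metis
    then show ?thesis unfolding p(2) regular_def by blast
  next
    case False
    then obtain q where q: "q \<in> topspace M" "q \<noteq> p" "f q = f p" using p(1) by (auto simp: regular_def)
    then have "{p, q} \<in> chords M f" using p(1) unfolding chords_def by (metis (mono_tags, lifting) mem_Collect_eq)
    then obtain p' q' where pq': "{p, q} = {p', q'}" "attractive M B dir p'" "repulsive M B dir q'"
      using orientation unfolding chord_diagram_orientation_def by blast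
    then have *: "p' \<in> topspace M" "q' \<in> topspace M" "p' \<noteq> q'" "f p' = f q'" "f p' = y"
      using p q by (auto simp: doubleton_eq_iff)
    obtain V \<epsilon> where V: "openin S V" "f p' \<in> V" "orients (V - curve) \<epsilon>"
      "\<And>m. m \<in> topspace M \<Longrightarrow> f m \<in> V \<Longrightarrow> f m = f p' \<or> regular m \<and> adapted \<epsilon> m"
      using double_patch[OF *(1-4) pq'(2,3)] by metis
    have "adapted \<epsilon> m" if "regular m" "f m \<in> V" for m
    proof -
      have "m \<in> topspace M" using that(1) by (simp add: regular_def)
      moreover have "f m \<noteq> f p'" using that(1) *(1-4) unfolding regular_def by metis
      ultimately show ?thesis using V(4) that(2) by blast
    qed
    then show ?thesis using V *(5) by blast
  qed
qed

end

section \<open>Extending germs along a compact set\<close>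

text \<open>Sections of a sheaf over a compact set \<open>C\<close> extend to a neighbourhood: compatible local data \<open>g y\<close> on \<open>V y\<close>
  need only agree near the points of \<open>C\<close>, not on all of \<open>V y \<inter> V z\<close>. Choose finitely many closed
  \<open>K y \<subseteq> V y\<close> whose interiors cover \<open>C\<close>, and let \<open>G\<close> be \<open>g y\<close> for some \<open>y\<close> with \<open>x \<in> K y\<close>. Close
  to \<open>z\<close> only those \<open>K y\<close> occur that contain \<open>z\<close>, and they are finitely many, so that all \<open>g y\<close> in
  question agree with \<open>g z\<close> there.\<close>

lemma germs_extend:
  assumes reg: "regular_space X" and C: "compactin X C"
    and V: "\<And>y. y \<in> C \<Longrightarrow> openin X (V y) \<and> y \<in> V y"
    and compat: "\<And>y z. y \<in> C \<Longrightarrow> z \<in> C \<Longrightarrow> z \<in> V y \<Longrightarrow>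
        \<exists>U. openin X U \<and> z \<in> U \<and> (\<forall>x\<in>U - C. g y x = g z x)"
  obtains G where "\<forall>z\<in>C. \<exists>U. openin X U \<and> z \<in> U \<and> U \<subseteq> V z \<and> (\<forall>x\<in>U - C. G x = g z x)"
proof -
  have "\<exists>P K. openin X P \<and> closedin X K \<and> y \<in> P \<and> P \<subseteq> K \<and> K \<subseteq> V y" if "y \<in> C" for y
    using reg V[OF that] unfolding neighbourhood_base_of_closedin[symmetric] neighbourhood_base_of by blast
  then obtain P K where PK: "\<And>y. y \<in> C \<Longrightarrow> openin X (P y) \<and> closedin X (K y) \<and> y \<in> P y \<and> P y \<subseteq> K y \<and> K y \<subseteq> V y"
    by metis
  obtain T where T: "finite T" "T \<subseteq> C" "C \<subseteq> (\<Union>y\<in>T. P y)"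
  proof -
    have "\<exists>\<F>. finite \<F> \<and> \<F> \<subseteq> P ` C \<and> C \<subseteq> \<Union>\<F>"
    proof (rule compactinD[OF C])
      show "openin X B" if "B \<in> P ` C" for B using that PK by blast
      show "C \<subseteq> \<Union>(P ` C)" using PK by blast
    qed
    then show thesis using that by (metis finite_subset_image)
  qed
  obtain W where W: "\<And>y z. y \<in> C \<Longrightarrow> z \<in> C \<Longrightarrow> z \<in> V y \<Longrightarrow>
      openin X (W y z) \<and> z \<in> W y z \<and> (\<forall>x\<in>W y z - C. g y x = g z x)"
    using compat by metis
  define G where "G x = g (SOME y. y \<in> T \<and> x \<in> K y) x" for x
  show thesis
  proof (rule that[of G], rule ballI)
    fix z assume z: "z \<in> C"
    then obtain y0 where y0: "y0 \<in> T" "z \<in> P y0" using T(3) by blast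
    \<comment> \<open>A neighbourhood of \<open>z\<close> on which \<open>g y\<close> agrees with \<open>g z\<close> or else which misses \<open>K y\<close>.\<close>
    define N where "N y = (if z \<in> K y then W y z else topspace X - K y)" for y
    define U where "U = V z \<inter> P y0 \<inter> \<Inter>(insert (topspace X) (N ` T))"
    have N: "openin X (N y) \<and> z \<in> N y" if "y \<in> T" for y
    proof -
      have y: "y \<in> C" using T(2) that by blast
      have "z \<in> topspace X" using z C compactin_subset_topspace by blast
      then show ?thesis
        using PK[OF y] W[OF y z] unfolding N_def by (auto split: if_splits)
    qed
    have "openin X (\<Inter>(insert (topspace X) (N ` T)))"
      using N T(1) by (intro openin_Inter) auto
    then have "openin X U" unfolding U_def using V[OF z] PK T(2) y0(1) by (intro openin_Int) blast+
    moreover have "z \<in> U"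
      unfolding U_def using N V[OF z] y0 z C compactin_subset_topspace by blast
    moreover have "U \<subseteq> V z" unfolding U_def by blast
    moreover have "G x = g z x" if x: "x \<in> U - C" for x
    proof -
      have "x \<in> K y0" using x y0(1) PK T(2) unfolding U_def by blast
      then have ex: "\<exists>y. y \<in> T \<and> x \<in> K y" using y0(1) by blast
      define y where "y = (SOME y. y \<in> T \<and> x \<in> K y)"
      have y: "y \<in> T" "x \<in> K y" unfolding y_def using someI_ex[OF ex] by blast+
      have xN: "x \<in> N y" using x y(1) unfolding U_def by blast
      have zK: "z \<in> K y" using xN y(2) unfolding N_def by (auto split: if_splits)
      then have "x \<in> W y z" using xN unfolding N_def by simp
      moreover have "y \<in> C" "z \<in> V y" using y(1) T(2) PK zK by blast+
      ultimately have "g y x = g z x" using W[of y z] z x by blast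
      then show ?thesis unfolding G_def y_def .
    qed
    ultimately show "\<exists>U. openin X U \<and> z \<in> U \<and> U \<subseteq> V z \<and> (\<forall>x\<in>U - C. G x = g z x)" by blast
  qed
qed

lemma compact_neighbourhood:
  assumes lc: "locally_compact_space X" and H: "Hausdorff_space X"
    and C: "compactin X C" and N: "openin X N" "C \<subseteq> N"
  obtains P K where "openin X P" "compactin X K" "C \<subseteq> P" "P \<subseteq> K" "K \<subseteq> N"
proof -
  have "locally_compact_space (subtopology X N)"
    using locally_compact_space_open_subset[OF disjI1[OF H] lc N(1)] .
  moreover have "Hausdorff_space (subtopology X N)" by (rule Hausdorff_space_subtopology[OF H])
  moreover have "compactin (subtopology X N) C" using C N(2) by (simp add: compactin_subtopology)
  ultimately obtain P K where PK: "openin (subtopology X N) P" "compactin (subtopology X N) K" "C \<subseteq> P" "P \<subseteq> K"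
    using locally_compact_space_compact_closed_compact[of "subtopology X N"] by metis
  show thesis
  proof (rule that)
    show "openin X P" by (rule openin_trans_full[OF PK(1) N(1)])
    show "compactin X K" "K \<subseteq> N" using PK(2) by (simp_all add: compactin_subtopology)
  qed (fact PK)+
qed

context surface_atlas
begin

lemma locally_compact: "locally_compact_space S"
  unfolding locally_compact_space_def
proof
  fix x assume "x \<in> topspace S"
  then obtain c where c: "c \<in> A" "x \<in> chart_dom c" using atlas_cover by blast
  note ch = atlas_chart[OF c(1)]
  obtain r where r: "r > 0" "cball (coord c x) r \<subseteq> chart_image c"
    using chart_open_image[OF ch] c(2) open_contains_cball by (metis imageI)
  have sub: "ball (coord c x) r \<subseteq> chart_image c" using r(2) ball_subset_cball by blast
  have "x \<in> param c ` ball (coord c x) r"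
    using param_coord[OF ch c(2)] r(1) by (metis centre_in_ball imageI)
  then show "\<exists>U K. openin S U \<and> compactin S K \<and> x \<in> U \<and> U \<subseteq> K"
    using openin_param_image[OF ch open_ball sub] compactin_param_image[OF ch compact_cball r(2)]
      image_mono[OF ball_subset_cball] by metis
qed

lemma regular_surface: "regular_space S"
  using locally_compact Hausdorff by (rule locally_compact_Hausdorff_imp_regular_space)

lemma component_open:
  assumes U: "openin S U" and F: "F \<in> connected_components_of (subtopology S U)"
  shows "openin S F"
proof (subst openin_subopen, intro ballI)
  fix x assume x: "x \<in> F"
  have FU: "F \<subseteq> U" using connected_components_of_subset[OF F] by simp
  then have xU: "x \<in> U" using x by blast
  then have "x \<in> topspace S" using U openin_subset by blast
  then obtain c where c: "c \<in> A" "x \<in> chart_dom c" using atlas_cover by blast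
  note ch = atlas_chart[OF c(1)]
  have "open (coord c ` (U \<inter> chart_dom c))" by (rule open_coord_image[OF ch U])
  then obtain r where r: "r > 0" "ball (coord c x) r \<subseteq> coord c ` (U \<inter> chart_dom c)"
    using xU c(2) by (meson IntI imageI openE)
  define Q where "Q = param c ` ball (coord c x) r"
  have sub: "ball (coord c x) r \<subseteq> chart_image c" using r(2) by blast
  have QU: "Q \<subseteq> U"
  proof
    fix z assume "z \<in> Q"
    then obtain w where w: "z = param c w" "w \<in> ball (coord c x) r" by (auto simp: Q_def)
    then obtain z' where z': "w = coord c z'" "z' \<in> U" "z' \<in> chart_dom c" using r(2) by blast
    then show "z \<in> U" unfolding w(1) z'(1) using param_coord[OF ch z'(3)] by simp
  qed
  have "connectedin S Q" unfolding Q_def by (rule connectedin_param_image[OF ch _ sub]) simp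
  then have con: "connectedin (subtopology S U) Q" using QU by (simp add: connectedin_subtopology)
  have xQ: "x \<in> Q" unfolding Q_def using param_coord[OF ch c(2)] r(1) by (metis centre_in_ball imageI)
  have "Q \<subseteq> F" by (rule connected_components_of_maximal[OF F con]) (use x xQ in \<open>auto simp: disjnt_iff\<close>)
  moreover have "openin S Q" unfolding Q_def by (rule openin_param_image[OF ch open_ball sub])
  ultimately show "\<exists>T. openin S T \<and> x \<in> T \<and> T \<subseteq> F" using xQ by blast
qed

end

lemma compact_subset_smaller_ball:
  assumes "compact K" "K \<subseteq> ball 0 1"
  obtains r where "0 \<le> r" "r < 1" "K \<subseteq> cball (0 :: 'e :: real_normed_vector) r"
proof (cases "K = {}")
  case True
  then show thesis by (intro that[of 0]) auto
next
  case False
  obtain x where x: "x \<in> K" "\<And>y. y \<in> K \<Longrightarrow> norm y \<le> norm x"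
    using continuous_attains_sup[OF assms(1) False, of norm] continuous_on_norm_id by blast
  show thesis using x assms(2) by (intro that[of "norm x"]) auto
qed

section \<open>Orienting the complement of the curve\<close>

context oriented_generic_curve
begin

text \<open>The patches are compatible at the points of the curve: at a regular point both orientations are
  adapted, which determines them, and a double point belongs to no patch but its own.\<close>

lemma orientation_near_curve:
  obtains N G where "openin S N" "curve \<subseteq> N" "orients (N - curve) G" "\<And>p. regular p \<Longrightarrow> adapted G p"
proof -
  define R where "R y V \<epsilon> \<longleftrightarrow> openin S V \<and> y \<in> V \<and> orients (V - curve) \<epsilon> \<and>
    (\<forall>m\<in>topspace M. f m \<in> V \<longrightarrow> f m = y \<or> regular m) \<and> (\<forall>m. regular m \<longrightarrow> f m \<in> V \<longrightarrow> adapted \<epsilon> m)" for y V \<epsilon>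
  have "\<forall>y\<in>curve. \<exists>V \<epsilon>. R y V \<epsilon>" unfolding R_def using curve_patch by blast
  then obtain V e where R: "\<And>y. y \<in> curve \<Longrightarrow> R y (V y) (e y)" by metis
  have V: "openin S (V y) \<and> y \<in> V y" and or: "orients (V y - curve) (e y)" if "y \<in> curve" for y
    using R[OF that] unfolding R_def by blast+
  have reg: "f m = y \<or> regular m" if "y \<in> curve" "m \<in> topspace M" "f m \<in> V y" for y m
    using R[OF that(1)] that(2,3) unfolding R_def by blast
  have ad: "adapted (e y) m" if "y \<in> curve" "regular m" "f m \<in> V y" for y m
    using R[OF that(1)] that(2,3) unfolding R_def by blast
  have compat: "\<exists>U. openin S U \<and> z \<in> U \<and> (\<forall>x\<in>U - curve. e y x = e z x)"
    if y: "y \<in> curve" and z: "z \<in> curve" "z \<in> V y" for y z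
  proof (cases "z = y")
    case True
    then show ?thesis using V[OF y] by blast
  next
    case False
    from z(1) obtain m where m: "m \<in> topspace M" "z = f m" by blast
    have "f m \<in> V y" using z(2) m(2) by simp
    with reg[OF y m(1)] have rm: "regular m" using False m(2) by blast
    have 1: "adapted (e y) m" using ad[OF y rm] z(2) m(2) by simp
    have 2: "adapted (e z) m" using ad[OF z(1) rm] V[OF z(1)] m(2) by simp
    have o: "openin S (V y \<inter> V z)" using V[OF y] V[OF z(1)] by blast
    have mV: "f m \<in> V y \<inter> V z" using z V[OF z(1)] m(2) by simp
    have s: "V y \<inter> V z - curve \<subseteq> V y - curve" "V y \<inter> V z - curve \<subseteq> V z - curve" by blast+
    show ?thesis
      using adapted_agree[OF rm o mV orients_mono[OF or[OF y] s(1)] orients_mono[OF or[OF z(1)] s(2)] 1 2]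
      unfolding m(2) by blast
  qed
  obtain G where "\<forall>z\<in>curve. \<exists>U. openin S U \<and> z \<in> U \<and> U \<subseteq> V z \<and> (\<forall>x\<in>U - curve. G x = e z x)"
    by (rule germs_extend[OF regular_surface compact_curve V compat])
  then obtain U where U: "\<And>z. z \<in> curve \<Longrightarrow> openin S (U z) \<and> z \<in> U z \<and> U z \<subseteq> V z \<and> (\<forall>x\<in>U z - curve. G x = e z x)"
    by metis
  define N where "N = (\<Union>z\<in>curve. U z)"
  show thesis
  proof (rule that[of N G])
    show "openin S N" unfolding N_def using U by blast
    show "curve \<subseteq> N" unfolding N_def using U by blast
    show "orients (N - curve) G"
    proof (rule orients_locally)
      fix x assume "x \<in> N - curve"
      then obtain z where z: "z \<in> curve" "x \<in> U z" unfolding N_def by blast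
      have "orients (U z \<inter> (N - curve)) (e z)"
        by (rule orients_mono[OF or[OF z(1)]]) (use U[OF z(1)] in blast)
      then show "\<exists>V \<epsilon>'. openin S V \<and> x \<in> V \<and> orients (V \<inter> (N - curve)) \<epsilon>' \<and> (\<forall>y\<in>V \<inter> (N - curve). G y = \<epsilon>' y)"
        using U[OF z(1)] z(2) by blast
    qed
    show "adapted G p" if rp: "regular p" for p
    proof -
      have z: "f p \<in> curve" using rp by (auto simp: regular_def)
      have "adapted (e (f p)) p" using ad[OF z rp] V[OF z] by blast
      then show ?thesis
        by (rule adapted_cong[of _ _ "U (f p)"]) (use U[OF z] in auto)
    qed
  qed
qed

text \<open>An open disk has one end. The part \<open>L\<close> of the face where the neighbourhood \<open>K\<close> of the curve is
  left is compact, so it is contained in a smaller closed disk \<open>E\<close>. The remaining annulus is connected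
  and avoids \<open>L\<close>, so it lies entirely in \<open>K\<close> or entirely outside \<open>P\<close>. In the first case the
  orientation of the face and \<open>G\<close> agree on the annulus up to a constant sign. In the second case the
  face stays away from the curve. Since \<open>E\<close> is compact and disjoint from the curve, it has no
  influence on germs at the curve.\<close>

lemma face_orientation:
  assumes F: "F \<in> connected_components_of (subtopology S (topspace S - curve))"
    and disk: "subtopology S F homeomorphic_space top_of_set (ball (0 :: real ^ 2) 1)"
    and N: "openin S N" "curve \<subseteq> N" and G: "orients (N - curve) G"
  shows "\<exists>P K \<epsilon>. openin S P \<and> curve \<subseteq> P \<and> compactin S K \<and> K \<subseteq> F \<and> orients F \<epsilon> \<and> (\<forall>x\<in>F \<inter> P - K. \<epsilon> x = G x)"
proof -
  have oC: "openin S (topspace S - curve)" using closed_curve by blast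
  have oF: "openin S F" by (rule component_open[OF oC F])
  have FC: "F \<subseteq> topspace S - curve" using connected_components_of_subset[OF F] by auto
  obtain h g where hg: "homeomorphic_maps (subtopology S F) (top_of_set (ball (0 :: real ^ 2) 1)) h g"
    using disk unfolding homeomorphic_space_def by blast
  have tF: "topspace (subtopology S F) = F" using FC by auto
  have ch: "continuous_map (subtopology S F) (top_of_set (ball 0 1)) h"
    and cg: "continuous_map (top_of_set (ball 0 1)) (subtopology S F) g"
    and gh: "\<And>x. x \<in> F \<Longrightarrow> g (h x) = x" and hg': "\<And>w. w \<in> ball 0 1 \<Longrightarrow> h (g w) = w"
    using hg tF unfolding homeomorphic_maps_def by auto
  have hF: "h x \<in> ball 0 1" if "x \<in> F" for x
    using continuous_map_image_subset_topspace[OF ch] that tF by auto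
  have gF: "g w \<in> F" if "w \<in> ball 0 1" for w
    using continuous_map_image_subset_topspace[OF cg] that tF by auto
  have cgS: "continuous_map (top_of_set (ball 0 1)) S g"
    using cg continuous_map_in_subtopology by blast
  have gim: "g ` ball 0 1 = F" using gF gh hF by (metis image_eqI image_subsetI subsetI subset_antisym)
  have op: "open_map (top_of_set (ball 0 1)) S g"
  proof -
    have "homeomorphic_map (top_of_set (ball 0 1)) (subtopology S F) g"
      using hg homeomorphic_maps_map by blast
    then have "open_map (top_of_set (ball 0 1)) (subtopology S F) g" by (rule homeomorphic_imp_open_map)
    then show ?thesis unfolding open_map_def using openin_trans_full[OF _ oF] by blast
  qed
  have "\<exists>\<epsilon>. orients (g ` ball 0 1) \<epsilon>"
    by (rule orients_convex_image[OF open_ball convex_ball cgS op]) (metis hg' inj_onI)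
  then obtain \<epsilon> where \<epsilon>: "orients F \<epsilon>" unfolding gim by blast
  obtain P K where PK: "openin S P" "compactin S K" "curve \<subseteq> P" "P \<subseteq> K" "K \<subseteq> N"
    by (rule compact_neighbourhood[OF locally_compact Hausdorff compact_curve N])
  have clK: "closedin S K" using compactin_imp_closedin[OF Hausdorff PK(2)] .
  define L where "L = (K - P) \<inter> F"
  have "compactin S L"
  proof -
    obtain T where T: "closedin S T" "F = T \<inter> (topspace S - curve)"
      using closedin_connected_components_of[OF F] by (auto simp: closedin_subtopology)
    have "L = (K - P) \<inter> T" unfolding L_def T(2) using PK(3) closedin_subset[OF clK] by blast
    moreover have "closedin S ((K - P) \<inter> T)" using clK PK(1) T(1) by (intro closedin_Int closedin_diff)
    ultimately show ?thesis using closed_compactin[OF PK(2), of L] by blast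
  qed
  then have "compactin (subtopology S F) L" by (simp add: compactin_subtopology L_def)
  then have "compactin (top_of_set (ball 0 1)) (h ` L)" by (rule image_compactin[OF _ ch])
  then have hL: "compact (h ` L)" "h ` L \<subseteq> ball 0 1" by (auto simp: compactin_subtopology)
  obtain r where r: "0 \<le> r" "r < 1" "h ` L \<subseteq> cball 0 r" by (rule compact_subset_smaller_ball[OF hL])
  define R where "R = {w :: real ^ 2. r < norm w \<and> norm w < 1}"
  define E where "E = g ` cball 0 r"
  have cr: "cball 0 r \<subseteq> ball (0 :: real ^ 2) 1" using r(2) by auto
  have "connected R" unfolding R_def using connected_annulus(1)[of r "0 :: real ^ 2" 1] by simp
  moreover have Rsub: "R \<subseteq> ball 0 1" by (auto simp: R_def)
  ultimately have conR: "connectedin S (g ` R)"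
    using connectedin_continuous_map_image[OF cgS, of R] by (simp add: connectedin_subtopology)
  have E: "compactin S E"
    unfolding E_def using image_compactin[OF _ cgS, of "cball 0 r"] cr by (simp add: compactin_subtopology)
  have EF: "E \<subseteq> F" unfolding E_def using cr gF by blast
  have FE: "x \<in> g ` R" if "x \<in> F - E" for x
  proof -
    have "h x \<in> ball 0 1" "g (h x) = x" using that hF gh by blast+
    moreover have "h x \<notin> cball 0 r" using that gh unfolding E_def by (metis DiffD1 DiffD2 imageI)
    ultimately show ?thesis by (intro image_eqI[of _ _ "h x"]) (auto simp: R_def)
  qed
  have Rcov: "g ` R \<subseteq> P \<union> (topspace S - K)"
  proof
    fix x assume "x \<in> g ` R"
    then obtain w where w: "w \<in> R" "x = g w" by blast
    have "w \<in> ball 0 1" using w(1) Rsub by blast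
    then have xF: "x \<in> F" and "h x = w" using gF hg' w(2) by blast+
    then have "h x \<notin> cball 0 r" using w(1) by (auto simp: R_def)
    then have "x \<notin> L" using r(3) by blast
    then show "x \<in> P \<union> (topspace S - K)" using xF FC unfolding L_def by blast
  qed
  have oK: "openin S (topspace S - K)" using clK by blast
  have "P \<inter> (topspace S - K) \<inter> g ` R = {}" using PK(4) by blast
  then have "P \<inter> g ` R = {} \<or> (topspace S - K) \<inter> g ` R = {}"
    using connectedinD[OF conR PK(1) oK Rcov] by blast
  then show ?thesis
  proof
    assume e: "P \<inter> g ` R = {}"
    have "\<forall>x\<in>F \<inter> P - E. \<epsilon> x = G x" using FE e by blast
    then show ?thesis using PK(1,3) E EF \<epsilon> by blast
  next
    assume e: "(topspace S - K) \<inter> g ` R = {}"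
    have gRF: "g ` R \<subseteq> F" using gF Rsub by blast
    have "g ` R \<subseteq> K" using e gRF FC by blast
    then have sub: "g ` R \<subseteq> N - curve" using PK(5) gRF FC by blast
    have "(r + (1 - r) / 2) *\<^sub>R axis 1 1 \<in> R"
      using r(1,2) by (simp add: R_def norm_axis_1 field_simps)
    then obtain x0 where x0: "x0 \<in> g ` R" by blast
    have G': "orients (g ` R) G" by (rule orients_mono[OF G sub])
    have \<epsilon>': "orients (g ` R) \<epsilon>" by (rule orients_mono[OF \<epsilon> gRF])
    define k where "k = \<epsilon> x0 * G x0"
    have s: "\<epsilon> x0 \<in> {1, -1}" "G x0 \<in> {1, -1}"
      using orients_sign[OF \<epsilon>' x0] orients_sign[OF G' x0] by blast+
    then have k: "k \<in> {1, -1}" by (auto simp: k_def)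
    have "k * \<epsilon> x = G x" if "x \<in> F \<inter> P - E" for x
    proof -
      have x: "x \<in> g ` R" using FE that by blast
      have "\<epsilon> x * G x = k" unfolding k_def by (rule orients_connected_ratio[OF \<epsilon>' G' conR x0 x])
      then show ?thesis using orients_sign[OF \<epsilon>' x] orients_sign[OF G' x] by auto
    qed
    then show ?thesis using orients_scale[OF \<epsilon> k] PK(1,3) E EF by blast
  qed
qed

text \<open>At a regular point only the two faces that contain the two sides of the curve matter, and near that
  point they carry the orientation \<open>G\<close>, which is adapted.\<close>

lemma complement_orientation:
  assumes disks: "\<And>F. F \<in> connected_components_of (subtopology S (topspace S - curve)) \<Longrightarrow>
           subtopology S F homeomorphic_space top_of_set (ball (0 :: real ^ 2) 1)"
  obtains \<epsilon> where "orients (topspace S - curve) \<epsilon>" "\<And>p. regular p \<Longrightarrow> adapted \<epsilon> p"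
proof -
  define X where "X = subtopology S (topspace S - curve)"
  define I where "I = connected_components_of X"
  have oC: "openin S (topspace S - curve)" using closed_curve by blast
  have tX: "topspace X = topspace S - curve" by (auto simp: X_def)
  obtain N G where N: "openin S N" "curve \<subseteq> N" "orients (N - curve) G" "\<And>p. regular p \<Longrightarrow> adapted G p"
    using orientation_near_curve by metis
  obtain P K e where e: "\<And>F. F \<in> I \<Longrightarrow> openin S (P F) \<and> curve \<subseteq> P F \<and> compactin S (K F) \<and> K F \<subseteq> F \<and>
      orients F (e F) \<and> (\<forall>x\<in>F \<inter> P F - K F. e F x = G x)"
    using face_orientation[OF _ disks N(1-3)] unfolding I_def X_def by metis
  have oF: "openin S F" if "F \<in> I" for F
    using component_open[OF oC] that unfolding I_def X_def by blast
  have orF: "orients F (e F)" if "F \<in> I" for F using e[OF that] by blast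
  have disj: "e F x = e F' x" if "F \<in> I" "F' \<in> I" "x \<in> F" "x \<in> F'" for F F' x
    using pairwise_disjoint_connected_components_of[of X] that
    unfolding I_def pairwise_def disjnt_iff by metis
  have "\<exists>\<epsilon>. orients (\<Union>F\<in>I. F) \<epsilon> \<and> (\<forall>F\<in>I. \<forall>x\<in>F. \<epsilon> x = e F x)"
  proof (rule orients_UNION[of I "\<lambda>F. F" e])
    fix \<epsilon> assume 1: "orients (\<Union>F\<in>I. F) \<epsilon>" and 2: "\<And>F x. F \<in> I \<Longrightarrow> x \<in> F \<Longrightarrow> \<epsilon> x = e F x"
    show ?thesis using 1 2 by blast
  qed (fact oF orF disj)+
  then obtain \<epsilon> where \<epsilon>: "orients (\<Union>F\<in>I. F) \<epsilon>" "\<And>F x. F \<in> I \<Longrightarrow> x \<in> F \<Longrightarrow> \<epsilon> x = e F x" by blast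
  have UI: "(\<Union>F\<in>I. F) = topspace S - curve"
    using Union_connected_components_of[of X] tX by (simp add: I_def)
  show thesis
  proof (rule that[of \<epsilon>])
    show "orients (topspace S - curve) \<epsilon>" using \<epsilon>(1) UI by simp
    fix p assume rp: "regular p"
    have pN: "f p \<in> N" "f p \<in> topspace S" "f p \<in> curve" using rp N(2) curve_topspace by (auto simp: regular_def)
    obtain b c where bc: "b \<in> B" "p \<in> chart_dom b" "c \<in> A" "f p \<in> chart_dom c"
      by (rule regular_charts[OF rp])
    obtain V Q1 Q2 where V: "openin S V" "f p \<in> V" "V \<subseteq> N" "V - curve = Q1 \<union> Q2" "connectedin S Q1" "connectedin S Q2"
      by (rule regular_two_sides[OF rp bc N(1) pN(1)]) blast
    have side: "\<exists>W. openin S W \<and> f p \<in> W \<and> (\<forall>x\<in>W \<inter> Q. \<epsilon> x = G x)"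
      if Q: "connectedin S Q" "Q \<subseteq> topspace S - curve" for Q
    proof (cases "Q = {}")
      case True
      then show ?thesis using pN(2) by blast
    next
      case False
      then obtain x where x: "x \<in> Q" by blast
      then obtain F where F: "F \<in> I" "x \<in> F" using Q(2) UI by blast
      have "connectedin X Q" using Q by (simp add: X_def connectedin_subtopology)
      then have QF: "Q \<subseteq> F"
        using connected_components_of_maximal[of F X Q] F x by (auto simp: I_def disjnt_iff)
      have "closedin S (K F)" using e[OF F(1)] compactin_imp_closedin[OF Hausdorff] by blast
      then have "openin S (P F - K F)" using e[OF F(1)] by blast
      moreover have "F \<inter> curve = {}" using UI F(1) by blast
      then have "f p \<in> P F - K F" using e[OF F(1)] pN(3) by blast
      moreover have "\<epsilon> z = G z" if "z \<in> (P F - K F) \<inter> Q" for z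
        using e[OF F(1)] \<epsilon>(2)[OF F(1)] QF that by (metis Diff_iff Int_iff subsetD)
      ultimately show ?thesis by blast
    qed
    have Vt: "V \<subseteq> topspace S" using V(1) openin_subset by blast
    obtain W1 where W1: "openin S W1" "f p \<in> W1" "\<forall>x\<in>W1 \<inter> Q1. \<epsilon> x = G x"
      using side[OF V(5)] V(4) Vt by blast
    obtain W2 where W2: "openin S W2" "f p \<in> W2" "\<forall>x\<in>W2 \<inter> Q2. \<epsilon> x = G x"
      using side[OF V(6)] V(4) Vt by blast
    show "adapted \<epsilon> p"
    proof (rule adapted_cong[OF N(4)[OF rp], of "V \<inter> W1 \<inter> W2"])
      show "openin S (V \<inter> W1 \<inter> W2)" using V(1) W1(1) W2(1) by blast
      show "f p \<in> V \<inter> W1 \<inter> W2" using V(2) W1(2) W2(2) by blast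
      fix x assume "x \<in> V \<inter> W1 \<inter> W2" "x \<notin> curve"
      then have "x \<in> W1 \<inter> Q1 \<or> x \<in> W2 \<inter> Q2" using V(4) by blast
      then show "G x = \<epsilon> x" using W1(3) W2(3) by metis
    qed
  qed
qed

end

section \<open>Counting the crossings of a loop\<close>

text \<open>Translates between the additive notation for \<open>w\<^sub>1\<close> and signs.\<close>

lemma prod_signs_bit:
  fixes x :: "nat \<Rightarrow> bit"
  shows "(\<Prod>i<n. if x i = 0 then 1 else - 1 :: real) = (if (\<Sum>i<n. x i) = 0 then 1 else - 1)"
proof (induction n)
  case (Suc n)
  then show ?case by (cases "x n"; cases "\<Sum>i<n. x i") simp_all
qed simp

lemma power_minus_one_bit: "(- 1 :: real) ^ m = (if (of_nat m :: bit) = 0 then 1 else - 1)"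
  using prod_signs_bit[of "\<lambda>_. 1" m] by simp

lemma real_locally_constant:
  fixes q :: "real \<Rightarrow> 'c"
  assumes "a \<le> b" and loc: "\<And>x. a \<le> x \<Longrightarrow> x \<le> b \<Longrightarrow> \<exists>d>0. \<forall>y\<in>{a..b}. \<bar>y - x\<bar> < d \<longrightarrow> q y = q x"
  shows "q b = q a"
proof (rule connectedin_locally_constant[of euclidean "{a..b}" q])
  show "connectedin euclidean {a..b}" by simp
  fix x assume "x \<in> {a..b}"
  then obtain d where "d > 0" "\<forall>y\<in>{a..b}. \<bar>y - x\<bar> < d \<longrightarrow> q y = q x" using loc[of x] by auto
  then show "\<exists>V. openin euclidean V \<and> x \<in> V \<and> (\<forall>y\<in>V \<inter> {a..b}. q y = q x)"
    by (intro exI[of _ "ball x d"]) (auto simp: dist_real_def abs_minus_commute)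
qed (use assms in auto)

context surface_atlas
begin

lemma chart_chain_exists:
  assumes "continuous_map euclideanreal S \<gamma>"
  shows "\<exists>n t c. chart_chain A \<gamma> n t c"
proof -
  define G where "G = (\<lambda>c. {t. \<gamma> t \<in> chart_dom c}) ` A"
  have cov: "{0..1} \<subseteq> \<Union>G"
  proof
    fix t :: real
    have "\<gamma> t \<in> topspace S" using assms by (auto simp: continuous_map_def)
    then show "t \<in> \<Union>G" using atlas_cover unfolding G_def by blast
  qed
  have "open U" if "U \<in> G" for U
  proof -
    from that obtain c where c: "c \<in> A" "U = {t \<in> topspace euclideanreal. \<gamma> t \<in> chart_dom c}" by (auto simp: G_def)
    have "openin euclideanreal {t \<in> topspace euclideanreal. \<gamma> t \<in> chart_dom c}"
      by (rule openin_continuous_map_preimage[OF assms chart_openin[OF atlas_chart[OF c(1)]]])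
    then show ?thesis unfolding c(2) by (rule open_openin[THEN iffD2])
  qed
  then have "\<exists>e>0. \<forall>x\<in>{0..1}. \<exists>U\<in>G. ball x e \<subseteq> U"
    using Heine_Borel_lemma[OF compact_Icc cov] by metis
  then obtain e where e: "e > 0" "\<And>x. x \<in> {0..1} \<Longrightarrow> \<exists>U\<in>G. ball x e \<subseteq> U" by blast
  obtain n :: nat where n: "1 < real n * e" using reals_Archimedean3[OF e(1)] by blast
  then have n0: "n > 0" by (auto intro: gr0I)
  define t where "t i = real i / real n" for i :: nat
  have "\<exists>c\<in>A. \<gamma> ` {t i..t (Suc i)} \<subseteq> chart_dom c" if "i < n" for i
  proof -
    have "t i \<in> {0..1}" using that by (simp add: t_def)
    from e(2)[OF this] obtain c where c: "c \<in> A" "ball (t i) e \<subseteq> {t. \<gamma> t \<in> chart_dom c}" by (auto simp: G_def)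
    have "t (Suc i) = t i + 1 / real n" by (simp add: t_def add_divide_distrib)
    moreover have "1 / real n < e" using n n0 by (simp add: divide_simps mult.commute)
    ultimately have "{t i..t (Suc i)} \<subseteq> ball (t i) e" by (auto simp: dist_real_def)
    then show ?thesis using c by blast
  qed
  then obtain c where "\<And>i. i < n \<Longrightarrow> c i \<in> A \<and> \<gamma> ` {t i..t (Suc i)} \<subseteq> chart_dom (c i)" by metis
  then have "chart_chain A \<gamma> n t c"
    unfolding chart_chain_def using n0 by (auto simp: t_def divide_strict_right_mono)
  then show ?thesis by blast
qed

end

text \<open>A loop in general position together with an orientation of the complement as constructed above.\<close>

locale loop_across_curve = oriented_generic_curve S A M B f dir
  for S :: "'a topology" and A :: "('a, real ^ 2) chart set"
    and M :: "'b topology" and B :: "('b, real) chart set" and f dir +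
  fixes \<epsilon> :: "'a \<Rightarrow> real" and \<gamma> :: "real \<Rightarrow> 'a"
  assumes or: "orients (topspace S - f ` topspace M) \<epsilon>" and ad: "\<And>p. regular p \<Longrightarrow> adapted \<epsilon> p"
    and loop: "smooth_loop S A \<gamma>" and gp: "general_position M B A f \<gamma>"
begin

lemma loop_smooth: "smooth_map euclideanreal line_atlas S A \<gamma>"
  and loop_periodic: "\<gamma> (t + 1) = \<gamma> t"
  using loop by (auto simp: smooth_loop_def)

lemma loop_continuous: "continuous_map euclideanreal S \<gamma>"
  using loop_smooth by (simp add: smooth_map_def)

lemma loop_topspace: "\<gamma> t \<in> topspace S"
  using loop_continuous by (auto simp: continuous_map_def)

lemma loop_neighbourhood:
  assumes "openin S U" "\<gamma> t0 \<in> U"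
  obtains d where "d > 0" "\<And>t. \<bar>t - t0\<bar> < d \<Longrightarrow> \<gamma> t \<in> U"
proof -
  have "openin euclideanreal {t \<in> topspace euclideanreal. \<gamma> t \<in> U}"
    by (rule openin_continuous_map_preimage[OF loop_continuous assms(1)])
  then have "open {t \<in> topspace euclideanreal. \<gamma> t \<in> U}" by (rule open_openin[THEN iffD2])
  then have "open {t. \<gamma> t \<in> U}" by simp
  then obtain d where "d > 0" "ball t0 d \<subseteq> {t. \<gamma> t \<in> U}" using assms(2) by (metis mem_Collect_eq openE)
  then show thesis by (intro that[of d]) (auto simp: dist_real_def abs_minus_commute subset_iff)
qed

lemma loop_at_crossing:
  assumes c: "c \<in> A" "\<gamma> t0 \<in> chart_dom c" and x: "\<gamma> t0 \<in> curve"
  shows "\<exists>d>0. \<exists>s\<in>{1, -1}. \<forall>t. 0 < \<bar>t - t0\<bar> \<and> \<bar>t - t0\<bar> < d \<longrightarrow>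
    \<gamma> t \<in> chart_dom c \<and> \<gamma> t \<notin> curve \<and> local_sign \<epsilon> (\<gamma> t) c = s * sgn (t - t0)"
proof -
  from x obtain p where p: "p \<in> topspace M" "\<gamma> t0 = f p" by blast
  have reg: "regular p" and trans: "transverse_at line_atlas B A \<gamma> f t0 p"
    using gp p unfolding general_position_def regular_def by blast+
  obtain b where b: "b \<in> B" "p \<in> chart_dom b" using base_cover[OF p(1)] by blast
  have cp: "f p \<in> chart_dom c" using c(2) p(2) by simp
  define l where "l = (UNIV :: real set, id :: real \<Rightarrow> real)"
  have l: "l \<in> line_atlas" "t \<in> chart_dom l" for t by (simp_all add: l_def)
  define L where "L = deriv_in_charts l c \<gamma> t0"
  define v where "v = L 1"
  have dL: "(in_charts l c \<gamma> has_derivative L) (at (coord l t0))"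
    unfolding L_def by (rule smooth_map_has_derivative[OF loop_smooth l(1) c(1) l(2) c(2)])
  then have lin: "linear L" by (rule has_derivative_linear)
  have Lv: "L h = h *\<^sub>R v" for h using linear_scale[OF lin, of h 1] by (simp add: v_def)
  have lc: "in_charts l c \<gamma> = (\<lambda>t. coord c (\<gamma> t))" "coord l t0 = t0"
    by (simp_all add: in_charts_def l_def fun_eq_iff inv_id[unfolded id_def] id_def)
  have dv: "((\<lambda>t. coord c (\<gamma> t)) has_vector_derivative v) (at t0)"
    using dL Lv unfolding lc has_vector_derivative_def by (simp add: Lv[abs_def])
  have "cross v (velocity b c p) \<noteq> 0"
    unfolding velocity_def v_def
  proof (rule cross_nonzero_if_spanning[OF lin])
    show "{u + w |u w. u \<in> range L \<and> w \<in> range (deriv_in_charts b c f p)} = UNIV"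
      using trans l b c cp unfolding transverse_at_def L_def by blast
    show "linear (deriv_in_charts b c f p)"
      using smooth_map_has_derivative[OF smooth_curve b(1) c(1) b(2) cp] by (rule has_derivative_linear)
    show "deriv_in_charts b c f p 1 \<noteq> 0"
      using velocity(2)[OF b(1) c(1) b(2) cp] by (simp add: velocity_def)
  qed
  then have cr: "cross (velocity b c p) v \<noteq> 0" by (simp add: cross_swap[of v])
  define \<delta> where "\<delta> t = coord c (\<gamma> (t0 + t))" for t
  have \<delta>0: "\<delta> 0 = coord c (f p)" by (simp add: \<delta>_def p(2))
  have "(((\<lambda>t. coord c (\<gamma> t)) \<circ> (\<lambda>t. t0 + t)) has_vector_derivative 1 *\<^sub>R v) (at 0)"
    by (rule vector_diff_chain_at) (auto intro!: derivative_eq_intros simp: dv)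
  then have d\<delta>: "(\<delta> has_vector_derivative v) (at 0)" by (simp add: \<delta>_def[abs_def] o_def)
  define s where "s = sgn (cross (velocity b c p) v) * dir p b"
  have s: "s \<in> {1, -1}" using dir_sign[OF reg b] cr by (auto simp: s_def sgn_if)
  have "\<forall>\<^sub>F t in at 0. \<delta> t \<in> chart_image c \<and> crossing_sign \<epsilon> p b c v t (param c (\<delta> t))"
    using ad[OF reg, unfolded adapted_def, rule_format, OF b(1) c(1) b(2) cp, unfolded adapted_in_def, rule_format,
        OF \<delta>0 d\<delta> cr] .
  then obtain d1 where d1: "d1 > 0" "\<And>t. t \<noteq> 0 \<Longrightarrow> \<bar>t\<bar> < d1 \<Longrightarrow> crossing_sign \<epsilon> p b c v t (param c (\<delta> t))"
    unfolding eventually_at by (auto simp: dist_real_def)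
  obtain d2 where d2: "d2 > 0" "\<And>t. \<bar>t - t0\<bar> < d2 \<Longrightarrow> \<gamma> t \<in> chart_dom c"
    using loop_neighbourhood[OF chart_openin[OF atlas_chart[OF c(1)]] c(2)] by metis
  have "\<gamma> t \<in> chart_dom c \<and> \<gamma> t \<notin> curve \<and> local_sign \<epsilon> (\<gamma> t) c = s * sgn (t - t0)"
    if t: "0 < \<bar>t - t0\<bar>" "\<bar>t - t0\<bar> < min d1 d2" for t
  proof -
    have td: "\<gamma> t \<in> chart_dom c" using d2(2) t(2) by simp
    have "param c (\<delta> (t - t0)) = \<gamma> t" using param_coord[OF atlas_chart[OF c(1)] td] by (simp add: \<delta>_def)
    then show ?thesis using d1(2)[of "t - t0"] t td by (simp add: s_def crossing_sign_def mult_ac)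
  qed
  moreover have "min d1 d2 > 0" using d1(1) d2(1) by simp
  ultimately show ?thesis using s by blast
qed

text \<open>Around any time, the sign along the loop is constant except for a change at that time if there is a
  crossing.\<close>

lemma loop_local:
  assumes c: "c \<in> A" "\<gamma> t0 \<in> chart_dom c"
  obtains d s where "d > 0" "s \<in> {1, -1}"
    "\<And>t. t \<noteq> t0 \<Longrightarrow> \<bar>t - t0\<bar> < d \<Longrightarrow> \<gamma> t \<in> chart_dom c \<and> \<gamma> t \<notin> curve \<and>
      local_sign \<epsilon> (\<gamma> t) c = (if t < t0 \<and> \<gamma> t0 \<in> curve then - s else s)"
proof (cases "\<gamma> t0 \<in> curve")
  case True
  from loop_at_crossing[OF c True] obtain d s where d: "d > 0" "s \<in> {1, -1}"
    "\<forall>t. 0 < \<bar>t - t0\<bar> \<and> \<bar>t - t0\<bar> < d \<longrightarrow> \<gamma> t \<in> chart_dom c \<and> \<gamma> t \<notin> curve \<and> local_sign \<epsilon> (\<gamma> t) c = s * sgn (t - t0)"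
    by blast
  show thesis
  proof (rule that[OF d(1,2)])
    fix t assume t: "t \<noteq> t0" "\<bar>t - t0\<bar> < d"
    then have "\<gamma> t \<in> chart_dom c \<and> \<gamma> t \<notin> curve \<and> local_sign \<epsilon> (\<gamma> t) c = s * sgn (t - t0)" using d(3) by simp
    moreover have "s * sgn (t - t0) = (if t < t0 \<and> \<gamma> t0 \<in> curve then - s else s)"
      using True t(1) by (simp add: sgn_if)
    ultimately show "\<gamma> t \<in> chart_dom c \<and> \<gamma> t \<notin> curve \<and>
      local_sign \<epsilon> (\<gamma> t) c = (if t < t0 \<and> \<gamma> t0 \<in> curve then - s else s)" by metis
  qed
next
  case False
  then have 1: "\<gamma> t0 \<in> topspace S - curve" using loop_topspace by blast
  obtain V where V: "openin S V" "\<gamma> t0 \<in> V" "V \<subseteq> chart_dom c"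
    "\<forall>y\<in>V \<inter> (topspace S - curve). local_sign \<epsilon> y c = local_sign \<epsilon> (\<gamma> t0) c"
    by (rule orients_local[OF or 1 c])
  have "openin S (V \<inter> (topspace S - curve))" using V(1) closed_curve by blast
  moreover have "\<gamma> t0 \<in> V \<inter> (topspace S - curve)" using V(2) 1 by blast
  ultimately obtain d where d: "d > 0" "\<And>t. \<bar>t - t0\<bar> < d \<Longrightarrow> \<gamma> t \<in> V \<inter> (topspace S - curve)"
    using loop_neighbourhood by metis
  have s: "local_sign \<epsilon> (\<gamma> t0) c \<in> {1, -1}" by (rule local_sign_values[where \<epsilon> = \<epsilon>, OF c orients_sign[OF or 1]])
  show thesis
  proof (rule that[OF d(1) s])
    fix t assume "t \<noteq> t0" "\<bar>t - t0\<bar> < d"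
    then have t: "\<gamma> t \<in> V \<inter> (topspace S - curve)" using d(2) by blast
    then have "local_sign \<epsilon> (\<gamma> t) c = local_sign \<epsilon> (\<gamma> t0) c" using V(4) by blast
    then show "\<gamma> t \<in> chart_dom c \<and> \<gamma> t \<notin> curve \<and>
      local_sign \<epsilon> (\<gamma> t) c = (if t < t0 \<and> \<gamma> t0 \<in> curve then - local_sign \<epsilon> (\<gamma> t0) c else local_sign \<epsilon> (\<gamma> t0) c)"
      using t V(3) False by auto
  qed
qed

lemma finite_crossings: "finite {t \<in> {a..b}. \<gamma> t \<in> curve}"
proof -
  have "\<exists>d>0. \<forall>t. t \<noteq> t0 \<longrightarrow> \<bar>t - t0\<bar> < d \<longrightarrow> \<gamma> t \<notin> curve" for t0
  proof -
    obtain c where "c \<in> A" "\<gamma> t0 \<in> chart_dom c" using atlas_cover[OF loop_topspace] by blast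
    then show ?thesis using loop_local by metis
  qed
  then obtain d where d: "\<And>t0. d t0 > 0" "\<And>t0 t. t \<noteq> t0 \<Longrightarrow> \<bar>t - t0\<bar> < d t0 \<Longrightarrow> \<gamma> t \<notin> curve" by metis
  have "{a..b} \<subseteq> (\<Union>t0\<in>{a..b}. ball t0 (d t0))" using d(1) by (auto intro: centre_in_ball[THEN iffD2])
  then obtain T where T: "T \<subseteq> {a..b}" "finite T" "{a..b} \<subseteq> (\<Union>t0\<in>T. ball t0 (d t0))"
    using compactE_image[OF compact_Icc[of a b], of "{a..b}" "\<lambda>t0. ball t0 (d t0)"] by auto
  have "{t \<in> {a..b}. \<gamma> t \<in> curve} \<subseteq> T"
  proof
    fix t assume t: "t \<in> {t \<in> {a..b}. \<gamma> t \<in> curve}"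
    then obtain t0 where "t0 \<in> T" "t \<in> ball t0 (d t0)" using T(3) by blast
    then show "t \<in> T" using d(2)[of t t0] t by (cases "t = t0") (auto simp: dist_real_def abs_minus_commute)
  qed
  then show ?thesis using T(2) finite_subset by blast
qed

text \<open>The orientation is undefined at the crossing times, and charts may be changed at such a
  time. The limit from the right is defined at all times.\<close>

definition right_sign :: "real \<Rightarrow> ('a, real ^ 2) chart \<Rightarrow> real" where
  "right_sign \<tau> c = (SOME s. \<exists>d>0. \<forall>t. \<tau> < t \<and> t < \<tau> + d \<longrightarrow> local_sign \<epsilon> (\<gamma> t) c = s)"

lemma right_sign_eq:
  assumes "d > 0" "\<And>t. \<tau> < t \<Longrightarrow> t < \<tau> + d \<Longrightarrow> local_sign \<epsilon> (\<gamma> t) c = s"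
  shows "right_sign \<tau> c = s"
  unfolding right_sign_def
proof (rule some_equality)
  show "\<exists>d>0. \<forall>t. \<tau> < t \<and> t < \<tau> + d \<longrightarrow> local_sign \<epsilon> (\<gamma> t) c = s" using assms by blast
  fix s' assume "\<exists>d>0. \<forall>t. \<tau> < t \<and> t < \<tau> + d \<longrightarrow> local_sign \<epsilon> (\<gamma> t) c = s'"
  then obtain d' where d': "d' > 0" "\<And>t. \<tau> < t \<Longrightarrow> t < \<tau> + d' \<Longrightarrow> local_sign \<epsilon> (\<gamma> t) c = s'" by blast
  define t where "t = \<tau> + min d d' / 2"
  have "\<tau> < t" "t < \<tau> + d" "t < \<tau> + d'" using assms(1) d'(1) by (auto simp: t_def)
  then show "s' = s" using assms(2)[of t] d'(2)[of t] by simp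
qed

definition crossings :: "real \<Rightarrow> real set" where
  "crossings \<tau> = {t \<in> {0<..\<tau>}. \<gamma> t \<in> curve}"

lemma finite_crossings': "finite (crossings \<tau>)"
  by (rule finite_subset[OF _ finite_crossings[of 0 \<tau>]]) (auto simp: crossings_def)

text \<open>The factor compensates for the reversal at each crossing, so that the value in a chart is
  constant as long as the loop stays in the chart. In other words, this is a local orientation
  transported continuously along the loop.\<close>

definition transported :: "real \<Rightarrow> ('a, real ^ 2) chart \<Rightarrow> real" where
  "transported \<tau> c = (- 1) ^ card (crossings \<tau>) * right_sign \<tau> c"

lemma right_sign_values:
  assumes "c \<in> A" "\<gamma> \<tau> \<in> chart_dom c"
  shows "right_sign \<tau> c \<in> {1, -1}"
proof -
  obtain d s where d: "d > 0" "s \<in> {1, -1}"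
    "\<And>t. t \<noteq> \<tau> \<Longrightarrow> \<bar>t - \<tau>\<bar> < d \<Longrightarrow> \<gamma> t \<in> chart_dom c \<and> \<gamma> t \<notin> curve \<and>
      local_sign \<epsilon> (\<gamma> t) c = (if t < \<tau> \<and> \<gamma> \<tau> \<in> curve then - s else s)"
    using loop_local[OF assms] by metis
  have "right_sign \<tau> c = s"
    by (rule right_sign_eq[OF d(1)]) (use d(3) in auto)
  then show ?thesis using d(2) by simp
qed

lemma transported_change:
  assumes "c \<in> A" "c' \<in> A" "\<gamma> \<tau> \<in> chart_dom c" "\<gamma> \<tau> \<in> chart_dom c'"
  shows "transported \<tau> c' = jacobian_sign c c' (\<gamma> \<tau>) * transported \<tau> c"
proof -
  obtain d s where d: "d > 0" "s \<in> {1, -1}"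
    "\<And>t. t \<noteq> \<tau> \<Longrightarrow> \<bar>t - \<tau>\<bar> < d \<Longrightarrow> \<gamma> t \<in> chart_dom c \<and> \<gamma> t \<notin> curve \<and>
      local_sign \<epsilon> (\<gamma> t) c = (if t < \<tau> \<and> \<gamma> \<tau> \<in> curve then - s else s)"
    using loop_local[OF assms(1,3)] by metis
  obtain V where V: "openin S V" "\<gamma> \<tau> \<in> V" "V \<subseteq> chart_dom c \<inter> chart_dom c'" "\<forall>y\<in>V. jacobian_sign c c' y = jacobian_sign c c' (\<gamma> \<tau>)"
    using jacobian_sign_locally_constant[OF assms] by blast
  obtain d' where d': "d' > 0" "\<And>t. \<bar>t - \<tau>\<bar> < d' \<Longrightarrow> \<gamma> t \<in> V" using loop_neighbourhood[OF V(1,2)] by metis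
  have r: "right_sign \<tau> c = s" by (rule right_sign_eq[OF d(1)]) (use d(3) in auto)
  have "right_sign \<tau> c' = jacobian_sign c c' (\<gamma> \<tau>) * s"
  proof (rule right_sign_eq[of "min d d'"])
    fix t assume t: "\<tau> < t" "t < \<tau> + min d d'"
    then have tV: "\<gamma> t \<in> V" using d'(2) by simp
    have "local_sign \<epsilon> (\<gamma> t) c = s" using d(3)[of t] t by simp
    moreover have "local_sign \<epsilon> (\<gamma> t) c' = jacobian_sign c c' (\<gamma> t) * local_sign \<epsilon> (\<gamma> t) c"
      by (rule local_sign_change[OF assms(1,2)]) (use tV V(3) in blast)+
    moreover have "jacobian_sign c c' (\<gamma> t) = jacobian_sign c c' (\<gamma> \<tau>)" using V(4) tV by blast
    ultimately show "local_sign \<epsilon> (\<gamma> t) c' = jacobian_sign c c' (\<gamma> \<tau>) * s" by simp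
  qed (use d(1) d'(1) in simp)
  then show ?thesis by (simp add: transported_def r)
qed

lemma transported_locally_constant:
  assumes c: "c \<in> A" "\<gamma> \<tau>0 \<in> chart_dom c" and "0 \<le> \<tau>0"
  shows "\<exists>d>0. \<forall>\<tau>\<ge>0. \<bar>\<tau> - \<tau>0\<bar> < d \<longrightarrow> transported \<tau> c = transported \<tau>0 c"
proof -
  obtain d s where d: "d > 0" "s \<in> {1, -1}"
    "\<And>t. t \<noteq> \<tau>0 \<Longrightarrow> \<bar>t - \<tau>0\<bar> < d \<Longrightarrow> \<gamma> t \<in> chart_dom c \<and> \<gamma> t \<notin> curve \<and>
      local_sign \<epsilon> (\<gamma> t) c = (if t < \<tau>0 \<and> \<gamma> \<tau>0 \<in> curve then - s else s)"
    using loop_local[OF c] by metis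
  have r: "right_sign \<tau>0 c = s" by (rule right_sign_eq[OF d(1)]) (use d(3) in auto)
  have "transported \<tau> c = transported \<tau>0 c" if \<tau>: "0 \<le> \<tau>" "\<bar>\<tau> - \<tau>0\<bar> < d" for \<tau>
  proof -
    consider "\<tau> = \<tau>0" | "\<tau> > \<tau>0" | "\<tau> < \<tau>0" by linarith
    then show ?thesis
    proof cases
      case 2
      have "right_sign \<tau> c = s"
        by (rule right_sign_eq[of "d - (\<tau> - \<tau>0)"]) (use d(3) \<tau> 2 in auto)
      moreover have "crossings \<tau> = crossings \<tau>0"
      proof -
        have "t \<le> \<tau>0" if "\<gamma> t \<in> curve" "t \<le> \<tau>" for t
          using d(3)[of t] that \<tau>(2) 2 by (cases "t \<le> \<tau>0") auto
        then show ?thesis using 2 by (auto simp: crossings_def)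
      qed
      ultimately show ?thesis by (simp add: transported_def r)
    next
      case 3
      define s' where "s' = (if \<gamma> \<tau>0 \<in> curve then - s else s)"
      have r': "right_sign \<tau> c = s'"
        by (rule right_sign_eq[of "\<tau>0 - \<tau>"]) (use d(3) \<tau> 3 in \<open>auto simp: s'_def\<close>)
      have no: "\<not> \<tau> < t" if "\<gamma> t \<in> curve" "t < \<tau>0" for t
        using d(3)[of t] that \<tau>(2) by auto
      have \<tau>0: "\<tau>0 > 0" using \<tau>(1) 3 by simp
      show ?thesis
      proof (cases "\<gamma> \<tau>0 \<in> curve")
        case True
        have "crossings \<tau>0 = insert \<tau>0 (crossings \<tau>)"
          using True \<tau>0 3 no unfolding crossings_def by (auto simp: not_less le_less)
        moreover have "\<tau>0 \<notin> crossings \<tau>" using 3 by (simp add: crossings_def)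
        ultimately have "card (crossings \<tau>0) = Suc (card (crossings \<tau>))" using finite_crossings' by simp
        then show ?thesis using True by (simp add: transported_def r r' s'_def)
      next
        case False
        have "crossings \<tau>0 = crossings \<tau>"
          using False 3 no unfolding crossings_def by (auto simp: not_less le_less)
        then show ?thesis using False by (simp add: transported_def r r' s'_def)
      qed
    qed simp
  qed
  then show ?thesis using d(1) by blast
qed

text \<open>Transport around the loop once, in the successive charts of the chain. Within a chart nothing
  changes, a change of chart contributes its Jacobian sign, so the total factor is the product of
  these signs. On the other hand the loop is periodic, so the orientation on the right of time \<open>1\<close> is that
  on the right of time \<open>0\<close>, and the transported values differ by the parity of the crossings only. In
  particular the sum is the same for all chains.\<close>

lemma w1_sum_eq_crossings:
  assumes "chart_chain A \<gamma> n t c"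
  shows "(\<Sum>i<n. w1_cocycle (c i) (c (Suc i mod n)) (\<gamma> (t (Suc i)))) = of_nat (card (crossings 1))"
proof -
  have t: "t 0 = 0" "t n = 1" "\<And>i. i < n \<Longrightarrow> t i < t (Suc i)" and cA: "\<And>i. i < n \<Longrightarrow> c i \<in> A"
    and dom: "\<And>i x. i < n \<Longrightarrow> t i \<le> x \<Longrightarrow> x \<le> t (Suc i) \<Longrightarrow> \<gamma> x \<in> chart_dom (c i)"
    using assms unfolding chart_chain_def by (auto simp: image_subset_iff)
  have n0: "n > 0" using t(1,2) by (auto intro: gr0I)
  have t_nn: "t i \<ge> 0" if "i \<le> n" for i
    using that
  proof (induction i)
    case (Suc i)
    then show ?case using t(3)[of i] by simp
  qed (simp add: t(1))
  have g1: "\<gamma> 1 = \<gamma> 0" using loop_periodic[of 0] by simp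
  define \<sigma> where "\<sigma> i = jacobian_sign (c i) (c (Suc i mod n)) (\<gamma> (t (Suc i)))" for i
  have next_dom: "c (Suc i mod n) \<in> A" "\<gamma> (t (Suc i)) \<in> chart_dom (c (Suc i mod n))" if i: "i < n" for i
  proof -
    show "c (Suc i mod n) \<in> A" using cA n0 by simp
    show "\<gamma> (t (Suc i)) \<in> chart_dom (c (Suc i mod n))"
    proof (cases "Suc i = n")
      case True
      then have "t (Suc i) = 1" using t(2) by simp
      then show ?thesis using True g1 dom[of 0 0] n0 t(1) t(3)[of 0] by simp
    next
      case False
      then have "Suc i < n" using i by simp
      then show ?thesis using dom[of "Suc i" "t (Suc i)"] t(3)[of "Suc i"] by simp
    qed
  qed
  have step: "transported (t (Suc i)) (c i) = transported (t i) (c i)" if i: "i < n" for i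
  proof (rule real_locally_constant[of "t i" "t (Suc i)" "\<lambda>\<tau>. transported \<tau> (c i)"])
    show "t i \<le> t (Suc i)" using t(3)[OF i] by simp
    fix x assume x: "t i \<le> x" "x \<le> t (Suc i)"
    have ti: "0 \<le> t i" using t_nn i by simp
    then have "0 \<le> x" using x(1) by simp
    then obtain d where d: "d > 0" "\<forall>\<tau>\<ge>0. \<bar>\<tau> - x\<bar> < d \<longrightarrow> transported \<tau> (c i) = transported x (c i)"
      using transported_locally_constant[OF cA[OF i] dom[OF i x]] by blast
    have "transported y (c i) = transported x (c i)" if "y \<in> {t i..t (Suc i)}" "\<bar>y - x\<bar> < d" for y
    proof -
      have "y \<ge> 0" using that(1) ti by simp
      then show ?thesis using d(2) that(2) by blast
    qed
    then show "\<exists>d>0. \<forall>y\<in>{t i..t (Suc i)}. \<bar>y - x\<bar> < d \<longrightarrow> transported y (c i) = transported x (c i)"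
      using d(1) by blast
  qed
  have "transported (t k) (c (k mod n)) = (\<Prod>i<k. \<sigma> i) * transported 0 (c 0)" if "k \<le> n" for k
    using that
  proof (induction k)
    case 0
    then show ?case by (simp add: t(1))
  next
    case (Suc k)
    then have k: "k < n" by simp
    have "transported (t (Suc k)) (c (Suc k mod n)) = \<sigma> k * transported (t (Suc k)) (c k)"
      unfolding \<sigma>_def
      by (rule transported_change[OF cA[OF k] next_dom(1)[OF k] dom[OF k] next_dom(2)[OF k]])
        (use t(3)[OF k] in auto)
    also have "\<dots> = \<sigma> k * ((\<Prod>i<k. \<sigma> i) * transported 0 (c 0))"
      using step[OF k] Suc k by simp
    finally show ?case by (simp add: mult_ac)
  qed
  \<comment> \<open>After \<open>n\<close> steps the chart is \<open>c 0\<close> again, because \<open>n mod n = 0\<close>.\<close>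
  from this[of n] have tot: "transported 1 (c 0) = (\<Prod>i<n. \<sigma> i) * transported 0 (c 0)" by (simp add: t(2))
  have c0: "c 0 \<in> A" "\<gamma> 0 \<in> chart_dom (c 0)" using cA n0 dom[of 0 0] t(1) t(3)[of 0] by simp_all
  have rv: "right_sign 1 (c 0) = right_sign 0 (c 0)"
  proof -
    obtain d s where d: "d > 0" "s \<in> {1, -1}"
      "\<And>t. t \<noteq> 0 \<Longrightarrow> \<bar>t - 0\<bar> < d \<Longrightarrow> \<gamma> t \<in> chart_dom (c 0) \<and> \<gamma> t \<notin> curve \<and>
        local_sign \<epsilon> (\<gamma> t) (c 0) = (if t < 0 \<and> \<gamma> 0 \<in> curve then - s else s)"
      using loop_local[OF c0] by metis
    have "right_sign 0 (c 0) = s" by (rule right_sign_eq[OF d(1)]) (use d(3) in auto)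
    moreover have "right_sign 1 (c 0) = s"
    proof (rule right_sign_eq[OF d(1)])
      fix t :: real assume "1 < t" "t < 1 + d"
      then show "local_sign \<epsilon> (\<gamma> t) (c 0) = s" using d(3)[of "t - 1"] loop_periodic[of "t - 1"] by simp
    qed
    ultimately show ?thesis by simp
  qed
  have "crossings 0 = {}" by (simp add: crossings_def)
  then have "(- 1) ^ card (crossings 1) * right_sign 0 (c 0) = (\<Prod>i<n. \<sigma> i) * right_sign 0 (c 0)"
    using tot by (simp add: transported_def rv)
  then have "(- 1) ^ card (crossings 1) = (\<Prod>i<n. \<sigma> i)"
    using right_sign_values[OF c0] by auto
  also have "\<dots> = (\<Prod>i<n. if w1_cocycle (c i) (c (Suc i mod n)) (\<gamma> (t (Suc i))) = 0 then 1 else - 1)"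
  proof (rule prod.cong)
    fix i assume "i \<in> {..<n}"
    then have i: "i < n" by simp
    show "\<sigma> i = (if w1_cocycle (c i) (c (Suc i mod n)) (\<gamma> (t (Suc i))) = 0 then 1 else - 1)"
      unfolding \<sigma>_def
      by (rule w1_cocycle_jsign[OF cA[OF i] next_dom(1)[OF i] dom[OF i] next_dom(2)[OF i]])
        (use t(3)[OF i] in auto)
  qed simp
  also have "\<dots> = (if (\<Sum>i<n. w1_cocycle (c i) (c (Suc i mod n)) (\<gamma> (t (Suc i)))) = 0 then 1 else - 1)"
    by (rule prod_signs_bit)
  finally show ?thesis
    unfolding power_minus_one_bit by (auto split: if_splits)
qed

text \<open>The transport counts a crossing at the base point at the end of the period, the theorem at its
  beginning.\<close>

lemma card_crossings: "card (crossings 1) = card {t \<in> {0..<1}. \<gamma> t \<in> curve}"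
proof (rule bij_betw_same_card[of "\<lambda>t. if t = 1 then 0 else t"])
  have g1: "\<gamma> 1 = \<gamma> 0" using loop_periodic[of 0] by simp
  show "bij_betw (\<lambda>t. if t = 1 then 0 else t) (crossings 1) {t \<in> {0..<1}. \<gamma> t \<in> curve}"
    by (rule bij_betwI[where g = "\<lambda>t. if t = 0 then 1 else t"])
      (use g1 in \<open>auto simp: crossings_def le_less split: if_splits\<close>)
qed

lemma w1_on_loop_eq: "w1_on_loop A \<gamma> = of_nat (card {t \<in> {0..<1}. \<gamma> t \<in> curve})"
  unfolding w1_on_loop_def card_crossings[symmetric]
proof (rule the_equality)
  show "\<exists>n t c. chart_chain A \<gamma> n t c \<and>
      of_nat (card (crossings 1)) = (\<Sum>i<n. w1_cocycle (c i) (c (Suc i mod n)) (\<gamma> (t (Suc i))))"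
    using chart_chain_exists[OF loop_continuous] w1_sum_eq_crossings by metis
  show "w = of_nat (card (crossings 1))" if "\<exists>n t c. chart_chain A \<gamma> n t c \<and>
      w = (\<Sum>i<n. w1_cocycle (c i) (c (Suc i mod n)) (\<gamma> (t (Suc i))))" for w
  proof -
    from that obtain n t c where "chart_chain A \<gamma> n t c"
      "w = (\<Sum>i<n. w1_cocycle (c i) (c (Suc i mod n)) (\<gamma> (t (Suc i))))" by blast
    then show ?thesis using w1_sum_eq_crossings[of n t c] by simp
  qed
qed

end

section \<open>The dual of the first Stiefel--Whitney class\<close>

theorem theorem7:
  fixes S :: "'a topology" and A :: "('a, real ^ 2) chart set"
    and M :: "'b topology" and B :: "('b, real) chart set"
    and f :: "'b \<Rightarrow> 'a"
  assumes "surface S A"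
    and "closed_1_manifold M B"
    and "generic_immersion M B S A f"
    and "orientable_chord_diagram M B (chords M f)"
    and "\<And>F. F \<in> connected_components_of (subtopology S (topspace S - f ` topspace M)) \<Longrightarrow>
           subtopology S F homeomorphic_space top_of_set (ball (0 :: real ^ 2) 1)"
  shows "realizes_dual_w1 M B S A f"
proof -
  obtain dir where dir: "chord_diagram_orientation M B (chords M f) dir"
    using assms(4) unfolding orientable_chord_diagram_def by blast
  interpret oriented_generic_curve S A M B f dir
    by unfold_locales (fact assms(1-3) dir)+
  obtain \<epsilon> where \<epsilon>: "orients (topspace S - curve) \<epsilon>" "\<And>p. regular p \<Longrightarrow> adapted \<epsilon> p"
    using complement_orientation[OF assms(5)] by blast
  show ?thesis
    unfolding realizes_dual_w1_def
  proof (intro allI impI)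
    fix \<gamma> assume "smooth_loop S A \<gamma> \<and> general_position M B A f \<gamma>"
    then interpret loop_across_curve S A M B f dir \<epsilon> \<gamma>
      by unfold_locales (use \<epsilon> in auto)
    show "w1_on_loop A \<gamma> = of_nat (card {t \<in> {0..<1}. \<gamma> t \<in> f ` topspace M})"
      by (rule w1_on_loop_eq)
  qed
qed

end
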